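(* Let $N\geq3$, let $\Omega\subset\mathbb{R}^N$ be a nonempty smooth, open and bounded set, and let $(\Lambda,u)\in\mathbb{R}\times H^1(\mathbb{R}^N)$ with $u\neq0$ be a solution to $$-\Delta u=\Lambda Q_\Omega u\quad\text{in }\mathbb{R}^N.$$ If $\Omega$ is starshaped (or the disjoint union of starshaped sets), then $\Lambda>0$.
   Context: $Q_\Omega(x):=1$ if $x\in\Omega$ and $Q_\Omega(x):=-1$ if $x\in\mathbb{R}^N\setminus\Omega$. The equation is understood weakly: $\int_{\mathbb{R}^N}\nabla u\cdot\nabla\varphi=\Lambda\int_{\mathbb{R}^N}Q_\Omega u\varphi$ for all $\varphi\in C_c^\infty(\mathbb{R}^N)$. *)

theory Defs
  imports "HOL-Analysis.Analysis"
begin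

text \<open>The derivatives of order \<open>\<le> k\<close> exist everywhere and are continuous. Since
  \<^const>\<open>frechet_derivative\<close> is arbitrary where a function is not differentiable,
  differentiability is required at every stage.\<close>

primrec Ck :: "nat \<Rightarrow> ('a::euclidean_space \<Rightarrow> real) \<Rightarrow> bool" where
  "Ck 0 f \<longleftrightarrow> continuous_on UNIV f"
| "Ck (Suc k) f \<longleftrightarrow> f differentiable_on UNIV \<and> (\<forall>v. Ck k (\<lambda>x. frechet_derivative f (at x) v))"

definition smooth :: "('a::euclidean_space \<Rightarrow> real) \<Rightarrow> bool" where
  "smooth f \<longleftrightarrow> (\<forall>k. Ck k f)"

definition test_function :: "('a::euclidean_space \<Rightarrow> real) \<Rightarrow> bool" where
  "test_function \<phi> \<longleftrightarrow> smooth \<phi> \<and> compact (closure {x. \<phi> x \<noteq> 0})"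

definition grad :: "('a::euclidean_space \<Rightarrow> real) \<Rightarrow> 'a \<Rightarrow> 'a" where
  "grad \<phi> x = (\<Sum>b\<in>Basis. frechet_derivative \<phi> (at x) b *\<^sub>R b)"

text \<open>Elements of \<open>L\<^sup>2\<close> and \<open>H\<^sup>1\<close> are represented by Lebesgue measurable functions rather than by
  equivalence classes, so equality of such elements is equality almost everywhere.\<close>

definition L2 :: "('a::euclidean_space \<Rightarrow> 'b::euclidean_space) \<Rightarrow> bool" where
  "L2 f \<longleftrightarrow> f \<in> borel_measurable lebesgue \<and> integrable lebesgue (\<lambda>x. (norm (f x))\<^sup>2)"

definition locally_integrable :: "('a::euclidean_space \<Rightarrow> 'b::euclidean_space) \<Rightarrow> bool" where
  "locally_integrable f \<longleftrightarrow> (\<forall>K. compact K \<longrightarrow> set_integrable lebesgue K f)"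

text \<open>The vector identity collects the \<open>N\<close> scalar ones
  \<open>\<integral> u \<partial>\<^sub>i\<phi> = - \<integral> g\<^sub>i \<phi>\<close>. A weak gradient is unique up to null sets.\<close>

definition has_weak_gradient :: "('a::euclidean_space \<Rightarrow> real) \<Rightarrow> ('a \<Rightarrow> 'a) \<Rightarrow> bool" where
  "has_weak_gradient u g \<longleftrightarrow> locally_integrable u \<and> locally_integrable g \<and>
     (\<forall>\<phi>. test_function \<phi> \<longrightarrow>
        (LINT x|lebesgue. u x *\<^sub>R grad \<phi> x) = - (LINT x|lebesgue. \<phi> x *\<^sub>R g x))"

definition H1 :: "('a::euclidean_space \<Rightarrow> real) \<Rightarrow> bool" where
  "H1 u \<longleftrightarrow> L2 u \<and> (\<exists>g. has_weak_gradient u g \<and> L2 g)"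

definition Q :: "'a set \<Rightarrow> 'a \<Rightarrow> real" where
  "Q \<Omega> x = (if x \<in> \<Omega> then 1 else - 1)"

text \<open>Weak solutions of \<open>-\<Delta> u = \<Lambda> Q\<^sub>\<Omega> u\<close> in the whole space.\<close>

definition weak_solution :: "'a::euclidean_space set \<Rightarrow> real \<Rightarrow> ('a \<Rightarrow> real) \<Rightarrow> bool" where
  "weak_solution \<Omega> \<Lambda> u \<longleftrightarrow> (\<exists>g. has_weak_gradient u g \<and>
     (\<forall>\<phi>. test_function \<phi> \<longrightarrow>
        (LINT x|lebesgue. g x \<bullet> grad \<phi> x) = \<Lambda> * (LINT x|lebesgue. Q \<Omega> x * u x * \<phi> x)))"

text \<open>Locally \<open>\<Omega>\<close> lies on one side of the graph of a smooth function \<open>\<gamma>\<close> over a hyperplane with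
  unit normal \<open>e\<close>. The point \<open>x - (x \<bullet> e) e\<close> is the orthogonal projection of \<open>x\<close> onto that
  hyperplane, so only the values of \<open>\<gamma>\<close> on the hyperplane matter.\<close>

definition smooth_boundary :: "'a::euclidean_space set \<Rightarrow> bool" where
  "smooth_boundary \<Omega> \<longleftrightarrow>
     (\<forall>p\<in>frontier \<Omega>. \<exists>r>0. \<exists>e \<gamma>. norm e = 1 \<and> smooth \<gamma> \<and>
        \<Omega> \<inter> ball p r = {x \<in> ball p r. x \<bullet> e > \<gamma> (x - (x \<bullet> e) *\<^sub>R e)})"

text \<open>The members of the family have to be open: every set is the disjoint union of its singletons,
  which are starshaped. For a bounded set with smooth boundary such a family
  consists of the connected components and is finite.\<close>

definition disjoint_union_of_starshaped :: "'a::euclidean_space set \<Rightarrow> bool" where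
  "disjoint_union_of_starshaped \<Omega> \<longleftrightarrow>
     (\<exists>\<S>. pairwise disjnt \<S> \<and> (\<forall>S\<in>\<S>. open S \<and> starlike S) \<and> \<Union>\<S> = \<Omega>)"

end

theory Submission
  imports Defs
begin

text \<open>
  Suppose that \<open>\<Lambda> \<le> 0\<close>; it is shown that \<open>u\<close> vanishes almost everywhere.

  If \<open>\<Lambda> = 0\<close>, then \<open>u\<close> is harmonic on the whole space and \<open>u\<close> and \<open>\<nabla>u\<close> are square integrable. The
  field \<open>- u \<nabla>u\<close> has divergence \<open>- |\<nabla>u|\<^sup>2\<close> and integrable norm, so \<open>\<nabla>u = 0\<close>, and the
  only square integrable constant is \<open>0\<close>.

  If \<open>\<Lambda> = - k\<^sup>2 < 0\<close>, the equation reads \<open>(\<Delta> + k\<^sup>2) u = F\<close> with \<open>F = 2 k\<^sup>2 u\<close> on \<open>\<Omega>\<close> and \<open>F = 0\<close>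
  elsewhere. Thus \<open>k\<^sup>2\<close> would be an eigenvalue of the operator \<open>- \<Delta> + 2 k\<^sup>2 1\<^sub>\<Omega>\<close> inside its
  continuous spectrum, which a bounded potential of compact support does not allow. The proof is a
  Carleman inequality with a weight that stays bounded at infinity. Fix a centre \<open>c\<close> at distance at least
  \<open>2\<close> from \<open>\<Omega>\<close>, put \<open>s = |x - c|\<^sup>2\<close> and let \<open>\<phi> = \<Phi>(s)\<close>. Multiply the equation satisfied by
  \<open>v = e\<^sup>\<phi> u\<close> by \<open>G = 2 (x - c) \<bullet> \<nabla>v + (N - 1) v\<close>, the generator of dilations about \<open>c\<close> up to a multiple of \<open>v\<close>. Up to a
  divergence, the result is a sum of squares with favourable sign and a term \<open>J v\<^sup>2\<close>, where \<open>J\<close> depends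
  only on \<open>\<Phi>\<close> and \<open>k\<close>, and it follows that
  \<open>\<integral> J e\<^sup>2\<^sup>\<phi> u\<^sup>2 \<le> \<integral> (S + \<nu>) e\<^sup>2\<^sup>\<phi> F\<^sup>2 + \<nu> e\<^sup>2\<^sup>\<phi> u\<^sup>2 1\<^sub>B\<close>
  with \<open>\<nu> = (N - 1) / 2\<close> and an annulus \<open>B = {1 \<le> s \<le> S}\<close> around \<open>\<Omega>\<close>
  (\<open>carleman_flux_divergence\<close>, \<open>carleman_inequality\<close>). There are weights for which \<open>J\<close> exceeds any given
  constant on \<open>B\<close> and has a positive lower bound everywhere (\<open>carleman_weight_exists\<close>). Since
  \<open>F\<^sup>2 \<le> 4 k\<^sup>4 u\<^sup>2\<close>, with \<open>F\<close> supported in \<open>B\<close>, such a weight leaves no room for a nonzero \<open>u\<close>.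

  All integrations by parts take place on mollifications \<open>K * u\<close>, which are twice continuously
  differentiable, and the two integrals pass to the limit because \<open>K * u\<close> and \<open>K * F\<close> converge in
  \<open>L\<^sup>2\<close> (\<open>mollified_solution\<close>, \<open>mollify_tendsto\<close>). Boundedness of the weight is what makes this work
  for a function of which no decay beyond square integrability is known.
\<close>

section \<open>Integrating a divergence over the whole space\<close>

lemma integral_lborel_translate:
  fixes f :: "'a::euclidean_space \<Rightarrow> 'b::{banach, second_countable_topology}"
  assumes [measurable]: "f \<in> borel_measurable borel"
  shows "(LINT x|lborel. f (x + t)) = (LINT x|lborel. f x)"
proof -
  have "(LINT x|lborel. f x) = (LINT x|distr lborel borel ((+) t). f x)"
    by (simp add: lborel_distr_plus)
  also have "\<dots> = (LINT x|lborel. f (t + x))"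
    by (rule integral_distr) auto
  finally show ?thesis by (simp add: add.commute)
qed

lemma has_derivative_continuous_UNIV:
  "(\<And>x. (f has_derivative f' x) (at x)) \<Longrightarrow> continuous_on UNIV f"
  by (rule has_derivative_continuous_on[of UNIV f f']) simp

lemma continuous_compact_support_bounded:
  fixes f :: "'a::euclidean_space \<Rightarrow> 'b::real_normed_vector"
  assumes "continuous_on UNIV f" and "\<And>x. norm x \<ge> R \<Longrightarrow> f x = 0"
  obtains B where "B > 0" "\<And>x. norm (f x) \<le> B"
proof -
  have "compact (f ` cball 0 R)"
    by (rule compact_continuous_image[OF continuous_on_subset[OF assms(1)]]) auto
  then obtain B where B: "B > 0" "\<And>y. y \<in> f ` cball 0 R \<Longrightarrow> norm y \<le> B"
    using compact_imp_bounded bounded_pos by metis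
  have "norm (f x) \<le> B" for x
    using B assms(2)[of x] by (cases "norm x \<le> R") auto
  with B(1) that show ?thesis by blast
qed

lemma integrable_on_bounded_support:
  fixes f :: "'a::euclidean_space \<Rightarrow> 'b::{banach, second_countable_topology}"
  assumes [measurable]: "f \<in> borel_measurable borel"
    and "\<And>x. norm (f x) \<le> B" and "\<And>x. norm x \<ge> R \<Longrightarrow> f x = 0"
  shows "integrable lborel f"
proof (rule Bochner_Integration.integrable_bound[where f = "\<lambda>x. B * indicat_real (cball 0 R) x"])
  have "0 \<le> B" using assms(2) norm_ge_zero order_trans by blast
  show "integrable lborel (\<lambda>x. B * indicat_real (cball (0::'a) R) x)"
    by (intro integrable_mult_right integrable_real_indicator emeasure_bounded_finite) auto
  show "AE x in lborel. norm (f x) \<le> norm (B * indicat_real (cball 0 R) x)"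
    using assms(2,3) \<open>0 \<le> B\<close> by (intro AE_I2) (auto simp: indicator_def not_le intro: less_imp_le)
qed auto

lemma derivative_zero_outside:
  fixes F :: "'a::euclidean_space \<Rightarrow> 'b::real_normed_vector"
  assumes "(F has_derivative F') (at x)" and "\<And>x. norm x \<ge> R \<Longrightarrow> F x = 0" and "norm x > R"
  shows "F' h = 0"
proof -
  have "open (- cball (0::'a) R)" by auto
  then have "((\<lambda>_. 0) has_derivative F') (at x)"
    by (rule has_derivative_transform_within_open[OF assms(1)]) (use assms(2,3) in auto)
  then have "F' = (\<lambda>_. 0)" using has_derivative_const has_derivative_unique by blast
  then show ?thesis by simp
qed

text \<open>The difference quotients of \<open>F\<close> integrate to zero because Lebesgue measure is invariant under
  translations, and they converge boundedly to the directional derivative.\<close>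

lemma integral_directional_derivative_zero:
  fixes F :: "'a::euclidean_space \<Rightarrow> real"
  assumes F: "\<And>x. (F has_derivative F' x) (at x)"
    and cont: "continuous_on UNIV (\<lambda>x. F' x b)"
    and supp: "\<And>x. norm x \<ge> R \<Longrightarrow> F x = 0"
  shows "integrable lborel (\<lambda>x. F' x b)" and "(LINT x|lborel. F' x b) = 0"
proof -
  have supp': "F' x b = 0" if "norm x \<ge> R + 1" for x
    using derivative_zero_outside[OF F supp, of R] that by auto
  obtain B where B: "B > 0" "\<And>x. norm (F' x b) \<le> B"
    using continuous_compact_support_bounded[OF cont supp'] by blast
  have contF: "continuous_on UNIV F"
    by (rule has_derivative_continuous_UNIV[OF F])
  have [measurable]: "F \<in> borel_measurable borel" "(\<lambda>x. F' x b) \<in> borel_measurable borel"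
    by (auto intro!: borel_measurable_continuous_onI contF cont)
  obtain BF where BF: "BF > 0" "\<And>x. norm (F x) \<le> BF"
    using continuous_compact_support_bounded[OF contF supp] by blast
  have intF: "integrable lborel F"
    by (rule integrable_on_bounded_support[OF _ BF(2) supp]) auto
  show "integrable lborel (\<lambda>x. F' x b)"
    by (rule integrable_on_bounded_support[OF _ B(2) supp']) auto
  define e where "e n = inverse (real (Suc n))" for n
  have e: "0 < e n" "e n \<le> 1" for n by (auto simp: e_def field_simps)
  have e0: "e \<longlonglongrightarrow> 0" unfolding e_def by (rule LIMSEQ_inverse_real_of_nat)
  define q where "q n x = (F (x + e n *\<^sub>R b) - F x) / e n" for n x
  have line: "((\<lambda>t. F (x + t *\<^sub>R b)) has_real_derivative F' (x + t *\<^sub>R b) b) (at t)" for x t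
  proof -
    interpret bounded_linear "F' (x + t *\<^sub>R b)" by (rule has_derivative_bounded_linear[OF F])
    have "((\<lambda>t. F (x + t *\<^sub>R b)) has_derivative (\<lambda>h. F' (x + t *\<^sub>R b) (h *\<^sub>R b))) (at t)"
      by (rule has_derivative_compose[OF _ F]) (auto intro!: derivative_eq_intros)
    moreover have "(\<lambda>h. F' (x + t *\<^sub>R b) (h *\<^sub>R b)) = (*) (F' (x + t *\<^sub>R b) b)"
      by (auto simp: scaleR fun_eq_iff)
    ultimately show ?thesis by (simp add: has_field_derivative_def)
  qed
  have qlim: "(\<lambda>n. q n x) \<longlonglongrightarrow> F' x b" for x
  proof -
    have "((\<lambda>h. (F (x + (0 + h) *\<^sub>R b) - F (x + 0 *\<^sub>R b)) / h) \<longlongrightarrow> F' (x + 0 *\<^sub>R b) b) (at 0)"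
      using line[of x 0] by (simp only: DERIV_def)
    then have L: "((\<lambda>h. (F (x + h *\<^sub>R b) - F x) / h) \<longlongrightarrow> F' x b) (at 0)" by simp
    have "filterlim e (at 0) sequentially"
      using e0 e(1) by (auto simp: filterlim_at intro!: always_eventually dest: less_imp_neq[symmetric])
    from filterlim_compose[OF L this] show ?thesis by (simp add: q_def)
  qed
  have qbd: "\<bar>q n x\<bar> \<le> B" for n x
  proof -
    obtain z where z: "F (x + e n *\<^sub>R b) - F (x + 0 *\<^sub>R b) = (e n - 0) * F' (x + z *\<^sub>R b) b"
      using MVT2[OF e(1)[of n], of "\<lambda>t. F (x + t *\<^sub>R b)" "\<lambda>t. F' (x + t *\<^sub>R b) b"] line by blast
    then have "q n x = F' (x + z *\<^sub>R b) b" using e(1)[of n] by (simp add: q_def)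
    then show ?thesis using B(2)[of "x + z *\<^sub>R b"] by simp
  qed
  have qsupp: "q n x = 0" if "norm x \<ge> R + norm b" for n x
  proof -
    have "norm x \<le> norm (x + e n *\<^sub>R b) + e n * norm b"
      using norm_triangle_ineq4[of "x + e n *\<^sub>R b" "e n *\<^sub>R b"] e(1)[of n] by simp
    moreover have "e n * norm b \<le> norm b" using e[of n] by (simp add: mult_left_le_one_le)
    ultimately have "norm (x + e n *\<^sub>R b) \<ge> R" "norm x \<ge> R" using that norm_ge_zero[of b] by linarith+
    then show ?thesis using supp by (simp add: q_def)
  qed
  have "(\<lambda>n. LINT x|lborel. q n x) \<longlonglongrightarrow> (LINT x|lborel. F' x b)"
  proof (rule integral_dominated_convergence[where w = "\<lambda>x. B * indicat_real (cball 0 (R + norm b)) x"])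
    show "(\<lambda>x. F' x b) \<in> borel_measurable lborel" by simp
    show "q n \<in> borel_measurable lborel" for n unfolding q_def[abs_def] by simp
    show "integrable lborel (\<lambda>x. B * indicat_real (cball (0::'a) (R + norm b)) x)"
      by (intro integrable_mult_right integrable_real_indicator emeasure_bounded_finite) auto
    show "AE x in lborel. (\<lambda>n. q n x) \<longlonglongrightarrow> F' x b" using qlim by auto
    show "AE x in lborel. norm (q n x) \<le> B * indicat_real (cball 0 (R + norm b)) x" for n
      using qbd qsupp by (intro AE_I2) (auto simp: indicator_def not_le intro: less_imp_le)
  qed
  moreover have "(LINT x|lborel. q n x) = 0" for n
  proof -
    have i: "integrable lborel (\<lambda>x. F (x + e n *\<^sub>R b))"
    proof (rule integrable_on_bounded_support[where B=BF and R="R + norm b"])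
      show "F (x + e n *\<^sub>R b) = 0" if "norm x \<ge> R + norm b" for x
      proof -
        have "norm x \<le> norm (x + e n *\<^sub>R b) + e n * norm b"
          using norm_triangle_ineq4[of "x + e n *\<^sub>R b" "e n *\<^sub>R b"] e(1)[of n] by simp
        moreover have "e n * norm b \<le> norm b" using e[of n] by (simp add: mult_left_le_one_le)
        ultimately show ?thesis using that by (intro supp) linarith
      qed
    qed (use BF in auto)
    show ?thesis
      unfolding q_def using integral_lborel_translate[of F "e n *\<^sub>R b"] i intF
      by (simp add: Bochner_Integration.integral_diff)
  qed
  ultimately show "(LINT x|lborel. F' x b) = 0"
    by (simp add: LIMSEQ_const_iff)
qed

definition tr :: "('a::euclidean_space \<Rightarrow> 'a) \<Rightarrow> real" where
  "tr L = (\<Sum>b\<in>Basis. L b \<bullet> b)"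

lemma tr_add: "tr (\<lambda>h. L h + M h) = tr L + tr M"
  by (simp add: tr_def inner_add_left sum.distrib)

lemma tr_scaleR: "tr (\<lambda>h. t *\<^sub>R L h) = t * tr L"
  by (simp add: tr_def sum_distrib_left)

lemma tr_minus: "tr (\<lambda>h. - L h) = - tr L"
  by (simp add: tr_def sum_negf)

lemma tr_id: "tr (\<lambda>h::'a::euclidean_space. h) = DIM('a)"
  by (simp add: tr_def)

lemma tr_rank_one: "tr (\<lambda>h::'a::euclidean_space. (u \<bullet> h) *\<^sub>R v) = u \<bullet> v"
  by (simp add: tr_def euclidean_inner[of u v])

lemmas tr_simps = tr_add tr_scaleR tr_minus tr_id tr_rank_one

text \<open>For cutoffs \<open>ct n\<close> of radius \<open>r n\<close>, the integral of \<open>ct n\<close> times the divergence of \<open>Z\<close> equals minus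
  the integral of \<open>\<nabla>(ct n) \<bullet> Z\<close>. The latter tends to zero: the gradient of the cutoff is of order
  \<open>1 / r n\<close> on a ball of radius \<open>r n\<close>, which absorbs the factor \<open>1 + norm x\<close> in the growth condition.
  Bounding the divergence from above by \<open>h\<close>, rather than asking that it be integrable, allows
  nonnegative terms of uncontrolled size to be discarded first.\<close>

lemma integral_nonneg_of_divergence_le:
  fixes Z :: "'a::euclidean_space \<Rightarrow> 'a"
  assumes Z: "\<And>x. (Z has_derivative Z' x) (at x)"
    and cont: "\<And>b. continuous_on UNIV (\<lambda>x. Z' x b)"
    and growth: "\<And>x. norm (Z x) \<le> (1 + norm x) * l x" and l: "integrable lborel l"
    and div: "\<And>x. tr (Z' x) \<le> h x" and h: "integrable lborel h"
  shows "0 \<le> (LINT x|lborel. h x)"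
proof -
  define r where "r n = real (Suc n)" for n
  have r1: "r n \<ge> 1" for n by (simp add: r_def)
  define pos :: "real \<Rightarrow> real" where "pos t = max 0 t" for t
  \<comment> \<open>The square of the positive part is continuously differentiable, also at \<open>0\<close>.\<close>
  have posd: "((\<lambda>t. (pos t)\<^sup>2) has_real_derivative 2 * pos t) (at t)" for t
  proof (cases "t = 0")
    case True
    have "((\<lambda>h. ((pos (0 + h))\<^sup>2 - (pos 0)\<^sup>2) / h) \<longlongrightarrow> 0) (at 0)"
    proof (rule Lim_null_comparison[where g = "\<lambda>h. \<bar>h\<bar>"])
      show "\<forall>\<^sub>F h in at 0. norm (((pos (0 + h))\<^sup>2 - (pos 0)\<^sup>2) / h) \<le> \<bar>h\<bar>"
        by (intro always_eventually) (auto simp: pos_def max_def power2_eq_square)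
      show "((\<lambda>h::real. \<bar>h\<bar>) \<longlongrightarrow> 0) (at 0)" by (rule tendsto_rabs_zero) (rule tendsto_ident_at)
    qed
    then show ?thesis using True by (simp add: DERIV_def pos_def)
  next
    case False
    show ?thesis
    proof (cases "t > 0")
      case True
      have "((\<lambda>t. t\<^sup>2) has_real_derivative 2 * t) (at t)"
        by (auto intro!: derivative_eq_intros)
      then have "((\<lambda>t. (pos t)\<^sup>2) has_real_derivative 2 * t) (at t)"
        by (rule has_field_derivative_transform_within_open[where S="{0<..}"]) (use True in \<open>auto simp: pos_def\<close>)
      then show ?thesis using True by (simp add: pos_def)
    next
      case F2: False
      have "((\<lambda>t::real. 0) has_real_derivative 0) (at t)" by simp
      then have "((\<lambda>t. (pos t)\<^sup>2) has_real_derivative 0) (at t)"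
        by (rule has_field_derivative_transform_within_open[where S="{..<0}"])
          (use F2 False in \<open>auto simp: pos_def max_def\<close>)
      then show ?thesis using F2 False by (simp add: pos_def)
    qed
  qed
  \<comment> \<open>A cutoff that is continuously differentiable and tends to 1 pointwise; \<open>1 + norm x\<close> times its
    gradient stays bounded and tends to 0 pointwise.\<close>
  define ct where "ct n x = (pos (1 - (x \<bullet> x) / (r n)\<^sup>2))\<^sup>2" for n and x :: 'a
  define ct' where "ct' n x = (- 4 * pos (1 - (x \<bullet> x) / (r n)\<^sup>2) / (r n)\<^sup>2) *\<^sub>R x" for n and x :: 'a
  have dct: "(ct n has_derivative (\<lambda>h. ct' n x \<bullet> h)) (at x)" for n x
  proof -
    have "((\<lambda>x. 1 - (x \<bullet> x) / (r n)\<^sup>2) has_derivative (\<lambda>h. - (2 * (x \<bullet> h)) / (r n)\<^sup>2)) (at x)"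
    proof -
      have "((\<lambda>x. 1 - c * (x \<bullet> x)) has_derivative (\<lambda>h. - (c * (2 * (x \<bullet> h))))) (at x)" for c :: real
        by (auto intro!: derivative_eq_intros simp: inner_commute)
      from this[of "1 / (r n)\<^sup>2"] show ?thesis by simp
    qed
    from has_derivative_compose[OF this posd[unfolded has_field_derivative_def]]
    have "((\<lambda>x. (pos (1 - (x \<bullet> x) / (r n)\<^sup>2))\<^sup>2) has_derivative
       (\<lambda>h. 2 * pos (1 - (x \<bullet> x) / (r n)\<^sup>2) * (- (2 * (x \<bullet> h)) / (r n)\<^sup>2))) (at x)" .
    moreover have "(\<lambda>h. 2 * pos (1 - (x \<bullet> x) / (r n)\<^sup>2) * (- (2 * (x \<bullet> h)) / (r n)\<^sup>2)) = (\<lambda>h. ct' n x \<bullet> h)"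
      by (auto simp: ct'_def fun_eq_iff)
    ultimately show ?thesis by (simp add: ct_def[abs_def])
  qed
  have posc: "continuous_on S pos" for S unfolding pos_def[abs_def] by (intro continuous_intros)
  have cct: "continuous_on UNIV (ct n)" "continuous_on UNIV (ct' n)" for n
    unfolding ct_def[abs_def] ct'_def[abs_def]
    by (intro continuous_intros continuous_on_compose2[OF posc[of UNIV]]; use r1[of n] in auto)+
  have cZ: "continuous_on UNIV Z"
    by (rule has_derivative_continuous_UNIV[OF Z])
  have posz: "pos (1 - (x \<bullet> x) / (r n)\<^sup>2) = 0" if "norm x \<ge> r n" for n and x :: 'a
  proof -
    have "(r n)\<^sup>2 \<le> x \<bullet> x" using that r1[of n] by (simp add: dot_square_norm power_mono)
    then show ?thesis using r1[of n] by (simp add: pos_def)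
  qed
  have pos01: "0 \<le> pos (1 - (x \<bullet> x) / (r n)\<^sup>2)" "pos (1 - (x \<bullet> x) / (r n)\<^sup>2) \<le> 1" for n and x :: 'a
    by (auto simp: pos_def)
  have ct01: "0 \<le> ct n x" "ct n x \<le> 1" for n x
    using pos01[of x n] by (auto simp: ct_def power_le_one)
  have eq: "integrable lborel (\<lambda>x. ct n x * (Z' x b \<bullet> b) + (ct' n x \<bullet> b) * (Z x \<bullet> b))"
     "(LINT x|lborel. ct n x * (Z' x b \<bullet> b) + (ct' n x \<bullet> b) * (Z x \<bullet> b)) = 0" for n b
  proof -
    define F where "F x = ct n x * (Z x \<bullet> b)" for x
    define F' where "F' x h = ct n x * (Z' x h \<bullet> b) + (ct' n x \<bullet> h) * (Z x \<bullet> b)" for x h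
    have "(F has_derivative F' x) (at x)" for x
      unfolding F_def[abs_def] F'_def[abs_def]
      by (rule has_derivative_mult[OF dct bounded_linear.has_derivative[OF bounded_linear_inner_left Z]])
    moreover have "continuous_on UNIV (\<lambda>x. F' x b)"
      unfolding F'_def by (intro continuous_intros cct cZ cont)
    moreover have "F x = 0" if "norm x \<ge> r n" for x
      using posz[OF that] by (simp add: F_def ct_def)
    ultimately show "integrable lborel (\<lambda>x. ct n x * (Z' x b \<bullet> b) + (ct' n x \<bullet> b) * (Z x \<bullet> b))"
     "(LINT x|lborel. ct n x * (Z' x b \<bullet> b) + (ct' n x \<bullet> b) * (Z x \<bullet> b)) = 0"
      using integral_directional_derivative_zero[of F F' b "r n"] by (auto simp: F'_def)
  qed
  have sumeq: "(\<Sum>b\<in>Basis. ct n x * (Z' x b \<bullet> b) + (ct' n x \<bullet> b) * (Z x \<bullet> b))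
     = ct n x * tr (Z' x) + ct' n x \<bullet> Z x" for n x
    by (simp add: tr_def sum.distrib sum_distrib_left euclidean_inner[of "ct' n x" "Z x"])
  have tot: "integrable lborel (\<lambda>x. ct n x * tr (Z' x) + ct' n x \<bullet> Z x)"
     "(LINT x|lborel. ct n x * tr (Z' x) + ct' n x \<bullet> Z x) = 0" for n
    using eq[of n] by (simp_all add: sumeq[symmetric] Bochner_Integration.integral_sum)
  have ct'b: "norm (ct' n x) * (1 + norm x) \<le> 8 * indicat_real (ball 0 (r n)) x" for n x
  proof (cases "norm x < r n")
    case True
    have "norm (ct' n x) \<le> 4 * 1 / (r n)\<^sup>2 * norm x"
    proof -
      have "pos (1 - (x \<bullet> x) / (r n)\<^sup>2) * norm x \<le> 1 * norm x"
        using pos01[of x n] by (intro mult_right_mono) auto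
      then have "4 * pos (1 - (x \<bullet> x) / (r n)\<^sup>2) * norm x / (r n)\<^sup>2 \<le> 4 * norm x / (r n)\<^sup>2"
        by (intro divide_right_mono) auto
      then show ?thesis using pos01[of x n] by (simp add: ct'_def abs_mult)
    qed
    then have "norm (ct' n x) * (1 + norm x) \<le> (4 * 1 / (r n)\<^sup>2 * norm x) * (1 + norm x)"
      by (rule mult_right_mono) simp
    also have "\<dots> \<le> (4 * 1 / (r n)\<^sup>2 * r n) * (2 * r n)"
      by (rule mult_mono) (use True r1[of n] in \<open>auto simp: divide_right_mono\<close>)
    also have "\<dots> = 8" using r1[of n] by (simp add: power2_eq_square)
    finally show ?thesis using True by simp
  next
    case False
    then show ?thesis using posz[of n x] by (simp add: ct'_def)
  qed
  have dom: "\<bar>ct' n x \<bullet> Z x\<bar> \<le> 8 * \<bar>l x\<bar>" for n x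
  proof -
    have "\<bar>ct' n x \<bullet> Z x\<bar> \<le> norm (ct' n x) * norm (Z x)" by (rule Cauchy_Schwarz_ineq2)
    also have "\<dots> \<le> norm (ct' n x) * ((1 + norm x) * \<bar>l x\<bar>)"
      using growth[of x] by (intro mult_left_mono) (auto intro: order_trans[OF _ mult_left_mono])
    also have "\<dots> \<le> 8 * \<bar>l x\<bar>"
      using mult_right_mono[OF ct'b[of n x], of "\<bar>l x\<bar>"]
      by (auto simp: indicator_def mult.assoc of_bool_def split: if_splits)
    finally show ?thesis .
  qed
  have [measurable]: "Z \<in> borel_measurable borel" "ct n \<in> borel_measurable borel"
     "ct' n \<in> borel_measurable borel" for n
    by (auto intro!: borel_measurable_continuous_onI cZ cct)
  have [measurable]: "l \<in> borel_measurable borel" "h \<in> borel_measurable borel" using l h by auto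
  have rinf: "filterlim r at_top sequentially"
    unfolding r_def using filterlim_compose[OF filterlim_real_sequentially filterlim_Suc] by simp
  have rinf2: "(\<lambda>n. c / (r n)\<^sup>2) \<longlonglongrightarrow> 0" for c
    by (rule real_tendsto_divide_at_top[OF tendsto_const])
       (intro filterlim_pow_at_top rinf, simp)
  have poslim: "(\<lambda>n. pos (1 - (x \<bullet> x) / (r n)\<^sup>2)) \<longlonglongrightarrow> 1" for x :: 'a
  proof -
    have "(\<lambda>n. pos (1 - (x \<bullet> x) / (r n)\<^sup>2)) \<longlonglongrightarrow> max 0 (1 - 0)"
      unfolding pos_def by (intro tendsto_intros rinf2)
    then show ?thesis by simp
  qed
  have i2: "integrable lborel (\<lambda>x. ct' n x \<bullet> Z x)" for n
    by (rule Bochner_Integration.integrable_bound[where f="\<lambda>x. 8 * \<bar>l x\<bar>"]) (use l dom in auto)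
  have lim2: "(\<lambda>n. LINT x|lborel. ct' n x \<bullet> Z x) \<longlonglongrightarrow> (LINT x|(lborel::'a measure). 0)"
  proof (rule integral_dominated_convergence[where w="\<lambda>x. 8 * \<bar>l x\<bar>"])
    show "AE x in lborel. (\<lambda>n. ct' n x \<bullet> Z x) \<longlonglongrightarrow> 0"
    proof (rule AE_I2)
      fix x
      have "(\<lambda>n. (pos (1 - (x \<bullet> x) / (r n)\<^sup>2) * (- 4 / (r n)\<^sup>2)) * (x \<bullet> Z x)) \<longlonglongrightarrow> 1 * 0 * (x \<bullet> Z x)"
        by (intro tendsto_intros poslim rinf2)
      then show "(\<lambda>n. ct' n x \<bullet> Z x) \<longlonglongrightarrow> 0" by (simp add: ct'_def mult.commute)
    qed
  qed (use l dom in auto)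
  have lim1: "(\<lambda>n. LINT x|lborel. ct n x * h x) \<longlonglongrightarrow> (LINT x|lborel. h x)"
  proof (rule integral_dominated_convergence[where w="\<lambda>x. \<bar>h x\<bar>"])
    show "AE x in lborel. (\<lambda>n. ct n x * h x) \<longlonglongrightarrow> h x"
    proof (rule AE_I2)
      fix x
      have "(\<lambda>n. (pos (1 - (x \<bullet> x) / (r n)\<^sup>2))\<^sup>2 * h x) \<longlonglongrightarrow> 1\<^sup>2 * h x"
        by (intro tendsto_intros poslim)
      then show "(\<lambda>n. ct n x * h x) \<longlonglongrightarrow> h x" by (simp add: ct_def)
    qed
    show "AE x in lborel. norm (ct n x * h x) \<le> \<bar>h x\<bar>" for n
      using ct01 by (auto simp: abs_mult mult_left_le_one_le)
  qed (use h in auto)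
  have "(LINT x|lborel. ct n x * h x) \<ge> - (LINT x|lborel. ct' n x \<bullet> Z x)" for n
  proof -
    have ih: "integrable lborel (\<lambda>x. ct n x * h x)"
      by (rule Bochner_Integration.integrable_bound[where f="\<lambda>x. \<bar>h x\<bar>"])
         (use h ct01 in \<open>auto simp: abs_mult mult_left_le_one_le\<close>)
    have "0 = (LINT x|lborel. ct n x * tr (Z' x) + ct' n x \<bullet> Z x)" using tot(2) by simp
    also have "\<dots> \<le> (LINT x|lborel. ct n x * h x + ct' n x \<bullet> Z x)"
      by (rule integral_mono[OF tot(1)])
        (use ih i2 ct01 div in \<open>auto intro!: mult_left_mono\<close>)
    also have "\<dots> = (LINT x|lborel. ct n x * h x) + (LINT x|lborel. ct' n x \<bullet> Z x)"
      by (rule Bochner_Integration.integral_add[OF ih i2])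
    finally show ?thesis by simp
  qed
  then show ?thesis
    using LIMSEQ_le[OF tendsto_minus[OF lim2] lim1] by auto
qed

section \<open>The Carleman weight\<close>

text \<open>The function \<open>\<Phi>\<close> is used as \<open>\<phi>(x) = \<Phi>(s)\<close> with \<open>s = |x - c|\<^sup>2\<close>. Then \<open>\<nabla>\<phi> = a(s) (x - c)\<close>, the function
  \<open>\<beta>\<close> is the coefficient of \<open>v\<^sup>2 (x - c)\<close> in the vector field of \<open>carleman_flux_divergence\<close>, and
  \<open>J = - (a + \<beta> + 2 s \<beta>')\<close> is the coefficient of \<open>v\<^sup>2\<close> that remains in the Carleman inequality. The
  numbers \<open>\<eta>\<close> and \<open>C\<close> bound \<open>J\<close> from below, everywhere and on the annulus \<open>1 \<le> s \<le> S\<close>.\<close>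

definition carleman_weight ::
  "real \<Rightarrow> real \<Rightarrow> real \<Rightarrow> (real \<Rightarrow> real) \<Rightarrow> (real \<Rightarrow> real) \<Rightarrow> (real \<Rightarrow> real) \<Rightarrow> (real \<Rightarrow> real) \<Rightarrow> (real \<Rightarrow> real) \<Rightarrow> real \<Rightarrow> real \<Rightarrow> bool" where
  "carleman_weight k S C \<Phi> a a' \<beta> \<beta>' A \<eta> \<longleftrightarrow>
    (\<forall>s\<ge>0. (\<Phi> has_real_derivative a s / 2) (at s) \<and> (a has_real_derivative a' s) (at s) \<and>
      (\<beta> has_real_derivative \<beta>' s) (at s) \<and> \<beta> s = 2 * s * a' s - a s - s * (a s)\<^sup>2 - k\<^sup>2 \<and>
      0 \<le> a s \<and> \<bar>\<Phi> s\<bar> \<le> A \<and> \<bar>\<beta> s\<bar> \<le> A \<and> s * (a s)\<^sup>2 \<le> A \<and> \<eta> \<le> - (a s + \<beta> s + 2 * s * \<beta>' s)) \<and>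
    continuous_on {0..} a' \<and> continuous_on {0..} \<beta>' \<and>
    (\<forall>s. 1 \<le> s \<longrightarrow> s \<le> S \<longrightarrow> C \<le> - (a s + \<beta> s + 2 * s * \<beta>' s))"

text \<open>With \<open>m = - s a' / a\<close> one finds
  \<open>J = k\<^sup>2 + s a\<^sup>2 (3 - 4 m) + 4 s m' a - 4 m\<^sup>2 a\<close>. Where \<open>m < 3/4\<close>, the quadratic term makes \<open>J\<close> large as
  soon as \<open>a\<close> is large. A bounded \<open>\<Phi>\<close>, however, needs an integrable \<open>a\<close>, hence \<open>m > 1\<close> far out,
  where only \<open>k\<^sup>2\<close> is left to keep \<open>J\<close> positive. Both demands are met by
  \<open>\<Phi> = \<tau> \<sigma> / (1 + \<epsilon> \<sigma>)\<close> with \<open>\<sigma> = (1 + s)\<^bsup>1/3\<^esup>\<close>. As long as \<open>\<epsilon> \<sigma>\<close> is small, \<open>m\<close> is at most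
  slightly above \<open>2/3\<close> and \<open>J\<close> is of order \<open>\<tau>\<^sup>2\<close> on the annulus. Once \<open>\<epsilon> \<sigma>\<close> is no longer small,
  \<open>s a\<^sup>2\<close> and \<open>a\<close> are at most \<open>\<tau>\<^sup>2 / \<sigma>\<close> and \<open>\<tau> / \<sigma>\<close>, which are of order \<open>\<epsilon>\<close>. So \<open>\<tau>\<close> is chosen
  first, and then \<open>\<epsilon>\<close> small in terms of \<open>\<tau>\<close>.\<close>

lemma carleman_weight_exists:
  fixes k S C :: real
  assumes k: "k > 0" and S: "S \<ge> 1"
  shows "\<exists>\<Phi> a a' \<beta> \<beta>' A \<eta>. \<eta> > 0 \<and> carleman_weight k S C \<Phi> a a' \<beta> \<beta>' A \<eta>"
proof -
  have alg1: "X * (- (4/9) * t * Y / (x ^ 5 * z ^ 3)) = - ((2/3) * (X / x ^ 3) * (Y / z)) * ((2/3) * t / (x\<^sup>2 * z\<^sup>2))"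
    if "x \<noteq> 0" "z \<noteq> 0" for x z X Y t :: real
    using that by (simp add: field_simps eval_nat_numeral)
  have alg2: "- ((2/3) * t) * ((2/3) * z * Y / x) / (x\<^sup>2 * z\<^sup>2)\<^sup>2 = - (4/9) * t * Y / (x ^ 5 * z ^ 3)"
    if "x \<noteq> 0" "z \<noteq> 0" for x z Y t :: real
    using that by (simp add: field_simps eval_nat_numeral)
  have alg3: "(2/3) * ((3 * x\<^sup>2 * (1 / (3 * x\<^sup>2))) / (x ^ 3)\<^sup>2) * Y + (2/3) * W * ((e / (3 * x\<^sup>2)) / z\<^sup>2)
      = (2/9) * (3 * Y / x ^ 6 + W * e / (x\<^sup>2 * z\<^sup>2))"
    if "x \<noteq> 0" "z \<noteq> 0" for x z Y W e :: real
    using that by (simp add: field_simps flip: power_mult)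
  define \<sigma> where "\<sigma> s = (1 + s) powr (1/3)" for s :: real
  have \<sigma>1: "\<sigma> s \<ge> 1" if "s \<ge> 0" for s
    using that by (simp add: \<sigma>_def ge_one_powr_ge_zero)
  have \<sigma>3: "\<sigma> s ^ 3 = 1 + s" if "s \<ge> 0" for s
    using that by (simp add: \<sigma>_def power3_eq_cube powr_add[symmetric])
  have d\<sigma>: "(\<sigma> has_real_derivative 1 / (3 * (\<sigma> s)\<^sup>2)) (at s)" if "s \<ge> 0" for s
  proof -
    have "(\<sigma> has_real_derivative (1/3) * (1 + s) powr (1/3 - 1) * 1) (at s)"
      unfolding \<sigma>_def[abs_def] using that by (auto intro!: derivative_eq_intros)
    moreover have "(1/3) * (1 + s) powr (1/3 - 1) * 1 = 1 / (3 * (\<sigma> s)\<^sup>2)"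
    proof -
      have "(1 + s) powr (1/3 - 1) * (\<sigma> s)\<^sup>2 = 1"
        using that by (simp add: \<sigma>_def power2_eq_square powr_add[symmetric])
      moreover have "\<sigma> s > 0" using \<sigma>1[OF that] by simp
      ultimately show ?thesis by (simp add: field_simps)
    qed
    ultimately show ?thesis by (simp only:)
  qed
  have c\<sigma>: "continuous_on {0..} \<sigma>"
    by (meson atLeast_iff d\<sigma> DERIV_isCont continuous_at_imp_continuous_on)
  \<comment> \<open>The bound \<open>40\<close> gives \<open>a (1 + s) \<ge> 20\<close> where \<open>\<epsilon> \<sigma> \<le> 1/19\<close>, the other one makes \<open>J\<close> exceed \<open>C\<close> on the annulus.\<close>
  define \<tau> where "\<tau> = max 40 (10 * (1 + \<bar>C\<bar>) * \<sigma> S ^ 2)"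
  \<comment> \<open>The first bound keeps \<open>J\<close> above \<open>k\<^sup>2 / 2\<close> where \<open>\<epsilon> \<sigma> \<ge> 1/19\<close>, the second keeps the annulus out of that region.\<close>
  define \<epsilon> where "\<epsilon> = min (k\<^sup>2 / (2 * 19 * (2 * \<tau>\<^sup>2 + 8 * \<tau>))) (1 / (19 * \<sigma> S))"
  have \<tau>: "\<tau> \<ge> 40" by (simp add: \<tau>_def)
  have \<epsilon>: "\<epsilon> > 0" unfolding \<epsilon>_def using k \<tau> \<sigma>1[of S] S by (auto intro!: divide_pos_pos add_pos_pos mult_pos_pos)
  define q where "q s = 1 + \<epsilon> * \<sigma> s" for s
  have q1: "q s > 1" if "s \<ge> 0" for s using \<epsilon> \<sigma>1[OF that] by (simp add: q_def)
  have dq: "(q has_real_derivative \<epsilon> / (3 * (\<sigma> s)\<^sup>2)) (at s)" if "s \<ge> 0" for s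
    unfolding q_def[abs_def] using d\<sigma>[OF that] by (auto intro!: derivative_eq_intros)
  have cq: "continuous_on {0..} q" unfolding q_def[abs_def] by (intro continuous_intros c\<sigma>)
  define \<Phi> where "\<Phi> s = \<tau> * \<sigma> s / q s" for s
  define a where "a s = (2/3) * \<tau> / ((\<sigma> s)\<^sup>2 * (q s)\<^sup>2)" for s
  define a' where "a' s = - (4/9) * \<tau> * (2 * q s - 1) / (\<sigma> s ^ 5 * q s ^ 3)" for s
  define m where "m s = (2/3) * (1 - 1 / \<sigma> s ^ 3) * (2 - 1 / q s)" for s
  define m' where "m' s = (2/9) * (3 * (2 - 1 / q s) / \<sigma> s ^ 6 + (1 - 1 / \<sigma> s ^ 3) * \<epsilon> / ((\<sigma> s)\<^sup>2 * (q s)\<^sup>2))" for s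
  define \<beta> where "\<beta> s = - (2 * m s + 1) * a s - s * (a s)\<^sup>2 - k\<^sup>2" for s
  define \<beta>' where "\<beta>' s = - (2 * m' s) * a s - (2 * m s + 1) * a' s - (a s)\<^sup>2 - 2 * s * a s * a' s" for s
  have nz: "\<sigma> s > 0" "q s > 0" "\<sigma> s \<noteq> 0" "q s \<noteq> 0" if "s \<ge> 0" for s
    using \<sigma>1[OF that] q1[OF that] by auto
  have d\<Phi>: "(\<Phi> has_real_derivative a s / 2) (at s)" if "s \<ge> 0" for s
  proof -
    have "(\<Phi> has_real_derivative (\<tau> * (1 / (3 * (\<sigma> s)\<^sup>2)) * q s - \<tau> * \<sigma> s * (\<epsilon> / (3 * (\<sigma> s)\<^sup>2))) / (q s * q s)) (at s)"
      unfolding \<Phi>_def[abs_def] by (intro DERIV_divide DERIV_cmult d\<sigma> dq that nz)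
    moreover have "(\<tau> * (1 / (3 * (\<sigma> s)\<^sup>2)) * q s - \<tau> * \<sigma> s * (\<epsilon> / (3 * (\<sigma> s)\<^sup>2))) / (q s * q s) = a s / 2"
    proof -
      have "\<tau> * (1 / (3 * (\<sigma> s)\<^sup>2)) * q s - \<tau> * \<sigma> s * (\<epsilon> / (3 * (\<sigma> s)\<^sup>2)) = \<tau> / (3 * (\<sigma> s)\<^sup>2) * (q s - \<epsilon> * \<sigma> s)"
        by (simp add: algebra_simps diff_divide_distrib)
      also have "q s - \<epsilon> * \<sigma> s = 1" by (simp add: q_def)
      finally show ?thesis by (simp add: a_def power2_eq_square)
    qed
    ultimately show ?thesis by (simp only:)
  qed
  have da: "(a has_real_derivative a' s) (at s)" if "s \<ge> 0" for s
  proof -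
    have "(a has_real_derivative - ((2/3) * \<tau>) * (2 * \<sigma> s * (1 / (3 * (\<sigma> s)\<^sup>2)) * (q s)\<^sup>2 + (\<sigma> s)\<^sup>2 * (2 * q s * (\<epsilon> / (3 * (\<sigma> s)\<^sup>2))))
      / ((\<sigma> s)\<^sup>2 * (q s)\<^sup>2)\<^sup>2) (at s)"
    proof -
      have "((\<lambda>s. (\<sigma> s)\<^sup>2 * (q s)\<^sup>2) has_real_derivative
          2 * \<sigma> s * (1 / (3 * (\<sigma> s)\<^sup>2)) * (q s)\<^sup>2 + (\<sigma> s)\<^sup>2 * (2 * q s * (\<epsilon> / (3 * (\<sigma> s)\<^sup>2)))) (at s)"
        by (rule DERIV_cong[OF DERIV_mult[OF DERIV_power[OF d\<sigma>[OF that], of 2] DERIV_power[OF dq[OF that], of 2]]])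
          (simp add: mult_ac)
      from DERIV_divide[OF DERIV_const[of "(2/3) * \<tau>"] this] nz[OF that]
      show ?thesis unfolding a_def[abs_def] by (simp add: power2_eq_square)
    qed
    moreover have "- ((2/3) * \<tau>) * (2 * \<sigma> s * (1 / (3 * (\<sigma> s)\<^sup>2)) * (q s)\<^sup>2 + (\<sigma> s)\<^sup>2 * (2 * q s * (\<epsilon> / (3 * (\<sigma> s)\<^sup>2))))
      / ((\<sigma> s)\<^sup>2 * (q s)\<^sup>2)\<^sup>2 = a' s"
    proof -
      have "(2 * \<sigma> s * (1 / (3 * (\<sigma> s)\<^sup>2)) * (q s)\<^sup>2 + (\<sigma> s)\<^sup>2 * (2 * q s * (\<epsilon> / (3 * (\<sigma> s)\<^sup>2))))
         = (2/3) * q s * (q s + \<epsilon> * \<sigma> s) / \<sigma> s"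
        using nz[OF that] by (simp add: field_simps power2_eq_square)
      also have "\<epsilon> * \<sigma> s = q s - 1" by (simp add: q_def)
      finally have "(2 * \<sigma> s * (1 / (3 * (\<sigma> s)\<^sup>2)) * (q s)\<^sup>2 + (\<sigma> s)\<^sup>2 * (2 * q s * (\<epsilon> / (3 * (\<sigma> s)\<^sup>2))))
         = (2/3) * q s * (2 * q s - 1) / \<sigma> s" by (simp add: algebra_simps)
      then show ?thesis using nz[OF that] by (simp only: a'_def) (rule alg2)
    qed
    ultimately show ?thesis by (simp only:)
  qed
  have dm: "(m has_real_derivative m' s) (at s)" if "s \<ge> 0" for s
  proof -
    have "(m has_real_derivative (2/3) * ((3 * (\<sigma> s)\<^sup>2 * (1 / (3 * (\<sigma> s)\<^sup>2))) / (\<sigma> s ^ 3)\<^sup>2) * (2 - 1 / q s)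
       + (2/3) * (1 - 1 / \<sigma> s ^ 3) * ((\<epsilon> / (3 * (\<sigma> s)\<^sup>2)) / (q s)\<^sup>2)) (at s)"
    proof -
      have 1: "((\<lambda>s. 1 - 1 / \<sigma> s ^ 3) has_real_derivative (3 * (\<sigma> s)\<^sup>2 * (1 / (3 * (\<sigma> s)\<^sup>2))) / (\<sigma> s ^ 3)\<^sup>2) (at s)"
        by (rule DERIV_cong[OF DERIV_diff[OF DERIV_const DERIV_divide[OF DERIV_const DERIV_power[OF d\<sigma>[OF that], of 3]]]])
          (use nz[OF that] in \<open>simp_all add: power2_eq_square\<close>)
      have 2: "((\<lambda>s. 2 - 1 / q s) has_real_derivative (\<epsilon> / (3 * (\<sigma> s)\<^sup>2)) / (q s)\<^sup>2) (at s)"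
        by (rule DERIV_cong[OF DERIV_diff[OF DERIV_const DERIV_divide[OF DERIV_const dq[OF that]]]])
          (use nz[OF that] in \<open>simp_all add: power2_eq_square\<close>)
      show ?thesis unfolding m_def[abs_def]
        by (rule DERIV_cong[OF DERIV_mult[OF DERIV_cmult[OF 1, of "2/3"] 2]]) (simp only: mult_ac)
    qed
    moreover have "(2/3) * ((3 * (\<sigma> s)\<^sup>2 * (1 / (3 * (\<sigma> s)\<^sup>2))) / (\<sigma> s ^ 3)\<^sup>2) * (2 - 1 / q s)
       + (2/3) * (1 - 1 / \<sigma> s ^ 3) * ((\<epsilon> / (3 * (\<sigma> s)\<^sup>2)) / (q s)\<^sup>2) = m' s"
      unfolding m'_def using nz[OF that] by (intro alg3)
    ultimately show ?thesis by (simp only:)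
  qed
  have d\<beta>: "(\<beta> has_real_derivative \<beta>' s) (at s)" if "s \<ge> 0" for s
    unfolding \<beta>_def[abs_def] \<beta>'_def
    by (auto intro!: derivative_eq_intros dm da that simp: algebra_simps power2_eq_square)
  have ca': "continuous_on {0..} a'" unfolding a'_def[abs_def]
    by (intro continuous_intros c\<sigma> cq) (use nz in auto)
  have ca: "continuous_on {0..} a" unfolding a_def[abs_def]
    by (intro continuous_intros c\<sigma> cq) (use nz in auto)
  have cm: "continuous_on {0..} m" unfolding m_def[abs_def]
    by (intro continuous_intros c\<sigma> cq) (use nz in auto)
  have cm': "continuous_on {0..} m'" unfolding m'_def[abs_def]
    by (intro continuous_intros c\<sigma> cq) (use nz in auto)
  have c\<beta>': "continuous_on {0..} \<beta>'" unfolding \<beta>'_def[abs_def]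
    by (intro continuous_intros ca ca' cm cm')
  have sa': "s * a' s = - m s * a s" if "s \<ge> 0" for s
  proof -
    have s: "s = \<sigma> s ^ 3 - 1" using \<sigma>3[OF that] by simp
    have f: "1 - 1 / \<sigma> s ^ 3 = (\<sigma> s ^ 3 - 1) / \<sigma> s ^ 3" "2 - 1 / q s = (2 * q s - 1) / q s"
      using nz[OF that] by (simp_all add: diff_divide_distrib)
    have "(\<sigma> s ^ 3 - 1) * a' s = - m s * a s"
      unfolding a'_def m_def a_def f using nz[OF that] by (intro alg1)
    then show ?thesis using s by simp
  qed
  have \<beta>eq: "\<beta> s = 2 * s * a' s - a s - s * (a s)\<^sup>2 - k\<^sup>2" if "s \<ge> 0" for s
    using sa'[OF that] by (simp add: \<beta>_def algebra_simps)
  have a0: "a s \<ge> 0" if "s \<ge> 0" for s using nz[OF that] \<tau> by (simp add: a_def)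
  have J: "- (a s + \<beta> s + 2 * s * \<beta>' s)
    = k\<^sup>2 + s * (a s)\<^sup>2 * (3 - 4 * m s) + 4 * s * m' s * a s - 4 * (m s)\<^sup>2 * a s" if "s \<ge> 0" for s
  proof -
    have "2 * s * \<beta>' s = - 4 * s * m' s * a s - 2 * (2 * m s + 1) * (s * a' s) - 2 * s * (a s)\<^sup>2 - 4 * s * a s * (s * a' s)"
      by (simp add: \<beta>'_def algebra_simps)
    then show ?thesis unfolding sa'[OF that] \<beta>_def by (simp add: algebra_simps power2_eq_square)
  qed
  have m'0: "m' s \<ge> 0" if "s \<ge> 0" for s
  proof -
    have "1 / q s \<le> 1" "1 / \<sigma> s ^ 3 \<le> 1" using q1[OF that] \<sigma>3[OF that] that by (auto simp: divide_simps)
    then show ?thesis using \<epsilon> by (simp add: m'_def)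
  qed
  \<comment> \<open>\<open>\<theta> = 1 - 1 / q\<close> measures how far \<open>\<Phi>\<close> has bent away from \<open>\<tau> \<sigma>\<close>.\<close>
  define \<theta> where "\<theta> s = 1 - 1 / q s" for s
  have \<theta>: "0 \<le> \<theta> s" "\<theta> s \<le> 1" if "s \<ge> 0" for s using q1[OF that] by (auto simp: \<theta>_def)
  have m_eq: "m s = (2/3) * (s / (1 + s)) * (1 + \<theta> s)" if "s \<ge> 0" for s
    using \<sigma>3[OF that] that by (simp add: m_def \<theta>_def field_simps)
  have a_eq: "a s = (2/3) * \<tau> * (1 - \<theta> s)\<^sup>2 / (\<sigma> s)\<^sup>2" if "s \<ge> 0" for s
    using nz[OF that] by (simp add: a_def \<theta>_def field_simps)
  have m0: "0 \<le> m s" if "s \<ge> 0" for s unfolding m_eq[OF that] using \<theta>[OF that] that by auto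
  have m43: "m s \<le> 4/3" if "s \<ge> 0" for s
  proof -
    have "(s / (1 + s)) * (1 + \<theta> s) \<le> 1 * 2" using \<theta>[OF that] that by (intro mult_mono) auto
    then have "(2/3) * (s / (1 + s) * (1 + \<theta> s)) \<le> (2/3) * (1 * 2)" by (intro mult_left_mono) auto
    moreover have "(2/3) * (1 * 2) = (4/3::real)" by simp
    ultimately show ?thesis
      unfolding m_eq[OF that] mult.assoc by (simp only:)
  qed
  have aup: "a s \<le> \<tau> / (\<sigma> s)\<^sup>2" if "s \<ge> 0" for s
  proof -
    have "(1 - \<theta> s)\<^sup>2 \<le> 1" using \<theta>[OF that] by (intro power_le_one) auto
    then have "(2/3) * (1 - \<theta> s)\<^sup>2 * \<tau> \<le> 1 * \<tau>" using \<tau> by (intro mult_right_mono) auto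
    then show ?thesis unfolding a_eq[OF that] by (intro divide_right_mono) (auto simp: mult_ac)
  qed
  have asig: "a s \<le> \<tau> / \<sigma> s" if "s \<ge> 0" for s
  proof -
    have "\<tau> / (\<sigma> s)\<^sup>2 \<le> \<tau> / \<sigma> s"
      using \<sigma>1[OF that] \<tau> by (intro divide_left_mono) (auto simp: self_le_power)
    then show ?thesis using aup[OF that] by simp
  qed
  have sa2: "s * (a s)\<^sup>2 \<le> \<tau>\<^sup>2 / \<sigma> s" if "s \<ge> 0" for s
  proof -
    have "s * (a s)\<^sup>2 \<le> \<sigma> s ^ 3 * (\<tau> / (\<sigma> s)\<^sup>2)\<^sup>2"
      using \<sigma>3[OF that] aup[OF that] a0[OF that] that \<sigma>1[OF that] by (intro mult_mono power_mono) auto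
    also have "\<dots> = \<tau>\<^sup>2 / \<sigma> s" using nz[OF that] by (simp add: field_simps eval_nat_numeral)
    finally show ?thesis .
  qed
  have near: "k\<^sup>2 + s * (a s)\<^sup>2 / 10 \<le> - (a s + \<beta> s + 2 * s * \<beta>' s)" if s: "s \<ge> 0" and t: "\<theta> s \<le> 1/20" for s
  proof -
    define w where "w = s / (1 + s)"
    have w: "0 \<le> w" "w \<le> 1" using s by (auto simp: w_def)
    have meq: "m s = (2/3) * w * (1 + \<theta> s)" unfolding w_def by (rule m_eq[OF s])
    have mw: "m s \<le> w * (7/10)"
    proof -
      have "w * (1 + \<theta> s) \<le> w * (21/20)" using t w by (intro mult_left_mono) auto
      then show ?thesis unfolding meq by argo
    qed
    have m2: "4 * (m s)\<^sup>2 \<le> 2 * w"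
    proof -
      have "(m s)\<^sup>2 \<le> (w * (7/10))\<^sup>2" using mw m0[OF s] by (rule power_mono)
      also have "\<dots> \<le> w * (49/100)" using w mult_left_mono[of w 1 w] by (simp add: power2_eq_square)
      finally show ?thesis using w by simp
    qed
    have aL: "a s * (1 + s) \<ge> 20"
    proof -
      have "(1 - \<theta> s)\<^sup>2 \<ge> (19/20)\<^sup>2" using t by (intro power_mono) auto
      then have "(2/3) * \<tau> * (1 - \<theta> s)\<^sup>2 \<ge> (2/3) * 40 * (19/20)\<^sup>2"
        using \<tau> by (intro mult_mono) auto
      then have 1: "(2/3) * \<tau> * (1 - \<theta> s)\<^sup>2 \<ge> 20" by (simp add: power2_eq_square)
      have "a s * (1 + s) = (2/3) * \<tau> * (1 - \<theta> s)\<^sup>2 * \<sigma> s"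
        unfolding a_eq[OF s] using nz[OF s] by (simp flip: \<sigma>3[OF s]) (simp add: eval_nat_numeral)
      moreover have "(2/3) * \<tau> * (1 - \<theta> s)\<^sup>2 * \<sigma> s \<ge> 20 * 1"
        using 1 \<sigma>1[OF s] by (intro mult_mono) auto
      ultimately show ?thesis by (simp only: mult_1_right)
    qed
    have "2 * w * a s \<le> s * (a s)\<^sup>2 / 10"
    proof -
      have "w \<le> w * (a s * (1 + s) / 20)" using mult_left_mono[of 1 "a s * (1 + s) / 20" w] aL w by simp
      also have "\<dots> = s * a s / 20" using s by (simp add: w_def)
      finally have "2 * w * a s \<le> 2 * (s * a s / 20) * a s" using a0[OF s] by (intro mult_right_mono) auto
      then show ?thesis by (simp add: power2_eq_square)
    qed
    moreover have "4 * (m s)\<^sup>2 * a s \<le> 2 * w * a s" using m2 a0[OF s] by (rule mult_right_mono)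
    moreover have "s * (a s)\<^sup>2 * (3 - 4 * m s) \<ge> s * (a s)\<^sup>2 * (1/5)"
      using mw w s by (intro mult_left_mono) auto
    moreover have "4 * s * m' s * a s \<ge> 0" using s m'0[OF s] a0[OF s] by simp
    ultimately show ?thesis unfolding J[OF s] by linarith
  qed
  have far: "k\<^sup>2 / 2 \<le> - (a s + \<beta> s + 2 * s * \<beta>' s)" if s: "s \<ge> 0" and t: "\<theta> s \<ge> 1/20" for s
  proof -
    have "20 * (q s - 1) \<ge> q s" using t nz[OF s] by (simp add: \<theta>_def field_simps)
    then have e19: "19 * \<epsilon> * \<sigma> s \<ge> 1" by (simp add: q_def)
    have "s * (a s)\<^sup>2 * (3 - 4 * m s) \<ge> s * (a s)\<^sup>2 * (- 7/3)"
      using m43[OF s] s by (intro mult_left_mono) auto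
    moreover have "4 * (m s)\<^sup>2 * a s \<le> 8 * a s"
    proof -
      have "(m s)\<^sup>2 \<le> (4/3)\<^sup>2" using m43[OF s] m0[OF s] by (rule power_mono)
      then have "4 * (m s)\<^sup>2 \<le> 8" by (simp add: power2_eq_square)
      then show ?thesis using a0[OF s] by (rule mult_right_mono)
    qed
    moreover have "4 * s * m' s * a s \<ge> 0" using s m'0[OF s] a0[OF s] by simp
    ultimately have 1: "- (a s + \<beta> s + 2 * s * \<beta>' s) \<ge> k\<^sup>2 - (7/3) * (s * (a s)\<^sup>2) - 8 * a s"
      unfolding J[OF s] by linarith
    have "s * (a s)\<^sup>2 \<le> (4/9) * \<tau>\<^sup>2 / \<sigma> s"
    proof -
      have "(1 - \<theta> s)\<^sup>2 \<le> 1" using \<theta>[OF s] by (intro power_le_one) auto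
      then have "(2/3) * (1 - \<theta> s)\<^sup>2 * \<tau> \<le> (2/3) * 1 * \<tau>" using \<tau> by (intro mult_right_mono) auto
      then have "a s \<le> (2/3) * \<tau> / (\<sigma> s)\<^sup>2" unfolding a_eq[OF s] by (intro divide_right_mono) (auto simp: mult_ac)
      then have "s * (a s)\<^sup>2 \<le> \<sigma> s ^ 3 * ((2/3) * \<tau> / (\<sigma> s)\<^sup>2)\<^sup>2"
        using \<sigma>3[OF s] a0[OF s] s \<sigma>1[OF s] by (intro mult_mono power_mono) auto
      also have "\<dots> = (4/9) * \<tau>\<^sup>2 / \<sigma> s" using nz[OF s] by (simp add: field_simps eval_nat_numeral)
      finally show ?thesis .
    qed
    note * = this
    have 2: "(7/3) * (s * (a s)\<^sup>2) + 8 * a s \<le> (2 * \<tau>\<^sup>2 + 8 * \<tau>) / \<sigma> s"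
    proof -
      have "0 \<le> \<tau>\<^sup>2 / \<sigma> s" using nz[OF s] by simp
      moreover have "(4/9) * \<tau>\<^sup>2 / \<sigma> s = (4/9) * (\<tau>\<^sup>2 / \<sigma> s)" by simp
      moreover have "(2 * \<tau>\<^sup>2 + 8 * \<tau>) / \<sigma> s = 2 * (\<tau>\<^sup>2 / \<sigma> s) + 8 * (\<tau> / \<sigma> s)"
        by (simp add: add_divide_distrib)
      ultimately show ?thesis using asig[OF s] * by linarith
    qed
    have T0: "2 * \<tau>\<^sup>2 + 8 * \<tau> > 0" using \<tau> by (simp add: add_nonneg_pos)
    have "(2 * \<tau>\<^sup>2 + 8 * \<tau>) / \<sigma> s \<le> (2 * \<tau>\<^sup>2 + 8 * \<tau>) * (19 * \<epsilon>)"
      using mult_left_mono[OF e19, of "2 * \<tau>\<^sup>2 + 8 * \<tau>"] T0 nz[OF s] by (simp add: divide_le_eq mult_ac)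
    also have "\<dots> \<le> k\<^sup>2 / 2"
    proof -
      have "\<epsilon> \<le> k\<^sup>2 / (2 * 19 * (2 * \<tau>\<^sup>2 + 8 * \<tau>))" by (simp add: \<epsilon>_def)
      then show ?thesis using T0 by (simp add: le_divide_eq mult_ac)
    qed
    finally show ?thesis using 1 2 by linarith
  qed
  have on_S: "C \<le> - (a s + \<beta> s + 2 * s * \<beta>' s)" if s: "1 \<le> s" "s \<le> S" for s
  proof -
    have s0: "s \<ge> 0" using s by simp
    have mono: "\<sigma> s \<le> \<sigma> S" unfolding \<sigma>_def using s by (intro powr_mono2) auto
    have "\<epsilon> * \<sigma> s \<le> 1 / 19"
    proof -
      have "\<epsilon> * \<sigma> s \<le> 1 / (19 * \<sigma> S) * \<sigma> S"
        using mono nz[OF s0] \<epsilon> nz[of S] S by (intro mult_mono) (auto simp: \<epsilon>_def)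
      then show ?thesis using nz[of S] S by simp
    qed
    then have t: "\<theta> s \<le> 1/20" using nz[OF s0] by (simp add: \<theta>_def q_def field_simps)
    have "(1 - \<theta> s)\<^sup>2 \<ge> (19/20)\<^sup>2" using t by (intro power_mono) auto
    then have "(2/3) * \<tau> * (1 - \<theta> s)\<^sup>2 \<ge> (2/3) * \<tau> * (19/20)\<^sup>2"
      using \<tau> by (intro mult_left_mono) auto
    then have "(2/3) * \<tau> * (1 - \<theta> s)\<^sup>2 \<ge> \<tau> / 2" using \<tau> by (simp add: power2_eq_square)
    then have "a s \<ge> (\<tau> / 2) / (\<sigma> s)\<^sup>2" unfolding a_eq[OF s0] by (intro divide_right_mono) auto
    also have "(\<tau> / 2) / (\<sigma> s)\<^sup>2 \<ge> (\<tau> / 2) / (\<sigma> S)\<^sup>2"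
      using mono nz[OF s0] \<tau> nz[of S] S by (intro divide_left_mono power_mono mult_pos_pos) auto
    finally have "a s \<ge> (\<tau> / 2) / (\<sigma> S)\<^sup>2" by simp
    moreover have "(\<tau> / 2) / (\<sigma> S)\<^sup>2 \<ge> 5 * (1 + \<bar>C\<bar>)"
    proof -
      have "\<tau> \<ge> 10 * (1 + \<bar>C\<bar>) * \<sigma> S ^ 2" by (simp add: \<tau>_def)
      then show ?thesis using nz[of S] S by (simp add: le_divide_eq algebra_simps)
    qed
    ultimately have a5: "a s \<ge> 5 * (1 + \<bar>C\<bar>)" by simp
    have "1 * (5 * (1 + \<bar>C\<bar>))\<^sup>2 \<le> s * (a s)\<^sup>2"
      using a5 s by (intro mult_mono power_mono) auto
    moreover have "10 * C \<le> (5 * (1 + \<bar>C\<bar>))\<^sup>2"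
    proof -
      have "0 \<le> \<bar>C\<bar> * (\<bar>C\<bar> * 25)" "C \<le> \<bar>C\<bar>" "0 \<le> \<bar>C\<bar>" by auto
      moreover have "(5 * (1 + \<bar>C\<bar>))\<^sup>2 = 25 + 50 * \<bar>C\<bar> + \<bar>C\<bar> * (\<bar>C\<bar> * 25)"
        by (simp add: power2_eq_square algebra_simps)
      ultimately show ?thesis by linarith
    qed
    ultimately show ?thesis using near[OF s0 t] zero_le_power2[of k] by linarith
  qed
  have \<eta>: "k\<^sup>2 / 2 \<le> - (a s + \<beta> s + 2 * s * \<beta>' s)" if "s \<ge> 0" for s
  proof (cases "\<theta> s \<le> 1/20")
    case True
    have "0 \<le> s * (a s)\<^sup>2 / 10" "0 \<le> k\<^sup>2 / 2" using that by auto
    with near[OF that True] show ?thesis by linarith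
  qed (use far[OF that] in auto)
  have \<tau>s: "\<tau> / \<sigma> s \<le> \<tau>" "\<tau>\<^sup>2 / \<sigma> s \<le> \<tau>\<^sup>2" if "s \<ge> 0" for s
    using \<sigma>1[OF that] \<tau> by (auto simp: divide_le_eq mult_le_cancel_left1)
  define A where "A = \<tau> / \<epsilon> + 4 * \<tau> + \<tau>\<^sup>2 + k\<^sup>2"
  have A: "\<bar>\<Phi> s\<bar> \<le> A" "\<bar>\<beta> s\<bar> \<le> A" "s * (a s)\<^sup>2 \<le> A" if "s \<ge> 0" for s
  proof -
    have p: "0 \<le> \<tau> / \<epsilon>" "0 \<le> \<tau>" "0 \<le> \<tau>\<^sup>2" "0 \<le> k\<^sup>2" using \<tau> \<epsilon> by auto
    have "0 \<le> \<Phi> s" using nz[OF that] \<tau> by (simp add: \<Phi>_def)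
    moreover have "\<Phi> s \<le> \<tau> / \<epsilon>" using nz[OF that] \<tau> \<epsilon> by (simp add: \<Phi>_def q_def field_simps)
    ultimately show "\<bar>\<Phi> s\<bar> \<le> A" unfolding A_def using p by linarith
    show "s * (a s)\<^sup>2 \<le> A" unfolding A_def using sa2[OF that] \<tau>s[OF that] p by linarith
    have "(2 * m s + 1) * a s \<le> (11/3) * \<tau>"
      using m43[OF that] m0[OF that] asig[OF that] \<tau>s[OF that] a0[OF that] by (intro mult_mono) auto
    moreover have "0 \<le> (2 * m s + 1) * a s" using m0[OF that] a0[OF that] by simp
    moreover have "0 \<le> s * (a s)\<^sup>2" using that by simp
    ultimately show "\<bar>\<beta> s\<bar> \<le> A"
      unfolding \<beta>_def A_def using sa2[OF that] \<tau>s[OF that] p by linarith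
  qed
  have "carleman_weight k S C \<Phi> a a' \<beta> \<beta>' A (k\<^sup>2 / 2)"
    unfolding carleman_weight_def
    by (intro conjI allI impI d\<Phi> da d\<beta> ca' c\<beta>' \<beta>eq a0 A \<eta> on_S) auto
  moreover have "k\<^sup>2 / 2 > 0" using k by simp
  ultimately show ?thesis by blast
qed

section \<open>The Carleman inequality\<close>

text \<open>An identity of Rellich and Pohozaev type. The multiplier \<open>G\<close> is \<open>2 r\<^bsup>(1-N)/2\<^esup> r \<partial>\<^sub>r (r\<^bsup>(N-1)/2\<^esup> v)\<close>
  with \<open>r = |x - c|\<close>. The vector field contains both \<open>G P\<close> and \<open>|P|\<^sup>2 (x - c)\<close>, where \<open>P\<close> is the gradient of
  \<open>v\<close> and \<open>H\<close> its derivative, because their second order terms \<open>P \<bullet> H (x - c)\<close> cancel by the symmetry of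
  \<open>H\<close>; the trace of \<open>H\<close> is all that survives of the second derivatives.\<close>

lemma carleman_flux_divergence:
  fixes v :: "'a::euclidean_space \<Rightarrow> real" and P :: "'a \<Rightarrow> 'a" and H :: "'a \<Rightarrow> 'a \<Rightarrow> 'a" and c :: 'a
  assumes v: "\<And>x. (v has_derivative (\<lambda>h. P x \<bullet> h)) (at x)"
    and P: "\<And>x. (P has_derivative H x) (at x)"
    and sym: "\<And>x h k. H x h \<bullet> k = h \<bullet> H x k"
    and contH: "\<And>h. continuous_on UNIV (\<lambda>x. H x h)"
    and b: "\<And>s. s \<ge> 0 \<Longrightarrow> (\<beta> has_real_derivative \<beta>' s) (at s)"
    and b': "continuous_on {0..} \<beta>'"
    and s: "\<And>x. s x = (x - c) \<bullet> (x - c)"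
    and G: "\<And>x. G x = 2 * ((x - c) \<bullet> P x) + (real DIM('a) - 1) * v x"
    and Z: "\<And>x. Z x = - (G x *\<^sub>R P x) + (P x \<bullet> P x + \<beta> (s x) * (v x)\<^sup>2) *\<^sub>R (x - c)"
  shows "\<exists>Z'. (\<forall>x. (Z has_derivative Z' x) (at x)) \<and> (\<forall>h. continuous_on UNIV (\<lambda>x. Z' x h))
    \<and> (\<forall>x. tr (Z' x) = - (P x \<bullet> P x) - G x * tr (H x) + \<beta> (s x) * v x * G x
       + (\<beta> (s x) + 2 * s x * \<beta>' (s x)) * (v x)\<^sup>2)"
proof -
  define N where "N = real DIM('a)"
  define Z' where "Z' x h = - (((2 *\<^sub>R P x + 2 *\<^sub>R H x (x - c) + (N - 1) *\<^sub>R P x) \<bullet> h) *\<^sub>R P x)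
     + - (G x *\<^sub>R H x h)
     + (((2 *\<^sub>R H x (P x) + (2 * \<beta>' (s x) * (v x)\<^sup>2) *\<^sub>R (x - c) + (2 * \<beta> (s x) * v x) *\<^sub>R P x) \<bullet> h) *\<^sub>R (x - c)
     + (P x \<bullet> P x + \<beta> (s x) * (v x)\<^sup>2) *\<^sub>R h)" for x h
  have s0: "s x \<ge> 0" for x by (simp add: s)
  have ds: "(s has_derivative (\<lambda>h. 2 * ((x - c) \<bullet> h))) (at x)" for x
    unfolding s[abs_def] by (auto intro!: derivative_eq_intros simp: inner_commute)
  have dbs: "((\<lambda>x. \<beta> (s x)) has_derivative (\<lambda>h. \<beta>' (s x) * (2 * ((x - c) \<bullet> h)))) (at x)" for x
    using has_derivative_compose[OF ds b[OF s0, unfolded has_field_derivative_def]] .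
  have dZ: "(Z has_derivative Z' x) (at x)" for x
  proof -
    have dG: "(G has_derivative (\<lambda>h. 2 * (h \<bullet> P x + (x - c) \<bullet> H x h) + (N - 1) * (P x \<bullet> h))) (at x)"
      unfolding G[abs_def] N_def by (auto intro!: derivative_eq_intros v P simp: algebra_simps)
    have dq: "((\<lambda>x. P x \<bullet> P x + \<beta> (s x) * (v x)\<^sup>2) has_derivative
       (\<lambda>h. 2 * (P x \<bullet> H x h) + (\<beta>' (s x) * (2 * ((x - c) \<bullet> h)) * (v x)\<^sup>2 + \<beta> (s x) * (2 * v x * (P x \<bullet> h))))) (at x)"
      by (auto intro!: derivative_eq_intros v P dbs simp: algebra_simps inner_commute)
    have dx: "((\<lambda>x. x - c) has_derivative (\<lambda>h. h)) (at x)" by (auto intro!: derivative_eq_intros)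
    have eq: "- (g *\<^sub>R Hh + (2 * (h \<bullet> Q + y \<bullet> Hh) + (N - 1) * (Q \<bullet> h)) *\<^sub>R Q)
        + (t *\<^sub>R h + (2 * (Q \<bullet> Hh) + (b' * (2 * (y \<bullet> h)) * v\<^sup>2 + b * (2 * v * (Q \<bullet> h)))) *\<^sub>R y)
      = - (((2 *\<^sub>R Q + 2 *\<^sub>R Hy + (N - 1) *\<^sub>R Q) \<bullet> h) *\<^sub>R Q) + - (g *\<^sub>R Hh)
        + (((2 *\<^sub>R HQ + (2 * b' * v\<^sup>2) *\<^sub>R y + (2 * b * v) *\<^sub>R Q) \<bullet> h) *\<^sub>R y + t *\<^sub>R h)"
      if "y \<bullet> Hh = Hy \<bullet> h" "Q \<bullet> Hh = HQ \<bullet> h" for Q y Hy HQ Hh h :: 'a and g t b b' v :: real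
      using that by (simp add: inner_add_left inner_commute[of h Q] algebra_simps)
    show ?thesis
      unfolding Z[abs_def] Z'_def
      by (rule has_derivative_eq_rhs[OF has_derivative_add[OF has_derivative_minus[OF has_derivative_scaleR[OF dG P]]
            has_derivative_scaleR[OF dq dx]]])
        (rule ext, rule eq, (rule sym[symmetric])+)
  qed
  have cv: "continuous_on UNIV v" and cP: "continuous_on UNIV P"
    by (rule has_derivative_continuous_UNIV[OF v] has_derivative_continuous_UNIV[OF P])+
  have cs: "continuous_on UNIV s" unfolding s[abs_def] by (intro continuous_intros)
  have cb: "continuous_on UNIV (\<lambda>x. \<beta> (s x))"
    by (rule has_derivative_continuous_UNIV[OF dbs])
  have cb': "continuous_on UNIV (\<lambda>x. \<beta>' (s x))"
    by (rule continuous_on_compose2[OF b' cs]) (use s0 in auto)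
  have lin: "linear (H x)" for x using P has_derivative_linear by blast
  have cHF: "continuous_on UNIV (\<lambda>x. H x (F x))" if "continuous_on UNIV F" for F
  proof -
    have "H x (F x) = (\<Sum>b\<in>Basis. (F x \<bullet> b) *\<^sub>R H x b)" for x
    proof -
      have "H x (F x) = H x (\<Sum>b\<in>Basis. (F x \<bullet> b) *\<^sub>R b)" by (simp add: euclidean_representation)
      then show ?thesis by (simp add: linear_sum[OF lin] linear_scale[OF lin])
    qed
    then show ?thesis by (simp only:) (intro continuous_intros contH that)
  qed
  have cZ': "continuous_on UNIV (\<lambda>x. Z' x h)" for h
    unfolding Z'_def G by (intro continuous_intros cHF cP cv cb cb')
  have trZ: "tr (Z' x) = - (P x \<bullet> P x) - G x * tr (H x) + \<beta> (s x) * v x * G x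
       + (\<beta> (s x) + 2 * s x * \<beta>' (s x)) * (v x)\<^sup>2" for x
  proof -
    have alg: "- (2 * pp + 2 * hp + (D - 1) * pp) - g * t + (2 * hp + 2 * b' * v\<^sup>2 * r + 2 * b * v * yp + (pp + b * v\<^sup>2) * D)
      = - pp - g * t + b * v * (2 * yp + (D - 1) * v) + (b + 2 * r * b') * v\<^sup>2"
      for pp hp D g t b b' v r yp :: real
      by (simp add: algebra_simps power2_eq_square)
    have "tr (Z' x) = - ((2 *\<^sub>R P x + 2 *\<^sub>R H x (x - c) + (N - 1) *\<^sub>R P x) \<bullet> P x) - G x * tr (H x)
      + ((2 *\<^sub>R H x (P x) + (2 * \<beta>' (s x) * (v x)\<^sup>2) *\<^sub>R (x - c) + (2 * \<beta> (s x) * v x) *\<^sub>R P x) \<bullet> (x - c)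
     + (P x \<bullet> P x + \<beta> (s x) * (v x)\<^sup>2) * N)"
      unfolding Z'_def by (simp only: tr_simps N_def)
    moreover have "H x (P x) \<bullet> (x - c) = H x (x - c) \<bullet> P x"
      unfolding sym[of x "P x" "x - c"] by (rule inner_commute)
    ultimately show ?thesis
      by (simp only: inner_add_left inner_scaleR_left G s N_def inner_commute[of "P x" "x - c"])
        (rule alg)
  qed
  show ?thesis by (intro exI[of _ Z'] conjI allI dZ cZ' trZ)
qed

text \<open>For \<open>v = e\<^sup>\<phi> w\<close> with gradient \<open>P\<close> and \<open>g = e\<^sup>\<phi> f\<close>, the trace of the second derivative of \<open>v\<close> is
  \<open>g + a G + (\<beta> + 2 a) v\<close>. The choice of \<open>\<beta>\<close> is the one for which the divergence of the
  vector field becomes \<open>- |P|\<^sup>2 - g G - a (G + v)\<^sup>2 - J v\<^sup>2\<close>. The term \<open>a (G + v)\<^sup>2\<close> is dropped, and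
  \<open>|P|\<^sup>2\<close> absorbs the part of \<open>g G\<close> that contains the gradient at the price of \<open>S g\<^sup>2\<close>. The part
  \<open>(N - 1) g v\<close> costs \<open>\<nu> g\<^sup>2 + \<nu> v\<^sup>2\<close> on the support of \<open>f\<close>. This is why \<open>f\<close> should
  live on an annulus: near the centre \<open>J\<close> cannot be made large enough to pay for \<open>\<nu> v\<^sup>2\<close>.\<close>

lemma carleman_inequality:
  fixes w :: "'a::euclidean_space \<Rightarrow> real" and p :: "'a \<Rightarrow> 'a" and H :: "'a \<Rightarrow> 'a \<Rightarrow> 'a" and c :: 'a
    and \<Phi> a a' \<beta> \<beta>' :: "real \<Rightarrow> real" and A \<eta> S C k :: real
  assumes w: "\<And>x. (w has_derivative (\<lambda>h. p x \<bullet> h)) (at x)"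
    and p: "\<And>x. (p has_derivative H x) (at x)"
    and sym: "\<And>x h k. H x h \<bullet> k = h \<bullet> H x k"
    and contH: "\<And>h. continuous_on UNIV (\<lambda>x. H x h)"
    and w2: "integrable lborel (\<lambda>x. (w x)\<^sup>2)" and p2: "integrable lborel (\<lambda>x. (norm (p x))\<^sup>2)"
    and f2: "integrable lborel (\<lambda>x. (f x)\<^sup>2)"
    and f: "\<And>x. f x = tr (H x) + k\<^sup>2 * w x"
    and supp: "\<And>x. f x \<noteq> 0 \<Longrightarrow> 1 \<le> (x - c) \<bullet> (x - c) \<and> (x - c) \<bullet> (x - c) \<le> S"
    and W: "carleman_weight k S C \<Phi> a a' \<beta> \<beta>' A \<eta>"
  defines "s \<equiv> \<lambda>x. (x - c) \<bullet> (x - c)" and "\<nu> \<equiv> (real DIM('a) - 1) / 2"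
  shows "0 \<le> (LINT x|lborel. exp (2 * \<Phi> (s x)) * ((S + \<nu>) * (f x)\<^sup>2)
     + exp (2 * \<Phi> (s x)) * (if 1 \<le> s x \<and> s x \<le> S then \<nu> - C else - \<eta>) * (w x)\<^sup>2)"
proof -
  have weight: "\<And>s. s \<ge> 0 \<Longrightarrow> (\<Phi> has_real_derivative a s / 2) (at s)"
    "\<And>s. s \<ge> 0 \<Longrightarrow> (a has_real_derivative a' s) (at s)"
    "\<And>s. s \<ge> 0 \<Longrightarrow> (\<beta> has_real_derivative \<beta>' s) (at s)"
    "continuous_on {0..} a'" "continuous_on {0..} \<beta>'"
    "\<And>s. s \<ge> 0 \<Longrightarrow> \<beta> s = 2 * s * a' s - a s - s * (a s)\<^sup>2 - k\<^sup>2"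
    "\<And>s. s \<ge> 0 \<Longrightarrow> 0 \<le> a s"
    "\<And>s. s \<ge> 0 \<Longrightarrow> \<bar>\<Phi> s\<bar> \<le> A" "\<And>s. s \<ge> 0 \<Longrightarrow> \<bar>\<beta> s\<bar> \<le> A" "\<And>s. s \<ge> 0 \<Longrightarrow> s * (a s)\<^sup>2 \<le> A"
    "\<And>s. s \<ge> 0 \<Longrightarrow> \<eta> \<le> - (a s + \<beta> s + 2 * s * \<beta>' s)"
    "\<And>s. 1 \<le> s \<Longrightarrow> s \<le> S \<Longrightarrow> C \<le> - (a s + \<beta> s + 2 * s * \<beta>' s)"
    using W unfolding carleman_weight_def by blast+
  have \<nu>0: "\<nu> \<ge> 0" unfolding \<nu>_def using DIM_positive[where 'a='a] by simp
  have N2: "real DIM('a) - 1 = 2 * \<nu>" by (simp add: \<nu>_def)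
  have s0: "s x \<ge> 0" for x by (simp add: s_def)
  have A0: "A \<ge> 0" using weight(8)[of 0] by simp
  define e where "e x = exp (\<Phi> (s x))" for x
  have e: "0 < e x" "e x \<le> exp A" "exp (2 * \<Phi> (s x)) = (e x)\<^sup>2" for x
    using weight(8)[OF s0[of x]] by (auto simp: e_def abs_le_iff power2_eq_square exp_add[symmetric])
  have e2: "(e x)\<^sup>2 \<le> exp (2 * A)" for x
    using weight(8)[OF s0[of x]] by (simp add: e(3)[symmetric] abs_le_iff)
  define v where "v x = e x * w x" for x
  define P where "P x = e x *\<^sub>R (p x + (a (s x) * w x) *\<^sub>R (x - c))" for x
  define HV where "HV x h = e x *\<^sub>R (((a (s x) *\<^sub>R (x - c)) \<bullet> h) *\<^sub>R (p x + (a (s x) * w x) *\<^sub>R (x - c))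
     + H x h + (((2 * a' (s x) * w x) *\<^sub>R (x - c) + a (s x) *\<^sub>R p x) \<bullet> h) *\<^sub>R (x - c) + (a (s x) * w x) *\<^sub>R h)" for x h
  have ds: "(s has_derivative (\<lambda>h. 2 * ((x - c) \<bullet> h))) (at x)" for x
    unfolding s_def by (auto intro!: derivative_eq_intros simp: inner_commute)
  have de: "(e has_derivative (\<lambda>h. e x * (a (s x) * ((x - c) \<bullet> h)))) (at x)" for x
  proof -
    have "((\<lambda>x. \<Phi> (s x)) has_derivative (\<lambda>h. a (s x) / 2 * (2 * ((x - c) \<bullet> h)))) (at x)"
      using has_derivative_compose[OF ds weight(1)[OF s0, unfolded has_field_derivative_def]] .
    from has_derivative_compose[OF this DERIV_exp[unfolded has_field_derivative_def]]
    show ?thesis by (simp add: e_def[abs_def] mult_ac)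
  qed
  have da: "((\<lambda>x. a (s x)) has_derivative (\<lambda>h. a' (s x) * (2 * ((x - c) \<bullet> h)))) (at x)" for x
    using has_derivative_compose[OF ds weight(2)[OF s0, unfolded has_field_derivative_def]] .
  have dx: "((\<lambda>x. x - c) has_derivative (\<lambda>h. h)) (at x)" for x by (auto intro!: derivative_eq_intros)
  have dv: "(v has_derivative (\<lambda>h. P x \<bullet> h)) (at x)" for x
    unfolding v_def[abs_def] P_def
    by (rule has_derivative_eq_rhs[OF has_derivative_mult[OF de w]])
      (simp add: fun_eq_iff algebra_simps inner_add_left)
  have dP: "(P has_derivative HV x) (at x)" for x
    unfolding P_def[abs_def] HV_def
    by (rule has_derivative_eq_rhs[OF has_derivative_scaleR[OF de has_derivative_add[OF p
            has_derivative_scaleR[OF has_derivative_mult[OF da w] dx]]]])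
      (simp add: fun_eq_iff algebra_simps inner_add_left)
  have symV: "HV x h \<bullet> l = h \<bullet> HV x l" for x h l
    unfolding HV_def using sym[of x h l]
    by (simp add: algebra_simps inner_add_left inner_add_right inner_commute)
  have cw: "continuous_on UNIV w" and cp: "continuous_on UNIV p" and ce: "continuous_on UNIV e"
     and ca: "continuous_on UNIV (\<lambda>x. a (s x))" and cs: "continuous_on UNIV s"
     and cv: "continuous_on UNIV v" and cP: "continuous_on UNIV P"
    by (rule has_derivative_continuous_UNIV[OF w] has_derivative_continuous_UNIV[OF p]
        has_derivative_continuous_UNIV[OF de] has_derivative_continuous_UNIV[OF da]
        has_derivative_continuous_UNIV[OF ds] has_derivative_continuous_UNIV[OF dv]
        has_derivative_continuous_UNIV[OF dP])+
  have ca': "continuous_on UNIV (\<lambda>x. a' (s x))"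
    by (rule continuous_on_compose2[OF weight(4) cs]) (use s0 in auto)
  have contV: "continuous_on UNIV (\<lambda>x. HV x h)" for h
    unfolding HV_def by (intro continuous_intros ce ca cp cw ca' contH)
  define G where "G x = 2 * ((x - c) \<bullet> P x) + (real DIM('a) - 1) * v x" for x
  have trV: "tr (HV x) = e x * f x + a (s x) * G x + (\<beta> (s x) + 2 * a (s x)) * v x" for x
  proof -
    have ss: "(x - c) \<bullet> (x - c) = s x" by (simp add: s_def)
    have comm: "p x \<bullet> (x - c) = (x - c) \<bullet> p x" by (rule inner_commute)
    have "tr (HV x) = e x * ((a (s x) *\<^sub>R (x - c)) \<bullet> (p x + (a (s x) * w x) *\<^sub>R (x - c)) + tr (H x)
      + ((2 * a' (s x) * w x) *\<^sub>R (x - c) + a (s x) *\<^sub>R p x) \<bullet> (x - c) + (a (s x) * w x) * DIM('a))"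
      unfolding HV_def by (simp only: tr_simps)
    also have "\<dots> = e x * f x + a (s x) * G x + (\<beta> (s x) + 2 * a (s x)) * v x"
      unfolding f G_def P_def v_def weight(6)[OF s0]
      by (simp only: inner_add_left inner_add_right inner_scaleR_left inner_scaleR_right ss comm)
        (simp add: ring_distribs power2_eq_square)
    finally show ?thesis .
  qed
  define Z where "Z x = - (G x *\<^sub>R P x) + (P x \<bullet> P x + \<beta> (s x) * (v x)\<^sup>2) *\<^sub>R (x - c)" for x
  have s_eq: "s x = (x - c) \<bullet> (x - c)" for x by (simp add: s_def)
  have "\<exists>Z'. (\<forall>x. (Z has_derivative Z' x) (at x)) \<and> (\<forall>h. continuous_on UNIV (\<lambda>x. Z' x h))
    \<and> (\<forall>x. tr (Z' x) = - (P x \<bullet> P x) - G x * tr (HV x) + \<beta> (s x) * v x * G x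
       + (\<beta> (s x) + 2 * s x * \<beta>' (s x)) * (v x)\<^sup>2)"
    by (rule carleman_flux_divergence[OF dv dP symV contV weight(3) weight(5) s_eq G_def Z_def])
  then obtain Z' where Z'_all: "\<forall>x. (Z has_derivative Z' x) (at x)" "\<forall>h. continuous_on UNIV (\<lambda>x. Z' x h)"
    "\<forall>x. tr (Z' x) = - (P x \<bullet> P x) - G x * tr (HV x) + \<beta> (s x) * v x * G x
       + (\<beta> (s x) + 2 * s x * \<beta>' (s x)) * (v x)\<^sup>2"
    by (elim exE conjE)
  note Z' = Z'_all[rule_format]
  define h where "h x = exp (2 * \<Phi> (s x)) * ((S + \<nu>) * (f x)\<^sup>2)
     + exp (2 * \<Phi> (s x)) * (if 1 \<le> s x \<and> s x \<le> S then \<nu> - C else - \<eta>) * (w x)\<^sup>2" for x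
  have rs: "norm (x - c) ^ 2 = s x" for x by (simp add: s_def dot_square_norm)
  have divh: "tr (Z' x) \<le> h x" for x
  proof -
    define g where "g = e x * f x"
    define J where "J = - (a (s x) + \<beta> (s x) + 2 * s x * \<beta>' (s x))"
    define B where "B \<longleftrightarrow> 1 \<le> s x \<and> s x \<le> S"
    have "tr (Z' x) = - (P x \<bullet> P x) - g * G x - a (s x) * (G x + v x)\<^sup>2 - J * (v x)\<^sup>2"
      unfolding Z'(3) trV g_def J_def by (simp add: algebra_simps power2_eq_square)
    also have "\<dots> \<le> - (norm (P x))\<^sup>2 - g * G x - J * (v x)\<^sup>2"
      using weight(7)[OF s0[of x]] by (simp add: dot_square_norm)
    finally have 1: "tr (Z' x) \<le> - (norm (P x))\<^sup>2 - g * G x - J * (v x)\<^sup>2" .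
    have hx: "h x = (S + \<nu>) * g\<^sup>2 + (if B then \<nu> - C else - \<eta>) * (v x)\<^sup>2"
      by (simp add: h_def e(3) g_def v_def B_def power_mult_distrib)
    show ?thesis
    proof (cases B)
      case True
      have "\<bar>(x - c) \<bullet> P x\<bar> \<le> norm (x - c) * norm (P x)" by (rule Cauchy_Schwarz_ineq2)
      then have "2 * (\<bar>g\<bar> * \<bar>(x - c) \<bullet> P x\<bar>) \<le> 2 * (\<bar>g\<bar> * (norm (x - c) * norm (P x)))"
        by (intro mult_left_mono) auto
      moreover have "- g * (2 * t) \<le> 2 * (\<bar>g\<bar> * \<bar>t\<bar>)" for t
        using abs_ge_self[of "- g * t"] by (simp add: abs_mult)
      ultimately have "- g * (2 * ((x - c) \<bullet> P x)) \<le> 2 * (\<bar>g\<bar> * (norm (x - c) * norm (P x)))"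
        by (rule order_trans[rotated])
      also have "\<dots> = 2 * (\<bar>g\<bar> * norm (x - c)) * norm (P x)" by (simp only: mult.assoc)
      also have "\<dots> \<le> (\<bar>g\<bar> * norm (x - c))\<^sup>2 + (norm (P x))\<^sup>2" by (rule sum_squares_bound)
      also have "(\<bar>g\<bar> * norm (x - c))\<^sup>2 = s x * g\<^sup>2" by (simp add: power_mult_distrib rs)
      also have "\<dots> \<le> S * g\<^sup>2" using True by (intro mult_right_mono) (auto simp: B_def)
      finally have 2: "- g * (2 * ((x - c) \<bullet> P x)) \<le> S * g\<^sup>2 + (norm (P x))\<^sup>2" by simp
      have "2 * (- g) * v x \<le> (- g)\<^sup>2 + (v x)\<^sup>2" by (rule sum_squares_bound)
      then have "\<nu> * (2 * (- g) * v x) \<le> \<nu> * (g\<^sup>2 + (v x)\<^sup>2)" using \<nu>0 by (intro mult_left_mono) auto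
      moreover have "- g * G x = - g * (2 * ((x - c) \<bullet> P x)) + \<nu> * (2 * (- g) * v x)"
        by (simp only: G_def N2) (simp add: algebra_simps)
      moreover have "C * (v x)\<^sup>2 \<le> J * (v x)\<^sup>2"
        using weight(12)[of "s x"] True by (intro mult_right_mono) (auto simp: B_def J_def)
      moreover have "h x = S * g\<^sup>2 + \<nu> * (g\<^sup>2 + (v x)\<^sup>2) - C * (v x)\<^sup>2"
        unfolding hx using True by (simp add: ring_distribs)
      ultimately show ?thesis using 1 2 by linarith
    next
      case False
      then have "g = 0" using supp[of x] by (auto simp: g_def B_def s_def)
      have "\<eta> * (v x)\<^sup>2 \<le> J * (v x)\<^sup>2"
        using weight(11)[OF s0[of x]] by (intro mult_right_mono) (auto simp: J_def)
      moreover have "0 \<le> (norm (P x))\<^sup>2" by simp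
      moreover have "h x = - (\<eta> * (v x)\<^sup>2)" using False \<open>g = 0\<close> by (simp add: hx)
      moreover have "g * G x = 0" using \<open>g = 0\<close> by simp
      ultimately show ?thesis using 1 by linarith
    qed
  qed
  have [measurable]: "w \<in> borel_measurable borel" "p \<in> borel_measurable borel" "P \<in> borel_measurable borel"
     "v \<in> borel_measurable borel" "s \<in> borel_measurable borel" "e \<in> borel_measurable borel"
    by (auto intro!: borel_measurable_continuous_onI cw cp cP cv cs ce)
  have [measurable]: "f \<in> borel_measurable borel"
  proof -
    have "f = (\<lambda>x. tr (H x) + k\<^sup>2 * w x)" using f by auto
    then show ?thesis unfolding tr_def
      by (auto intro!: borel_measurable_continuous_onI continuous_intros contH cw)
  qed
  have iv: "integrable lborel (\<lambda>x. (v x)\<^sup>2)"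
  proof (rule Bochner_Integration.integrable_bound[where f="\<lambda>x. exp (2 * A) * (w x)\<^sup>2"])
    show "AE x in lborel. norm ((v x)\<^sup>2) \<le> norm (exp (2 * A) * (w x)\<^sup>2)"
      using e2 by (intro AE_I2) (simp add: v_def power_mult_distrib mult_right_mono)
  qed (use w2 in auto)
  have iP: "integrable lborel (\<lambda>x. (norm (P x))\<^sup>2)"
  proof (rule Bochner_Integration.integrable_bound[where f="\<lambda>x. exp (2 * A) * (2 * (norm (p x))\<^sup>2 + (2 * A) * (w x)\<^sup>2)"])
    have "(norm (P x))\<^sup>2 \<le> exp (2 * A) * (2 * (norm (p x))\<^sup>2 + (2 * A) * (w x)\<^sup>2)" for x
    proof -
      have "(norm (p x + (a (s x) * w x) *\<^sub>R (x - c)))\<^sup>2 \<le> (norm (p x) + norm ((a (s x) * w x) *\<^sub>R (x - c)))\<^sup>2"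
        by (intro power_mono norm_triangle_ineq) auto
      also have "\<dots> \<le> 2 * (norm (p x))\<^sup>2 + 2 * (norm ((a (s x) * w x) *\<^sub>R (x - c)))\<^sup>2"
        using sum_squares_bound[of "norm (p x)" "norm ((a (s x) * w x) *\<^sub>R (x - c))"]
        by (simp add: power2_sum)
      also have "(norm ((a (s x) * w x) *\<^sub>R (x - c)))\<^sup>2 = (s x * (a (s x))\<^sup>2) * (w x)\<^sup>2"
        by (simp add: power_mult_distrib rs)
      also have "\<dots> \<le> A * (w x)\<^sup>2" using weight(10)[OF s0[of x]] by (intro mult_right_mono) auto
      finally have "(norm (p x + (a (s x) * w x) *\<^sub>R (x - c)))\<^sup>2 \<le> 2 * (norm (p x))\<^sup>2 + (2 * A) * (w x)\<^sup>2" by simp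
      then have "(e x)\<^sup>2 * (norm (p x + (a (s x) * w x) *\<^sub>R (x - c)))\<^sup>2 \<le> exp (2 * A) * (2 * (norm (p x))\<^sup>2 + (2 * A) * (w x)\<^sup>2)"
        using e2[of x] by (intro mult_mono) auto
      then show ?thesis by (simp add: P_def power_mult_distrib)
    qed
    then show "AE x in lborel. norm ((norm (P x))\<^sup>2) \<le> norm (exp (2 * A) * (2 * (norm (p x))\<^sup>2 + (2 * A) * (w x)\<^sup>2))"
      using A0 by (intro AE_I2) (simp add: abs_of_nonneg)
  qed (use w2 p2 in auto)
  define l where "l x = (1 + norm c) * ((3 + \<nu>) * (norm (P x))\<^sup>2 + (\<nu> + A) * (v x)\<^sup>2)" for x
  have il: "integrable lborel l" unfolding l_def[abs_def]
    by (intro integrable_mult_right Bochner_Integration.integrable_add iv iP)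
  have growth: "norm (Z x) \<le> (1 + norm x) * l x" for x
  proof -
    define r where "r = norm (x - c)"
    define n where "n = norm (P x)"
    have r0: "r \<ge> 0" "n \<ge> 0" by (auto simp: r_def n_def)
    have "\<bar>G x\<bar> \<le> 2 * \<bar>(x - c) \<bullet> P x\<bar> + (2 * \<nu>) * \<bar>v x\<bar>"
      using \<nu>0 abs_triangle_ineq[of "2 * ((x - c) \<bullet> P x)" "(2 * \<nu>) * v x"]
      by (simp add: G_def N2 abs_mult)
    also have "\<dots> \<le> 2 * (r * n) + (2 * \<nu>) * \<bar>v x\<bar>"
      using Cauchy_Schwarz_ineq2[of "x - c" "P x"] by (simp add: r_def n_def)
    finally have "\<bar>G x\<bar> * n \<le> (2 * (r * n) + (2 * \<nu>) * \<bar>v x\<bar>) * n" using r0 by (intro mult_right_mono)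
    also have "\<dots> = 2 * r * n\<^sup>2 + \<nu> * (2 * \<bar>v x\<bar> * n)" by (simp add: algebra_simps power2_eq_square)
    also have "\<dots> \<le> 2 * r * n\<^sup>2 + \<nu> * ((v x)\<^sup>2 + n\<^sup>2)"
      using sum_squares_bound[of "\<bar>v x\<bar>" n] \<nu>0 by (intro add_left_mono mult_left_mono) auto
    finally have 1: "\<bar>G x\<bar> * n \<le> 2 * r * n\<^sup>2 + \<nu> * ((v x)\<^sup>2 + n\<^sup>2)" .
    have "\<bar>\<beta> (s x) * (v x)\<^sup>2\<bar> \<le> A * (v x)\<^sup>2"
      using weight(9)[OF s0[of x]] by (simp add: abs_mult mult_right_mono)
    then have "\<bar>P x \<bullet> P x + \<beta> (s x) * (v x)\<^sup>2\<bar> \<le> n\<^sup>2 + A * (v x)\<^sup>2"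
      unfolding dot_square_norm n_def using zero_le_power2[of "norm (P x)"] by linarith
    then have 2: "\<bar>P x \<bullet> P x + \<beta> (s x) * (v x)\<^sup>2\<bar> * r \<le> (n\<^sup>2 + A * (v x)\<^sup>2) * r"
      using r0 by (intro mult_right_mono)
    have "norm (Z x) \<le> \<bar>G x\<bar> * n + \<bar>P x \<bullet> P x + \<beta> (s x) * (v x)\<^sup>2\<bar> * r"
      unfolding Z_def by (rule order_trans[OF norm_triangle_ineq]) (simp add: n_def r_def)
    also have "\<dots> \<le> (2 * r * n\<^sup>2 + \<nu> * ((v x)\<^sup>2 + n\<^sup>2)) + (n\<^sup>2 + A * (v x)\<^sup>2) * r"
      using 1 2 by (rule add_mono)
    also have "\<dots> \<le> (1 + r) * ((3 + \<nu>) * n\<^sup>2 + (\<nu> + A) * (v x)\<^sup>2)"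
    proof -
      have "0 \<le> 3 * n\<^sup>2 + A * (v x)\<^sup>2 + r * (\<nu> * n\<^sup>2) + r * (\<nu> * (v x)\<^sup>2)" using r0 A0 \<nu>0 by simp
      then show ?thesis by (simp add: algebra_simps)
    qed
    also have "\<dots> \<le> ((1 + norm x) * (1 + norm c)) * ((3 + \<nu>) * n\<^sup>2 + (\<nu> + A) * (v x)\<^sup>2)"
    proof (rule mult_right_mono)
      have "(1 + norm x) * (1 + norm c) = 1 + norm x + norm c + norm x * norm c" by (simp add: algebra_simps)
      moreover have "0 \<le> norm x * norm c" by simp
      ultimately show "1 + r \<le> (1 + norm x) * (1 + norm c)"
        using norm_triangle_ineq4[of x c] unfolding r_def by linarith
    qed (use A0 \<nu>0 in simp)
    finally show ?thesis by (simp add: l_def n_def)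
  qed
  have ih: "integrable lborel h" unfolding h_def[abs_def]
  proof (rule Bochner_Integration.integrable_add)
    show "integrable lborel (\<lambda>x. exp (2 * \<Phi> (s x)) * ((S + \<nu>) * (f x)\<^sup>2))"
    proof (rule Bochner_Integration.integrable_bound[where f="\<lambda>x. exp (2 * A) * (\<bar>S + \<nu>\<bar> * (f x)\<^sup>2)"])
      show "AE x in lborel. norm (exp (2 * \<Phi> (s x)) * ((S + \<nu>) * (f x)\<^sup>2)) \<le> norm (exp (2 * A) * (\<bar>S + \<nu>\<bar> * (f x)\<^sup>2))"
        unfolding e(3) using e2 by (intro AE_I2) (simp add: abs_mult mult_right_mono)
    qed (use f2 in \<open>auto simp: e(3)\<close>)
    show "integrable lborel (\<lambda>x. exp (2 * \<Phi> (s x)) * (if 1 \<le> s x \<and> s x \<le> S then \<nu> - C else - \<eta>) * (w x)\<^sup>2)"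
    proof (rule Bochner_Integration.integrable_bound[where f="\<lambda>x. exp (2 * A) * (\<bar>\<nu> - C\<bar> + \<bar>\<eta>\<bar>) * (w x)\<^sup>2"])
      have "\<bar>exp (2 * \<Phi> (s x)) * (if 1 \<le> s x \<and> s x \<le> S then \<nu> - C else - \<eta>) * (w x)\<^sup>2\<bar>
          \<le> exp (2 * A) * (\<bar>\<nu> - C\<bar> + \<bar>\<eta>\<bar>) * (w x)\<^sup>2" for x
        unfolding e(3) using e2[of x] by (auto simp: abs_mult intro!: mult_right_mono mult_mono)
      then show "AE x in lborel. norm (exp (2 * \<Phi> (s x)) * (if 1 \<le> s x \<and> s x \<le> S then \<nu> - C else - \<eta>) * (w x)\<^sup>2)
          \<le> norm (exp (2 * A) * (\<bar>\<nu> - C\<bar> + \<bar>\<eta>\<bar>) * (w x)\<^sup>2)"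
        by (intro AE_I2) (simp add: abs_mult)
    qed (use w2 in \<open>auto simp: e(3)\<close>)
  qed
  have "0 \<le> (LINT x|lborel. h x)"
    by (rule integral_nonneg_of_divergence_le[OF Z'(1,2) growth il divh ih])
  then show ?thesis by (simp only: h_def)
qed

section \<open>A smooth bump function\<close>

lemma Ck_Suc_imp_Ck: "Ck (Suc k) f \<Longrightarrow> Ck k f"
proof (induction k arbitrary: f)
  case 0
  then show ?case using differentiable_imp_continuous_on by auto
next
  case (Suc k)
  then show ?case by (metis Ck.simps(2))
qed

lemma Ck_SucI:
  fixes f :: "'a::euclidean_space \<Rightarrow> real"
  assumes "\<And>x. (f has_derivative f' x) (at x)" and "\<And>v. Ck k (\<lambda>x. f' x v)"
  shows "Ck (Suc k) f"
proof -
  have "frechet_derivative f (at x) = f' x" for x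
    using frechet_derivative_at[OF assms(1)] by simp
  then show ?thesis using assms
    by (auto simp: differentiable_on_def differentiable_def intro: has_derivative_at_withinI)
qed

lemma Ck_SucD:
  assumes "Ck (Suc k) f"
  shows "(f has_derivative frechet_derivative f (at x)) (at x)"
    and "Ck k (\<lambda>x. frechet_derivative f (at x) v)"
  using assms by (auto simp: differentiable_on_def frechet_derivative_works[symmetric])

lemma Ck_const: "Ck k (\<lambda>_. c)"
proof (induction k arbitrary: c)
  case (Suc k)
  show ?case by (rule Ck_SucI[where f' = "\<lambda>_ _. 0"]) (auto intro: Suc)
qed auto

lemma Ck_add: "Ck k f \<Longrightarrow> Ck k g \<Longrightarrow> Ck k (\<lambda>x. f x + g x)"
proof (induction k arbitrary: f g)
  case (Suc k)
  show ?case
    by (rule Ck_SucI[where f' = "\<lambda>x v. frechet_derivative f (at x) v + frechet_derivative g (at x) v"])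
      (use Suc in \<open>auto intro!: has_derivative_add Ck_SucD\<close>)
qed (auto intro: continuous_intros)

lemma Ck_mult: "Ck k f \<Longrightarrow> Ck k g \<Longrightarrow> Ck k (\<lambda>x. f x * g x)"
proof (induction k arbitrary: f g)
  case (Suc k)
  show ?case
    by (rule Ck_SucI[where f' = "\<lambda>x v. f x * frechet_derivative g (at x) v + frechet_derivative f (at x) v * g x"])
      (use Suc in \<open>auto intro!: has_derivative_mult Ck_add Suc.IH Ck_SucD Ck_Suc_imp_Ck[of k f] Ck_Suc_imp_Ck[of k g]\<close>)
qed (auto intro: continuous_intros)

lemma Ck_inner_affine: "Ck k (\<lambda>x::'a::euclidean_space. (x - p) \<bullet> v)"
proof (cases k)
  case (Suc j)
  show ?thesis unfolding Suc
    by (rule Ck_SucI[where f' = "\<lambda>_ h. h \<bullet> v"]) (auto intro!: derivative_eq_intros Ck_const)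
qed (auto intro!: continuous_intros)

lemma Ck_sq_dist: "Ck k (\<lambda>x::'a::euclidean_space. c + d * ((x - p) \<bullet> (x - p)))"
proof (cases k)
  case (Suc j)
  show ?thesis unfolding Suc
  proof (rule Ck_SucI[where f' = "\<lambda>x h. (2 * d) * ((x - p) \<bullet> h)"])
    show "((\<lambda>x. c + d * ((x - p) \<bullet> (x - p))) has_derivative (\<lambda>h. (2 * d) * ((x - p) \<bullet> h))) (at x)" for x
      by (auto intro!: derivative_eq_intros simp: inner_commute algebra_simps)
    show "Ck j (\<lambda>x. (2 * d) * ((x - p) \<bullet> v))" for v
      by (intro Ck_mult Ck_const Ck_inner_affine)
  qed
qed (auto intro!: continuous_intros)

text \<open>The derivative of \<open>exp (- 1 / t) / t ^ m\<close> is a combination of functions of the same form. Proving smoothness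
  for all \<open>m\<close> at once therefore turns it into an induction on the order of differentiability.\<close>

definition expn :: "nat \<Rightarrow> real \<Rightarrow> real" where
  "expn m t = (if t > 0 then exp (- (1 / t)) / t ^ m else 0)"

lemma expn_limit: "(expn m \<longlongrightarrow> 0) (at_right 0)"
proof -
  have "((\<lambda>x::real. x ^ m / exp x) \<longlongrightarrow> 0) at_top" by (rule tendsto_power_div_exp_0)
  then have "((\<lambda>t::real. (inverse t) ^ m / exp (inverse t)) \<longlongrightarrow> 0) (at_right 0)"
    by (rule filterlim_compose[OF _ filterlim_inverse_at_top_right])
  then show ?thesis
    by (rule Lim_transform_eventually)
      (auto simp: eventually_at_right_less expn_def exp_minus field_simps
        intro!: eventually_mono[OF eventually_at_right_less])
qed

lemma expn_deriv: "(expn m has_real_derivative expn (m + 2) t - m * expn (Suc m) t) (at t)"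
proof -
  consider "t > 0" | "t < 0" | "t = 0" by linarith
  then show ?thesis
  proof cases
    case 1
    have "((\<lambda>t. exp (- (1 / t)) / t ^ m) has_real_derivative
       (exp (- (1 / t)) * (1 / t ^ 2) * t ^ m - exp (- (1 / t)) * (real m * t ^ (m - 1))) / (t ^ m * t ^ m)) (at t)"
      using 1 by (auto intro!: derivative_eq_intros simp: power2_eq_square)
    moreover have "(exp (- (1 / t)) * (1 / t ^ 2) * t ^ m - exp (- (1 / t)) * (real m * t ^ (m - 1))) / (t ^ m * t ^ m)
       = expn (m + 2) t - m * expn (Suc m) t"
    proof (cases m)
      case (Suc j)
      then show ?thesis using 1 by (simp add: expn_def field_simps power2_eq_square)
    qed (use 1 in \<open>simp add: expn_def power2_eq_square\<close>)
    ultimately have "((\<lambda>t. exp (- (1 / t)) / t ^ m) has_real_derivative expn (m + 2) t - m * expn (Suc m) t) (at t)"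
      by (simp only:)
    then show ?thesis
      by (rule has_field_derivative_transform_within_open[where S="{0<..}"]) (use 1 in \<open>auto simp: expn_def\<close>)
  next
    case 2
    have "((\<lambda>t. 0) has_real_derivative 0) (at t)" by simp
    then have "(expn m has_real_derivative 0) (at t)"
      by (rule has_field_derivative_transform_within_open[where S="{..<0}"]) (use 2 in \<open>auto simp: expn_def\<close>)
    then show ?thesis using 2 by (simp add: expn_def)
  next
    case 3
    have "((\<lambda>h. (expn m (0 + h) - expn m 0) / h) \<longlongrightarrow> 0) (at_right 0)"
      by (rule Lim_transform_eventually[OF expn_limit[of "Suc m"]])
        (auto simp: expn_def intro!: eventually_mono[OF eventually_at_right_less])
    moreover have "((\<lambda>h. (expn m (0 + h) - expn m 0) / h) \<longlongrightarrow> 0) (at_left 0)"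
      by (rule Lim_transform_eventually[OF tendsto_const])
        (auto simp: expn_def eventually_at_left_field intro!: exI[of _ "-1"])
    ultimately show ?thesis using 3 by (simp add: DERIV_def filterlim_split_at expn_def)
  qed
qed

lemma expn_nonneg: "0 \<le> expn m t" by (simp add: expn_def)

lemma Ck_expn:
  fixes f :: "'a::euclidean_space \<Rightarrow> real"
  assumes "\<And>k. Ck k f"
  shows "Ck k (\<lambda>x. expn m (f x))"
proof (induction k arbitrary: m)
  case 0
  have "continuous_on UNIV (expn m)"
    using expn_deriv DERIV_isCont continuous_at_imp_continuous_on by blast
  then show ?case using assms[of 0] continuous_on_compose2[of UNIV "expn m" UNIV f] by simp
next
  case (Suc k)
  let ?f' = "\<lambda>x. frechet_derivative f (at x)"
  show ?case
  proof (rule Ck_SucI[where f' = "\<lambda>x v. (expn (m + 2) (f x) + (- real m) * expn (Suc m) (f x)) * ?f' x v"])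
    show "((\<lambda>x. expn m (f x)) has_derivative (\<lambda>v. (expn (m + 2) (f x) + (- real m) * expn (Suc m) (f x)) * ?f' x v)) (at x)" for x
      using has_derivative_compose[OF Ck_SucD(1)[OF assms, of x] expn_deriv[unfolded has_field_derivative_def]] by simp
    show "Ck k (\<lambda>x. (expn (m + 2) (f x) + (- real m) * expn (Suc m) (f x)) * ?f' x v)" for v
      by (intro Ck_mult Ck_add Ck_const Suc Ck_SucD assms)
  qed
qed

text \<open>The function \<open>bump c\<close> is supported in the ball of radius \<open>1 / sqrt c\<close>. Its first and second
  directional derivatives are \<open>bump1 c h\<close> and \<open>bump2 c h k\<close>; the closed form shows that the
  latter is symmetric in \<open>h\<close> and \<open>k\<close>.\<close>

definition bump :: "real \<Rightarrow> 'a::euclidean_space \<Rightarrow> real" where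
  "bump c z = expn 0 (1 - c * (z \<bullet> z))"
definition bump1 :: "real \<Rightarrow> 'a::euclidean_space \<Rightarrow> 'a \<Rightarrow> real" where
  "bump1 c h z = expn 2 (1 - c * (z \<bullet> z)) * (- 2 * c) * (z \<bullet> h)"
definition bump2 :: "real \<Rightarrow> 'a::euclidean_space \<Rightarrow> 'a \<Rightarrow> 'a \<Rightarrow> real" where
  "bump2 c h k z = (expn 4 (1 - c * (z \<bullet> z)) - 2 * expn 3 (1 - c * (z \<bullet> z))) * (- 2 * c)\<^sup>2 * (z \<bullet> h) * (z \<bullet> k)
     + expn 2 (1 - c * (z \<bullet> z)) * (- 2 * c) * (h \<bullet> k)"

lemma bump_arg_deriv:
  "((\<lambda>z::'a::euclidean_space. 1 - c * (z \<bullet> z)) has_derivative (\<lambda>h. (- 2 * c) * (z \<bullet> h))) (at z)"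
  by (auto intro!: derivative_eq_intros simp: inner_commute)

lemma bump_deriv: "(bump c has_derivative (\<lambda>h. bump1 c h z)) (at z)"
proof -
  have n: "expn (0 + 2) = expn 2" by (simp only: add_0)
  have "(\<lambda>h. bump1 c h z) = (\<lambda>h. (expn (0 + 2) (1 - c * (z \<bullet> z)) - real 0 * expn (Suc 0) (1 - c * (z \<bullet> z))) * (- 2 * c * (z \<bullet> h)))"
    using n by (simp only: bump1_def mult.assoc of_nat_0 mult_zero_left diff_zero)
  then show ?thesis
    using has_derivative_compose[OF bump_arg_deriv[of c z] expn_deriv[of 0, unfolded has_field_derivative_def]]
    unfolding bump_def[abs_def] by (simp only:)
qed

lemma bump1_deriv: "(bump1 c h has_derivative (\<lambda>k. bump2 c h k z)) (at z)"
proof -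
  have e: "((\<lambda>z::'a. expn 2 (1 - c * (z \<bullet> z))) has_derivative
     (\<lambda>k. (expn (2 + 2) (1 - c * (z \<bullet> z)) - real 2 * expn (Suc 2) (1 - c * (z \<bullet> z))) * ((- 2 * c) * (z \<bullet> k)))) (at z)"
    by (rule has_derivative_compose[OF bump_arg_deriv[of c z] expn_deriv[of 2, unfolded has_field_derivative_def]])
  have n: "expn (2 + 2) = expn 4" "expn (Suc 2) = expn 3" by simp_all
  show ?thesis unfolding bump1_def[abs_def] bump2_def
    by (rule has_derivative_eq_rhs[OF has_derivative_mult[OF has_derivative_mult[OF e has_derivative_const]
          has_derivative_inner_left[OF has_derivative_ident]]])
      (simp add: n fun_eq_iff power2_eq_square algebra_simps inner_commute)
qed

lemma bump2_sym: "bump2 c h k z = bump2 c k h z"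
  by (simp add: bump2_def inner_commute mult_ac)

lemma expn_continuous: "continuous_on S (expn m)"
  using expn_deriv DERIV_isCont continuous_at_imp_continuous_on by blast

lemma bump_continuous:
  "continuous_on UNIV (bump c)" "continuous_on UNIV (bump1 c h)" "continuous_on UNIV (bump2 c h k)"
  unfolding bump_def[abs_def] bump1_def[abs_def] bump2_def[abs_def]
  by (intro continuous_intros continuous_on_compose2[OF expn_continuous[of UNIV]] subset_UNIV)+

lemma bump_zero:
  assumes "c * d\<^sup>2 \<ge> 1" "c \<ge> 0" "d \<ge> 0" "norm z \<ge> d"
  shows "bump c z = 0" "bump1 c h z = 0" "bump2 c h k z = 0"
proof -
  have "c * (z \<bullet> z) \<ge> c * d\<^sup>2" using assms by (intro mult_left_mono) (auto simp: dot_square_norm power_mono)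
  then show "bump c z = 0" "bump1 c h z = 0" "bump2 c h k z = 0"
    using assms(1) by (auto simp: bump_def bump1_def bump2_def expn_def)
qed

lemma bump_nonneg: "0 \<le> bump c z" by (simp add: bump_def expn_nonneg)

lemma test_function_bump:
  assumes "c * d\<^sup>2 \<ge> 1" "c \<ge> 0" "d \<ge> 0"
  shows "test_function (\<lambda>y. bump c (x - y))" "test_function (\<lambda>y. bump1 c h (x - y))"
proof -
  have arg: "1 - c * ((x - y) \<bullet> (x - y)) = 1 + (- c) * ((y - x) \<bullet> (y - x))" for y
    by (simp add: inner_diff inner_commute)
  have 1: "smooth (\<lambda>y. bump c (x - y))"
    unfolding smooth_def bump_def arg by (intro allI Ck_expn Ck_sq_dist)
  have lin: "(x - y) \<bullet> h = (- 1) * ((y - x) \<bullet> h)" for y by (simp add: inner_diff)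
  have 2: "smooth (\<lambda>y. bump1 c h (x - y))"
    unfolding smooth_def bump1_def arg lin by (intro allI Ck_mult Ck_const Ck_inner_affine Ck_expn Ck_sq_dist)
  have "compact (closure {y. f (x - y) \<noteq> (0::real)})" if "\<And>z. norm z \<ge> d \<Longrightarrow> f z = 0" for f
  proof -
    have "{y. f (x - y) \<noteq> 0} \<subseteq> ball x d"
      using that by (auto simp: dist_norm not_le[symmetric])
    then show ?thesis by (meson bounded_ball bounded_subset compact_closure)
  qed
  from this[of "bump c"] this[of "bump1 c h"] 1 2 bump_zero[OF assms]
  show "test_function (\<lambda>y. bump c (x - y))" "test_function (\<lambda>y. bump1 c h (x - y))"
    by (auto simp: test_function_def)
qed

lemma bump_reflect_deriv:
  "((\<lambda>y. bump c (x - y)) has_derivative (\<lambda>h. - bump1 c h (x - y))) (at y)"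
  "((\<lambda>y. bump1 c k (x - y)) has_derivative (\<lambda>h. - bump2 c k h (x - y))) (at y)"
proof -
  have r: "((\<lambda>y. x - y) has_derivative (\<lambda>h. - h)) (at y)" by (auto intro!: derivative_eq_intros)
  have m: "bump1 c (- h) z = - bump1 c h z" "bump2 c k (- h) z = - bump2 c k h z" for h z
    by (simp_all add: bump1_def bump2_def)
  show "((\<lambda>y. bump c (x - y)) has_derivative (\<lambda>h. - bump1 c h (x - y))) (at y)"
    using has_derivative_compose[OF r bump_deriv[of c]] by (simp only: m)
  show "((\<lambda>y. bump1 c k (x - y)) has_derivative (\<lambda>h. - bump2 c k h (x - y))) (at y)"
    using has_derivative_compose[OF r bump1_deriv[of c k]] by (simp only: m)
qed

lemma bump_integral_pos:
  fixes c d :: real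
  assumes c: "c > 0" and cd: "c * d\<^sup>2 \<ge> 1" "d \<ge> 0"
  shows "integrable lborel (bump c :: 'a::euclidean_space \<Rightarrow> real)" "(LINT z|lborel. bump c (z::'a)) > 0"
proof -
  have supp: "bump c z = 0" if "norm z \<ge> d" for z :: 'a using bump_zero(1)[OF cd(1) _ cd(2) that] c by simp
  obtain B where B: "\<And>z::'a. norm (bump c z) \<le> B"
    using continuous_compact_support_bounded[OF bump_continuous(1) supp] by blast
  have [measurable]: "(bump c :: 'a \<Rightarrow> real) \<in> borel_measurable borel"
    by (rule borel_measurable_continuous_onI[OF bump_continuous(1)])
  show int: "integrable lborel (bump c :: 'a \<Rightarrow> real)"
    by (rule integrable_on_bounded_support[OF _ B supp]) auto
  define r where "r = sqrt (1 / (2 * c))"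
  have r: "r > 0" using c by (simp add: r_def)
  have iI: "integrable lborel (\<lambda>z. exp (- 2) * indicat_real (ball (0::'a) r) z)"
    by (intro integrable_mult_right integrable_real_indicator emeasure_bounded_finite) auto
  have "0 < exp (- 2) * measure lborel (ball (0::'a) r)"
    using content_ball_pos[OF r, of "0::'a"] by simp
  also have "\<dots> = (LINT z|lborel. exp (- 2) * indicat_real (ball (0::'a) r) z)" by simp
  also have "\<dots> \<le> (LINT z|lborel. bump c (z::'a))"
  proof (rule integral_mono[OF iI int])
    fix z :: 'a
    show "exp (- 2) * indicat_real (ball 0 r) z \<le> bump c z"
    proof (cases "norm z < r")
      case True
      then have "(norm z)\<^sup>2 \<le> r\<^sup>2" by (intro power_mono) auto
      then have "c * (z \<bullet> z) \<le> c * r\<^sup>2" using c by (intro mult_left_mono) (auto simp: dot_square_norm)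
      also have "c * r\<^sup>2 = 1 / 2" using c by (simp add: r_def)
      finally have t: "1 - c * (z \<bullet> z) \<ge> 1 / 2" by simp
      then have "1 / (1 - c * (z \<bullet> z)) \<le> 2" by (simp add: divide_le_eq)
      then have "exp (- 2) \<le> exp (- (1 / (1 - c * (z \<bullet> z))))" by simp
      then show ?thesis using True t by (simp add: bump_def expn_def)
    qed (simp add: bump_nonneg)
  qed
  finally show "(LINT z|lborel. bump c (z::'a)) > 0" .
qed

section \<open>Convolution with a kernel of compact support\<close>

definition conv :: "('a::euclidean_space \<Rightarrow> real) \<Rightarrow> ('a \<Rightarrow> real) \<Rightarrow> 'a \<Rightarrow> real" where
  "conv K u x = (LINT y|lborel. K (x - y) * u y)"

lemma conv_cmult: "conv (\<lambda>z. t * k z) u x = t * conv k u x"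
  by (simp add: conv_def mult.assoc)

lemma sq_integrable_on_ball:
  fixes u :: "'a::euclidean_space \<Rightarrow> real"
  assumes [measurable]: "u \<in> borel_measurable borel" and "integrable lborel (\<lambda>x. (u x)\<^sup>2)"
  shows "integrable lborel (\<lambda>y. indicat_real (cball p r) y * \<bar>u y\<bar>)"
proof (rule Bochner_Integration.integrable_bound[where f="\<lambda>y. indicat_real (cball p r) y + (u y)\<^sup>2"])
  show "integrable lborel (\<lambda>y. indicat_real (cball p r) y + (u y)\<^sup>2)"
    using assms(2) by (intro Bochner_Integration.integrable_add integrable_real_indicator emeasure_bounded_finite) auto
  have "\<bar>u y\<bar> \<le> 1 + (u y)\<^sup>2" for y
    using sum_squares_bound[of "\<bar>u y\<bar>" 1] by simp
  then show "AE y in lborel. norm (indicat_real (cball p r) y * \<bar>u y\<bar>) \<le> norm (indicat_real (cball p r) y + (u y)\<^sup>2)"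
    by (intro AE_I2) (auto simp: indicator_def)
qed (auto intro!: borel_measurable_times borel_measurable_indicator)

lemma conv_integrable:
  fixes K u :: "'a::euclidean_space \<Rightarrow> real"
  assumes cont: "continuous_on UNIV K" and supp: "\<And>z. norm z \<ge> r \<Longrightarrow> K z = 0"
    and u[measurable]: "u \<in> borel_measurable borel" and u2: "integrable lborel (\<lambda>x. (u x)\<^sup>2)"
  shows "integrable lborel (\<lambda>y. K (x - y) * u y)"
proof -
  obtain B where B: "B > 0" "\<And>z. norm (K z) \<le> B"
    using continuous_compact_support_bounded[OF cont supp] by blast
  have [measurable]: "K \<in> borel_measurable borel" by (rule borel_measurable_continuous_onI[OF cont])
  show ?thesis
  proof (rule Bochner_Integration.integrable_bound[where f="\<lambda>y. B * (indicat_real (cball x r) y * \<bar>u y\<bar>)"])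
    show "integrable lborel (\<lambda>y. B * (indicat_real (cball x r) y * \<bar>u y\<bar>))"
      by (intro integrable_mult_right sq_integrable_on_ball u u2)
    show "AE y in lborel. norm (K (x - y) * u y) \<le> norm (B * (indicat_real (cball x r) y * \<bar>u y\<bar>))"
      using B supp by (intro AE_I2) (auto simp: indicator_def abs_mult dist_norm not_le mult_right_mono)
  qed auto
qed

lemma conv_continuous:
  fixes K u :: "'a::euclidean_space \<Rightarrow> real"
  assumes cont: "continuous_on UNIV K" and supp: "\<And>z. norm z \<ge> r \<Longrightarrow> K z = 0"
    and u[measurable]: "u \<in> borel_measurable borel" and u2: "integrable lborel (\<lambda>x. (u x)\<^sup>2)"
  shows "continuous_on UNIV (conv K u)"
proof (rule continuous_on_sequentiallyI)
  fix X and x :: 'a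
  assume X: "X \<longlonglongrightarrow> x"
  obtain B where B: "B > 0" "\<And>z. norm (K z) \<le> B"
    using continuous_compact_support_bounded[OF cont supp] by blast
  have [measurable]: "K \<in> borel_measurable borel" by (rule borel_measurable_continuous_onI[OF cont])
  have "(\<lambda>n. X n - x) \<longlonglongrightarrow> 0" using X by (simp add: LIM_zero)
  then obtain M where M: "\<And>n. norm (X n - x) \<le> M"
    by (meson convergent_imp_Bseq convergentI BseqE)
  show "(\<lambda>n. conv K u (X n)) \<longlonglongrightarrow> conv K u x"
    unfolding conv_def
  proof (rule integral_dominated_convergence[where w="\<lambda>y. B * (indicat_real (cball x (M + r)) y * \<bar>u y\<bar>)"])
    show "integrable lborel (\<lambda>y. B * (indicat_real (cball x (M + r)) y * \<bar>u y\<bar>))"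
      by (intro integrable_mult_right sq_integrable_on_ball u u2)
    show "AE y in lborel. (\<lambda>n. K (X n - y) * u y) \<longlonglongrightarrow> K (x - y) * u y"
    proof (rule AE_I2)
      fix y
      have "(\<lambda>n. K (X n - y)) \<longlonglongrightarrow> K (x - y)"
        by (rule continuous_on_tendsto_compose[OF cont]) (auto intro!: tendsto_intros X)
      then show "(\<lambda>n. K (X n - y) * u y) \<longlonglongrightarrow> K (x - y) * u y" by (rule tendsto_mult_right)
    qed
    show "AE y in lborel. norm (K (X n - y) * u y) \<le> B * (indicat_real (cball x (M + r)) y * \<bar>u y\<bar>)" for n
    proof (rule AE_I2)
      fix y
      show "norm (K (X n - y) * u y) \<le> B * (indicat_real (cball x (M + r)) y * \<bar>u y\<bar>)"
      proof (cases "y \<in> cball x (M + r)")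
        case True
        then show ?thesis using B(2)[of "X n - y"] by (simp add: abs_mult mult_right_mono)
      next
        case False
        have "dist x y \<le> norm (X n - x) + norm (X n - y)"
          using norm_triangle_ineq4[of "X n - y" "X n - x"] by (simp add: dist_norm)
        then have "norm (X n - y) \<ge> r" using False M[of n] by auto
        then show ?thesis using supp False by (simp add: indicator_def)
      qed
    qed
  qed auto
qed

text \<open>Differentiation under the integral sign: the difference quotients of \<open>K\<close>, minus the derivative, are bounded by
  twice the Lipschitz constant of \<open>K\<close> and supported in a fixed ball, on which \<open>u\<close> is integrable.\<close>

lemma conv_has_derivative:
  fixes K u :: "'a::euclidean_space \<Rightarrow> real"
  assumes K: "\<And>z. (K has_derivative (\<lambda>h. K' h z)) (at z)" and contK': "\<And>h. continuous_on UNIV (K' h)"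
    and supp: "\<And>z. norm z \<ge> r \<Longrightarrow> K z = 0"
    and u[measurable]: "u \<in> borel_measurable borel" and u2: "integrable lborel (\<lambda>x. (u x)\<^sup>2)"
  shows "(conv K u has_derivative (\<lambda>h. conv (K' h) u x)) (at x)"
proof -
  have cont: "continuous_on UNIV K" by (rule has_derivative_continuous_on[of UNIV K "\<lambda>z h. K' h z"]) (use K in simp)
  have supp': "K' h z = 0" if "norm z \<ge> r + 1" for h z
    using derivative_zero_outside[OF K supp] that by simp
  have lin: "linear (\<lambda>h. K' h z)" for z using K has_derivative_linear by blast
  have [measurable]: "K \<in> borel_measurable borel" "K' h \<in> borel_measurable borel" for h
    by (auto intro!: borel_measurable_continuous_onI cont contK')
  have ex: "\<exists>B. \<forall>z. norm (K' b z) \<le> B" for b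
    using continuous_compact_support_bounded[OF contK' supp'] by metis
  obtain B where B: "\<And>b z. norm (K' b z) \<le> B b" using ex by metis
  define L where "L = (\<Sum>b\<in>Basis. B b)"
  have L: "\<bar>K' h z\<bar> \<le> L * norm h" for h z
  proof -
    have "K' h z = K' (\<Sum>b\<in>Basis. (h \<bullet> b) *\<^sub>R b) z" by (simp add: euclidean_representation)
    also have "\<dots> = (\<Sum>b\<in>Basis. (h \<bullet> b) * K' b z)"
      using linear_sum[OF lin] linear_scale[OF lin] by (simp add: linear_sum[OF lin])
    also have "\<bar>\<dots>\<bar> \<le> (\<Sum>b\<in>Basis. \<bar>(h \<bullet> b) * K' b z\<bar>)" by (rule sum_abs)
    also have "\<dots> \<le> (\<Sum>b\<in>Basis. norm h * B b)"
      using B Basis_le_norm by (intro sum_mono) (auto simp: abs_mult intro!: mult_mono)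
    finally show ?thesis by (simp add: L_def sum_distrib_left mult.commute)
  qed
  have Lip: "\<bar>K (z + h) - K z\<bar> \<le> L * norm h" for z h
  proof -
    have "norm (K (z + h) - K z) \<le> L * norm (z + h - z)"
    proof (rule differentiable_bound[of UNIV K "\<lambda>z h. K' h z"])
      show "onorm (\<lambda>h. K' h y) \<le> L" for y by (rule onorm_le) (use L in auto)
    qed (use K in auto)
    then show ?thesis by simp
  qed
  have int: "integrable lborel (\<lambda>y. K (x - y) * u y)" for x by (rule conv_integrable[OF cont supp u u2])
  have int': "integrable lborel (\<lambda>y. K' h (x - y) * u y)" for x h by (rule conv_integrable[OF contK' supp' u u2])
  have linc: "linear (\<lambda>h. conv (K' h) u x)"
    unfolding conv_def
  proof (rule linearI)
    show "(LINT y|lborel. K' (a + b) (x - y) * u y) = (LINT y|lborel. K' a (x - y) * u y) + (LINT y|lborel. K' b (x - y) * u y)" for a b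
      using int' by (simp add: linear_add[OF lin] distrib_right Bochner_Integration.integral_add)
    show "(LINT y|lborel. K' (c *\<^sub>R a) (x - y) * u y) = c *\<^sub>R (LINT y|lborel. K' a (x - y) * u y)" for c a
      by (simp add: linear_scale[OF lin] mult.assoc)
  qed
  have "((\<lambda>h. norm (conv K u (x + h) - conv K u x - conv (K' h) u x) / norm h) \<longlongrightarrow> 0) (at 0)"
    unfolding tendsto_at_iff_sequentially
  proof (intro allI impI)
    fix X :: "nat \<Rightarrow> 'a" assume X0: "\<forall>i. X i \<in> UNIV - {0}" and X: "X \<longlonglongrightarrow> 0"
    obtain M where M: "\<And>n. norm (X n) \<le> M" by (meson X convergent_imp_Bseq convergentI BseqE)
    have M0: "M \<ge> 0" using M norm_ge_zero order_trans by blast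
    define D where "D n y = (K (x + X n - y) - K (x - y) - K' (X n) (x - y)) / norm (X n)" for n y
    have Deq: "(conv K u (x + X n) - conv K u x - conv (K' (X n)) u x) / norm (X n) = (LINT y|lborel. D n y * u y)" for n
      unfolding conv_def D_def using int int'
      by (simp add: left_diff_distrib times_divide_eq_left Bochner_Integration.integral_diff)
    have "(\<lambda>n. LINT y|lborel. D n y * u y) \<longlonglongrightarrow> (LINT y|(lborel::'a measure). 0)"
    proof (rule integral_dominated_convergence[where w="\<lambda>y. (2 * L) * (indicat_real (cball x (M + r + 1)) y * \<bar>u y\<bar>)"])
      show "integrable lborel (\<lambda>y. (2 * L) * (indicat_real (cball x (M + r + 1)) y * \<bar>u y\<bar>))"
        by (intro integrable_mult_right sq_integrable_on_ball u u2)
      show "AE y in lborel. (\<lambda>n. D n y * u y) \<longlonglongrightarrow> 0"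
      proof (rule AE_I2)
        fix y
        have "((\<lambda>h. norm (K (x - y + h) - K (x - y) - K' h (x - y)) / norm h) \<longlongrightarrow> 0) (at 0)"
          using K[of "x - y"] by (simp add: has_derivative_at)
        then have "((\<lambda>h. norm (K (x - y + h) - K (x - y) - K' h (x - y)) / norm h) \<circ> X) \<longlonglongrightarrow> 0"
          using X0 X unfolding tendsto_at_iff_sequentially by blast
        then have "(\<lambda>n. norm (D n y)) \<longlonglongrightarrow> 0"
          by (simp add: D_def o_def algebra_simps)
        then have "(\<lambda>n. D n y) \<longlonglongrightarrow> 0" by (rule tendsto_norm_zero_cancel)
        then show "(\<lambda>n. D n y * u y) \<longlonglongrightarrow> 0" by (rule tendsto_mult_left_zero)
      qed
      show "AE y in lborel. norm (D n y * u y) \<le> (2 * L) * (indicat_real (cball x (M + r + 1)) y * \<bar>u y\<bar>)" for n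
      proof (rule AE_I2)
        fix y
        have Xn: "norm (X n) > 0" using X0 by auto
        show "norm (D n y * u y) \<le> (2 * L) * (indicat_real (cball x (M + r + 1)) y * \<bar>u y\<bar>)"
        proof (cases "y \<in> cball x (M + r + 1)")
          case True
          have "\<bar>K (x + X n - y) - K (x - y) - K' (X n) (x - y)\<bar> \<le> L * norm (X n) + L * norm (X n)"
            using Lip[of "x - y" "X n"] L[of "X n" "x - y"]
              abs_triangle_ineq4[of "K (x + X n - y) - K (x - y)" "K' (X n) (x - y)"]
            by (simp add: algebra_simps)
          then have "\<bar>D n y\<bar> \<le> 2 * L" using Xn by (simp add: D_def divide_le_eq)
          then show ?thesis using True by (simp add: abs_mult mult_right_mono)
        next
          case False
          have "dist x y \<le> norm (x + X n - y) + norm (X n)"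
            using norm_triangle_ineq4[of "x + X n - y" "X n"] by (simp add: dist_norm)
          then have "norm (x + X n - y) \<ge> r" "norm (x - y) \<ge> r + 1"
            using False M[of n] M0 by (auto simp: dist_norm)
          then show ?thesis using supp supp' False by (simp add: D_def indicator_def)
        qed
      qed
    qed (auto simp: D_def[abs_def])
    then have "(\<lambda>n. \<bar>LINT y|lborel. D n y * u y\<bar>) \<longlonglongrightarrow> 0" using tendsto_rabs_zero by simp
    then show "((\<lambda>h. norm (conv K u (x + h) - conv K u x - conv (K' h) u x) / norm h) \<circ> X) \<longlonglongrightarrow> 0"
      by (simp add: o_def Deq[symmetric] )
  qed
  then show ?thesis using linc by (simp add: has_derivative_at linear_conv_bounded_linear)
qed

section \<open>Continuity of translation in the mean\<close>

lemma lborel_distr_reflect: "distr lborel borel (\<lambda>y. x - y) = (lborel :: 'a::euclidean_space measure)"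
  by (subst lborel_affine[of "-1" x]) (auto simp: density_1)

lemma integral_lborel_reflect:
  fixes f :: "'a::euclidean_space \<Rightarrow> real"
  assumes [measurable]: "f \<in> borel_measurable borel"
  shows "(LINT y|lborel. f (x - y)) = (LINT z|lborel. f z)"
proof -
  have "(LINT z|lborel. f z) = (LINT z|distr lborel borel (\<lambda>y. x - y). f z)"
    by (simp add: lborel_distr_reflect)
  also have "\<dots> = (LINT y|lborel. f (x - y))" by (rule integral_distr) auto
  finally show ?thesis ..
qed

lemma integrable_lborel_translate:
  fixes f :: "'a::euclidean_space \<Rightarrow> real"
  assumes "integrable lborel f"
  shows "integrable lborel (\<lambda>x. f (x + t))"
proof -
  have [measurable]: "f \<in> borel_measurable borel" using assms by auto
  have "integrable (distr lborel borel ((+) t)) f" using assms by (simp add: lborel_distr_plus)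
  then have "integrable lborel (\<lambda>x. f (t + x))" by (subst (asm) integrable_distr_eq) auto
  then show ?thesis by (simp add: add.commute)
qed

lemma integrable_lborel_reflect:
  fixes f :: "'a::euclidean_space \<Rightarrow> real"
  assumes "integrable lborel f"
  shows "integrable lborel (\<lambda>y. f (x - y))"
proof -
  have [measurable]: "f \<in> borel_measurable borel" using assms by auto
  have "integrable (distr lborel borel (\<lambda>y. x - y)) f" using assms by (simp add: lborel_distr_reflect)
  then show ?thesis by (subst (asm) integrable_distr_eq) auto
qed

lemma abs_diff_telescope: "\<bar>a' - a\<bar> \<le> \<bar>b' - a'\<bar> + \<bar>b' - b\<bar> + \<bar>b - a\<bar>" for a a' b b' :: real
  by arith

text \<open>By translation invariance, the integral in question is twice the integral of the positive part of
  \<open>1\<^sub>U(x) - 1\<^sub>U(x + X n)\<close>. That part is dominated by \<open>1\<^sub>U\<close>, and since \<open>U\<close> is open it vanishes eventually at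
  every point.\<close>

lemma open_translation_continuous:
  fixes U :: "'a::euclidean_space set"
  assumes "open U" and fin: "emeasure lborel U < \<infinity>" and X: "X \<longlonglongrightarrow> 0"
  shows "(\<lambda>n. LINT x|lborel. \<bar>indicat_real U (x + X n) - indicat_real U x\<bar>) \<longlonglongrightarrow> 0"
proof -
  have U[measurable]: "U \<in> sets borel" using assms(1) by simp
  have iU: "integrable lborel (indicat_real U)" using fin by (intro integrable_real_indicator) auto
  have iT: "integrable lborel (\<lambda>x. indicat_real U (x + t))" for t by (rule integrable_lborel_translate[OF iU])
  define d where "d n x = indicat_real U x * (1 - indicat_real U (x + X n))" for n x
  have id: "integrable lborel (d n)" for n
    by (rule Bochner_Integration.integrable_bound[OF iU]) (auto simp: d_def[abs_def] indicator_def)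
  have "\<bar>indicat_real U (x + X n) - indicat_real U x\<bar> = 2 * d n x + (indicat_real U (x + X n) - indicat_real U x)" for n x
    by (auto simp: d_def indicator_def)
  then have eq: "(LINT x|lborel. \<bar>indicat_real U (x + X n) - indicat_real U x\<bar>) = 2 * (LINT x|lborel. d n x)" for n
    using id iU iT integral_lborel_translate[of "indicat_real U" "X n"] by simp
  have "(\<lambda>n. LINT x|lborel. d n x) \<longlonglongrightarrow> (LINT x|(lborel::'a measure). 0)"
  proof (rule integral_dominated_convergence[where w="indicat_real U"])
    show "AE x in lborel. (\<lambda>n. d n x) \<longlonglongrightarrow> 0"
    proof (rule AE_I2)
      fix x
      show "(\<lambda>n. d n x) \<longlonglongrightarrow> 0"
      proof (cases "x \<in> U")
        case True
        have "(\<lambda>n. x + X n) \<longlonglongrightarrow> x + 0" by (intro tendsto_intros X)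
        then have "\<forall>\<^sub>F n in sequentially. x + X n \<in> U"
          using topological_tendstoD[OF _ assms(1)] True by simp
        then have "\<forall>\<^sub>F n in sequentially. d n x = 0" by eventually_elim (simp add: d_def)
        then show ?thesis by (rule tendsto_eventually)
      qed (simp add: d_def)
    qed
  qed (use iU in \<open>auto simp: d_def[abs_def] indicator_def\<close>)
  then have "(\<lambda>n. 2 * (LINT x|lborel. d n x)) \<longlonglongrightarrow> 2 * 0" by (intro tendsto_mult_left) simp
  then show ?thesis by (simp add: eq)
qed

lemma L1_increment_approx:
  fixes f g :: "'a::euclidean_space \<Rightarrow> real"
  assumes f: "integrable lborel f" and g: "integrable lborel g"
  shows "(LINT x|lborel. \<bar>f (x + t) - f x\<bar>)
    \<le> 2 * (LINT x|lborel. \<bar>g x - f x\<bar>) + (LINT x|lborel. \<bar>g (x + t) - g x\<bar>)"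
proof -
  let ?D = "\<lambda>x. \<bar>g x - f x\<bar>"
  have [measurable]: "f \<in> borel_measurable borel" "g \<in> borel_measurable borel" using f g by auto
  have iD: "integrable lborel ?D" using f g by auto
  have iD': "integrable lborel (\<lambda>x. ?D (x + t))" by (rule integrable_lborel_translate[OF iD])
  have i2: "integrable lborel (\<lambda>x. \<bar>g (x + t) - g x\<bar>)"
    using g integrable_lborel_translate[OF g, of t] by auto
  have i1: "integrable lborel (\<lambda>x. \<bar>f (x + t) - f x\<bar>)"
    using f integrable_lborel_translate[OF f, of t] by auto
  have "(LINT x|lborel. \<bar>f (x + t) - f x\<bar>) \<le> (LINT x|lborel. ?D (x + t) + \<bar>g (x + t) - g x\<bar> + ?D x)"
    by (rule integral_mono) (use i1 i2 iD iD' abs_diff_telescope in auto)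
  also have "\<dots> = (LINT x|lborel. ?D (x + t)) + (LINT x|lborel. \<bar>g (x + t) - g x\<bar>) + (LINT x|lborel. ?D x)"
    using i2 iD iD' by (simp only: Bochner_Integration.integral_add Bochner_Integration.integrable_add)
  also have "(LINT x|lborel. ?D (x + t)) = (LINT x|lborel. ?D x)"
    by (rule integral_lborel_translate[of ?D]) simp
  finally show ?thesis by simp
qed

text \<open>The property passes from open sets to indicators of Borel sets of finite measure by outer regularity,
  then to sums and to dominated limits.\<close>

lemma L1_translation_continuous:
  fixes f :: "'a::euclidean_space \<Rightarrow> real"
  assumes f: "integrable lborel f" and X: "X \<longlonglongrightarrow> 0"
  shows "(\<lambda>n. LINT x|lborel. \<bar>f (x + X n) - f x\<bar>) \<longlonglongrightarrow> 0"
  using f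
proof (induction rule: integrable_induct)
  case (base A c)
  then have A[measurable]: "A \<in> sets borel" and fin: "emeasure lborel A < \<infinity>" by auto
  have iA: "integrable lborel (indicat_real A)" using fin by (intro integrable_real_indicator) auto
  have "(\<lambda>n. LINT x|lborel. \<bar>indicat_real A (x + X n) - indicat_real A x\<bar>) \<longlonglongrightarrow> 0"
  proof (rule LIMSEQ_I)
    fix r :: real assume r: "r > 0"
    obtain U where U: "open U" "A \<subseteq> U" "emeasure lborel (U - A) < ennreal (r / 4)"
      using outer_regular_lborel[OF A, of "r / 4"] r by auto
    have [measurable]: "U \<in> sets borel" using U(1) by simp
    have UA: "emeasure lborel (U - A) < top" by (rule order_less_trans[OF U(3) ennreal_less_top])
    have "emeasure lborel U \<le> emeasure lborel A + emeasure lborel (U - A)"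
      using emeasure_subadditive[of A lborel "U - A"] U(2) by (simp add: Un_absorb1)
    also have "\<dots> < \<infinity>" using fin UA by simp
    finally have finU: "emeasure lborel U < \<infinity>" .
    have iU: "integrable lborel (indicat_real U)" using finU by (intro integrable_real_indicator) auto
    have diff: "(LINT x|lborel. \<bar>indicat_real U x - indicat_real A x\<bar>) < r / 4"
    proof -
      have "\<bar>indicat_real U x - indicat_real A x\<bar> = indicat_real (U - A) x" for x
        using U(2) by (auto simp: indicator_def)
      then have "(LINT x|lborel. \<bar>indicat_real U x - indicat_real A x\<bar>) = measure lborel (U - A)" by simp
      also have "\<dots> < r / 4" 
      proof -
        have "emeasure lborel (U - A) = ennreal (measure lborel (U - A))"
          by (use UA in \<open>simp add: emeasure_eq_ennreal_measure\<close>)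
        then show ?thesis using U(3) r by (simp add: ennreal_less_iff)
      qed
      finally show ?thesis .
    qed
    have "\<forall>\<^sub>F n in sequentially. (LINT x|lborel. \<bar>indicat_real U (x + X n) - indicat_real U x\<bar>) < r / 4"
      using open_translation_continuous[OF U(1) finU X] r by (intro order_tendstoD) auto
    then obtain N where N: "\<And>n. n \<ge> N \<Longrightarrow> (LINT x|lborel. \<bar>indicat_real U (x + X n) - indicat_real U x\<bar>) < r / 4"
      by (auto simp: eventually_sequentially)
    have "norm ((LINT x|lborel. \<bar>indicat_real A (x + X n) - indicat_real A x\<bar>) - 0) < r" if n: "n \<ge> N" for n
    proof -
      have "(LINT x|lborel. \<bar>indicat_real A (x + X n) - indicat_real A x\<bar>) < r"
        using L1_increment_approx[OF iA iU, of "X n"] diff N[OF n] r by linarith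
      moreover have "0 \<le> (LINT x|lborel. \<bar>indicat_real A (x + X n) - indicat_real A x\<bar>)" by simp
      ultimately show ?thesis by simp
    qed
    then show "\<exists>no. \<forall>n\<ge>no. norm ((LINT x|lborel. \<bar>indicat_real A (x + X n) - indicat_real A x\<bar>) - 0) < r" by blast
  qed
  then have "(\<lambda>n. (LINT x|lborel. \<bar>indicat_real A (x + X n) - indicat_real A x\<bar>) * \<bar>c\<bar>) \<longlonglongrightarrow> 0 * \<bar>c\<bar>"
    by (intro tendsto_mult_right)
  moreover have "(LINT x|lborel. \<bar>indicat_real A (x + X n) *\<^sub>R c - indicat_real A x *\<^sub>R c\<bar>)
     = (LINT x|lborel. \<bar>indicat_real A (x + X n) - indicat_real A x\<bar>) * \<bar>c\<bar>" for n
    by (simp add: left_diff_distrib[symmetric] abs_mult)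
  ultimately show ?case by simp
next
  case (add f g)
  have i: "integrable lborel (\<lambda>x. \<bar>f (x + X n) - f x\<bar>)" "integrable lborel (\<lambda>x. \<bar>g (x + X n) - g x\<bar>)" for n
    using add.hyps integrable_lborel_translate[OF add.hyps(1), of "X n"] integrable_lborel_translate[OF add.hyps(2), of "X n"] by auto
  have i3: "integrable lborel (\<lambda>x. \<bar>f (x + X n) + g (x + X n) - (f x + g x)\<bar>)" for n
    using add.hyps integrable_lborel_translate[OF add.hyps(1), of "X n"] integrable_lborel_translate[OF add.hyps(2), of "X n"] by auto
  show ?case
  proof (rule tendsto_sandwich[where f="\<lambda>_. 0::real"])
    show "(\<lambda>n. (LINT x|lborel. \<bar>f (x + X n) - f x\<bar>) + (LINT x|lborel. \<bar>g (x + X n) - g x\<bar>)) \<longlonglongrightarrow> 0"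
      using tendsto_add[OF add.IH(1) add.IH(2)] by simp
    show "\<forall>\<^sub>F n in sequentially. (LINT x|lborel. \<bar>f (x + X n) + g (x + X n) - (f x + g x)\<bar>)
       \<le> (LINT x|lborel. \<bar>f (x + X n) - f x\<bar>) + (LINT x|lborel. \<bar>g (x + X n) - g x\<bar>)"
    proof (rule always_eventually, rule allI)
      fix n
      have "(LINT x|lborel. \<bar>f (x + X n) + g (x + X n) - (f x + g x)\<bar>)
        \<le> (LINT x|lborel. \<bar>f (x + X n) - f x\<bar> + \<bar>g (x + X n) - g x\<bar>)"
        by (rule integral_mono[OF i3]) (use i in auto)
      then show "(LINT x|lborel. \<bar>f (x + X n) + g (x + X n) - (f x + g x)\<bar>)
       \<le> (LINT x|lborel. \<bar>f (x + X n) - f x\<bar>) + (LINT x|lborel. \<bar>g (x + X n) - g x\<bar>)"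
        using i by simp
    qed
  qed auto
next
  case (lim f s)
  have fl: "integrable lborel f" using lim by simp
  have [measurable]: "f \<in> borel_measurable borel" "s i \<in> borel_measurable borel" for i
    using lim by auto
  have conv: "(\<lambda>i. LINT x|lborel. \<bar>s i x - f x\<bar>) \<longlonglongrightarrow> (LINT x|(lborel::'a measure). 0)"
  proof (rule integral_dominated_convergence[where w="\<lambda>x. 3 * \<bar>f x\<bar>"])
    show "AE x in lborel. (\<lambda>i. \<bar>s i x - f x\<bar>) \<longlonglongrightarrow> 0"
    proof (rule AE_I2)
      fix x
      have "(\<lambda>i. s i x) \<longlonglongrightarrow> f x" using lim by simp
      then show "(\<lambda>i. \<bar>s i x - f x\<bar>) \<longlonglongrightarrow> 0" by (intro tendsto_rabs_zero) (simp add: LIM_zero)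
    qed
    show "AE x in lborel. norm \<bar>s i x - f x\<bar> \<le> 3 * \<bar>f x\<bar>" for i
    proof (rule AE_I2)
      fix x
      have "\<bar>s i x\<bar> \<le> 2 * \<bar>f x\<bar>" using lim.hyps(3)[of x i] by simp
      then show "norm \<bar>s i x - f x\<bar> \<le> 3 * \<bar>f x\<bar>"
        using abs_triangle_ineq4[of "s i x" "f x"] by simp
    qed
  qed (use fl in auto)
  show ?case
  proof (rule LIMSEQ_I)
    fix r :: real assume r: "r > 0"
    have "\<forall>\<^sub>F i in sequentially. (LINT x|lborel. \<bar>s i x - f x\<bar>) < r / 4"
      using conv r by (intro order_tendstoD) auto
    then obtain i where i: "(LINT x|lborel. \<bar>s i x - f x\<bar>) < r / 4"
      using eventually_happens'[OF sequentially_bot] by blast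
    have "\<forall>\<^sub>F n in sequentially. (LINT x|lborel. \<bar>s i (x + X n) - s i x\<bar>) < r / 4"
      using lim.IH[of i] r by (intro order_tendstoD) auto
    then obtain N where N: "\<And>n. n \<ge> N \<Longrightarrow> (LINT x|lborel. \<bar>s i (x + X n) - s i x\<bar>) < r / 4"
      by (auto simp: eventually_sequentially)
    have "norm ((LINT x|lborel. \<bar>f (x + X n) - f x\<bar>) - 0) < r" if n: "n \<ge> N" for n
    proof -
      have "(LINT x|lborel. \<bar>f (x + X n) - f x\<bar>) < r"
        using L1_increment_approx[OF fl lim.hyps(1)[of i], of "X n"] i N[OF n] r by linarith
      moreover have "0 \<le> (LINT x|lborel. \<bar>f (x + X n) - f x\<bar>)" by simp
      ultimately show ?thesis by simp
    qed
    then show "\<exists>no. \<forall>n\<ge>no. norm ((LINT x|lborel. \<bar>f (x + X n) - f x\<bar>) - 0) < r" by blast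
  qed
qed

section \<open>Convergence of mollifications\<close>

lemma diff_square_le: "(a - b)\<^sup>2 \<le> 2 * a\<^sup>2 + 2 * b\<^sup>2" for a b :: real
  using sum_squares_bound[of a "- b"] by (simp add: power2_diff)

text \<open>For nonnegative numbers \<open>(b - a)\<^sup>2 \<le> |b\<^sup>2 - a\<^sup>2|\<close>. Applied to the positive and the negative part of \<open>f\<close>
  separately, this reduces the claim to the squares of these parts, which are integrable.\<close>

lemma L2_translation_continuous:
  fixes f :: "'a::euclidean_space \<Rightarrow> real"
  assumes f[measurable]: "f \<in> borel_measurable borel" and f2: "integrable lborel (\<lambda>x. (f x)\<^sup>2)" and X: "X \<longlonglongrightarrow> 0"
  shows "(\<lambda>n. LINT x|lborel. (f (x + X n) - f x)\<^sup>2) \<longlonglongrightarrow> 0"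
proof -
  define p where "p x = (max (f x) 0)\<^sup>2" for x
  define m where "m x = (max (- f x) 0)\<^sup>2" for x
  have ip: "integrable lborel p"
    by (rule Bochner_Integration.integrable_bound[OF f2]) (auto simp: p_def[abs_def] max_def)
  have im: "integrable lborel m"
    by (rule Bochner_Integration.integrable_bound[OF f2]) (auto simp: m_def[abs_def] max_def)
  have pos: "(b - a)\<^sup>2 \<le> \<bar>b\<^sup>2 - a\<^sup>2\<bar>" if "a \<ge> 0" "b \<ge> 0" for a b :: real
  proof -
    have "(b - a)\<^sup>2 = \<bar>b - a\<bar> * \<bar>b - a\<bar>" by (simp add: power2_eq_square)
    also have "\<dots> \<le> \<bar>b - a\<bar> * (b + a)" using that by (intro mult_left_mono) auto
    also have "\<dots> = \<bar>(b - a) * (b + a)\<bar>" using that by (simp add: abs_mult)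
    also have "(b - a) * (b + a) = b\<^sup>2 - a\<^sup>2" by (simp add: power2_eq_square algebra_simps)
    finally show ?thesis .
  qed
  \<comment> \<open>Writing \<open>b - a\<close> as the difference of the increments of the positive and the negative part.\<close>
  have split: "(b - a)\<^sup>2 \<le> 2 * \<bar>(max b 0)\<^sup>2 - (max a 0)\<^sup>2\<bar> + 2 * \<bar>(max (- b) 0)\<^sup>2 - (max (- a) 0)\<^sup>2\<bar>" for a b :: real
  proof -
    define c d where "c = max b 0 - max a 0" and "d = max (- b) 0 - max (- a) 0"
    have "b - a = c - d" by (auto simp: c_def d_def max_def)
    then have "(b - a)\<^sup>2 = c\<^sup>2 + d\<^sup>2 - 2 * c * d" by (simp add: power2_diff)
    also have "\<dots> \<le> 2 * c\<^sup>2 + 2 * d\<^sup>2" using sum_squares_bound[of c "- d"] by simp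
    finally show ?thesis
      using pos[of "max a 0" "max b 0"] pos[of "max (- a) 0" "max (- b) 0"] unfolding c_def d_def by simp
  qed
  have i: "integrable lborel (\<lambda>x. \<bar>p (x + t) - p x\<bar>)" "integrable lborel (\<lambda>x. \<bar>m (x + t) - m x\<bar>)" for t
    using ip im integrable_lborel_translate[OF ip, of t] integrable_lborel_translate[OF im, of t] by auto
  show ?thesis
  proof (rule tendsto_sandwich[where f="\<lambda>_. 0::real"])
    show "(\<lambda>n. 2 * (LINT x|lborel. \<bar>p (x + X n) - p x\<bar>) + 2 * (LINT x|lborel. \<bar>m (x + X n) - m x\<bar>)) \<longlonglongrightarrow> 0"
      using tendsto_add[OF tendsto_mult_left[OF L1_translation_continuous[OF ip X], of 2]
          tendsto_mult_left[OF L1_translation_continuous[OF im X], of 2]] by simp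
    show "\<forall>\<^sub>F n in sequentially. (LINT x|lborel. (f (x + X n) - f x)\<^sup>2)
      \<le> 2 * (LINT x|lborel. \<bar>p (x + X n) - p x\<bar>) + 2 * (LINT x|lborel. \<bar>m (x + X n) - m x\<bar>)"
    proof (rule always_eventually, rule allI)
      fix n
      have "(LINT x|lborel. (f (x + X n) - f x)\<^sup>2)
        \<le> (LINT x|lborel. 2 * \<bar>p (x + X n) - p x\<bar> + 2 * \<bar>m (x + X n) - m x\<bar>)"
        by (rule integral_mono') (use i split in \<open>auto simp: p_def m_def\<close>)
      then show "(LINT x|lborel. (f (x + X n) - f x)\<^sup>2)
         \<le> 2 * (LINT x|lborel. \<bar>p (x + X n) - p x\<bar>) + 2 * (LINT x|lborel. \<bar>m (x + X n) - m x\<bar>)"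
        using i by simp
    qed
  qed auto
qed

text \<open>The function \<open>K\<close> is a probability density, so Jensen's inequality bounds \<open>(K * f - f)\<^sup>2\<close> at \<open>x\<close> by the
  average of \<open>(f(x - z) - f(x))\<^sup>2\<close> over \<open>z\<close>. Tonelli's theorem then allows the integration over
  \<open>x\<close> to be carried out first, at fixed \<open>z\<close>.\<close>

lemma mollify_L2_bound:
  fixes K f :: "'a::euclidean_space \<Rightarrow> real"
  assumes cont: "continuous_on UNIV K" and supp: "\<And>z. norm z \<ge> r \<Longrightarrow> K z = 0"
    and K0: "\<And>z. K z \<ge> 0" and K1: "(LINT z|lborel. K z) = 1"
    and f[measurable]: "f \<in> borel_measurable borel" and f2: "integrable lborel (\<lambda>x. (f x)\<^sup>2)"
    and M: "\<And>z. norm z < r \<Longrightarrow> (LINT x|lborel. (f (x + (- z)) - f x)\<^sup>2) \<le> M"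
  shows "integrable lborel (\<lambda>x. (conv K f x - f x)\<^sup>2)" "(LINT x|lborel. (conv K f x - f x)\<^sup>2) \<le> M"
proof -
  obtain B where B: "B > 0" "\<And>z. norm (K z) \<le> B"
    using continuous_compact_support_bounded[OF cont supp] by blast
  have [measurable]: "K \<in> borel_measurable borel" by (rule borel_measurable_continuous_onI[OF cont])
  have [measurable]: "conv K f \<in> borel_measurable borel"
    by (rule borel_measurable_continuous_onI[OF conv_continuous[OF cont supp f f2]])
  have iK: "integrable lborel K" by (rule integrable_on_bounded_support[OF _ B(2) supp]) auto
  have ifx: "integrable lborel (\<lambda>z. (f (x - z))\<^sup>2)" for x by (rule integrable_lborel_reflect[OF f2])
  have iKf2: "integrable lborel (\<lambda>z. K z * (f (x - z))\<^sup>2)" for x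
    by (rule Bochner_Integration.integrable_bound[OF integrable_mult_right[OF ifx[of x], of B]])
      (use B in \<open>auto intro!: AE_I2 mult_right_mono simp: abs_mult\<close>)
  have iKf: "integrable lborel (\<lambda>z. K z * f (x - z))" for x
    using integrable_lborel_reflect[OF conv_integrable[OF cont supp f f2, where x=x], where x=x] by simp
  have conv_eq: "conv K f x = (LINT z|lborel. K z * f (x - z))" for x
    unfolding conv_def using integral_lborel_reflect[of "\<lambda>y. K (x - y) * f y" x] by simp
  define g where "g x z = f (x - z) - f x" for x z
  have iKg2: "integrable lborel (\<lambda>z. K z * (g x z)\<^sup>2)" for x
  proof -
    have "(\<lambda>z. K z * (g x z)\<^sup>2) = (\<lambda>z. K z * (f (x - z))\<^sup>2 - (2 * f x) * (K z * f (x - z)) + (f x)\<^sup>2 * K z)"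
      by (auto simp: g_def power2_diff fun_eq_iff algebra_simps)
    then show ?thesis using iKf2 iKf iK by simp
  qed
  have iKg: "integrable lborel (\<lambda>z. K z * g x z)" for x
    using iKf[of x] iK by (simp add: g_def right_diff_distrib)
  have jensen: "(conv K f x - f x)\<^sup>2 \<le> (LINT z|lborel. K z * (g x z)\<^sup>2)" for x
  proof -
    define I where "I = conv K f x - f x"
    have I: "I = (LINT z|lborel. K z * g x z)"
      using iKf[of x] iK K1 by (simp add: I_def conv_eq g_def right_diff_distrib)
    \<comment> \<open>Jensen's inequality for the square, as nonnegativity of the variance of \<open>g x\<close> under \<open>K\<close>.\<close>
    have "0 \<le> (LINT z|lborel. K z * (g x z - I)\<^sup>2)" using K0 by (intro integral_nonneg_AE AE_I2) auto
    also have "(\<lambda>z. K z * (g x z - I)\<^sup>2) = (\<lambda>z. K z * (g x z)\<^sup>2 - (2 * I) * (K z * g x z) + I\<^sup>2 * K z)"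
      by (auto simp: power2_diff fun_eq_iff algebra_simps)
    also have "(LINT z|lborel. K z * (g x z)\<^sup>2 - (2 * I) * (K z * g x z) + I\<^sup>2 * K z)
       = (LINT z|lborel. K z * (g x z)\<^sup>2) - (2 * I) * I + I\<^sup>2"
      using iKg2[of x] iKg[of x] iK K1 by (simp add: I[symmetric])
    finally show ?thesis unfolding I_def[symmetric] by (simp add: power2_eq_square)
  qed
  have M0: "M \<ge> 0"
  proof (rule ccontr)
    assume "\<not> 0 \<le> M"
    have "K z = 0" for z
    proof (rule ccontr)
      assume "K z \<noteq> 0"
      then have "(LINT x|lborel. (f (x + (- z)) - f x)\<^sup>2) \<le> M" using M[of z] supp[of z] by force
      moreover have "0 \<le> (LINT x|lborel. (f (x + (- z)) - f x)\<^sup>2)" by simp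
      ultimately show False using \<open>\<not> 0 \<le> M\<close> by linarith
    qed
    then show False using K1 by simp
  qed
  have ig: "integrable lborel (\<lambda>x. (g x z)\<^sup>2)" for z
  proof (rule Bochner_Integration.integrable_bound[where f="\<lambda>x. 2 * (f (x + (- z)))\<^sup>2 + 2 * (f x)\<^sup>2"])
    show "integrable lborel (\<lambda>x. 2 * (f (x + (- z)))\<^sup>2 + 2 * (f x)\<^sup>2)"
      using f2 integrable_lborel_translate[OF f2, of "- z"] by simp
    show "AE x in lborel. norm ((g x z)\<^sup>2) \<le> norm (2 * (f (x + (- z)))\<^sup>2 + 2 * (f x)\<^sup>2)"
    proof (rule AE_I2)
      fix x
      show "norm ((g x z)\<^sup>2) \<le> norm (2 * (f (x + (- z)))\<^sup>2 + 2 * (f x)\<^sup>2)"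
        using diff_square_le[of "f (x - z)" "f x"] by (simp add: g_def)
    qed
  qed (auto simp: g_def[abs_def])
  have bound: "(\<integral>\<^sup>+x. ennreal ((conv K f x - f x)\<^sup>2) \<partial>lborel) \<le> ennreal M"
  proof -
    have "(\<integral>\<^sup>+x. ennreal ((conv K f x - f x)\<^sup>2) \<partial>lborel) \<le> (\<integral>\<^sup>+x. (\<integral>\<^sup>+z. ennreal (K z * (g x z)\<^sup>2) \<partial>lborel) \<partial>lborel)"
    proof (rule nn_integral_mono)
      fix x
      have "(\<integral>\<^sup>+z. ennreal (K z * (g x z)\<^sup>2) \<partial>lborel) = ennreal (LINT z|lborel. K z * (g x z)\<^sup>2)"
        by (rule nn_integral_eq_integral[OF iKg2]) (use K0 in auto)
      then show "ennreal ((conv K f x - f x)\<^sup>2) \<le> (\<integral>\<^sup>+z. ennreal (K z * (g x z)\<^sup>2) \<partial>lborel)"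
        using jensen[of x] by (simp add: ennreal_leI)
    qed
    also have "\<dots> = (\<integral>\<^sup>+z. (\<integral>\<^sup>+x. ennreal (K z * (g x z)\<^sup>2) \<partial>lborel) \<partial>lborel)"
      by (rule lborel_pair.Fubini'[symmetric]) (simp add: g_def)
    also have "\<dots> \<le> (\<integral>\<^sup>+z. ennreal (K z * M) \<partial>lborel)"
    proof (rule nn_integral_mono)
      fix z
      have "(\<integral>\<^sup>+x. ennreal (K z * (g x z)\<^sup>2) \<partial>lborel) = ennreal (LINT x|lborel. K z * (g x z)\<^sup>2)"
        by (rule nn_integral_eq_integral) (use K0 ig[of z] in auto)
      also have "(LINT x|lborel. K z * (g x z)\<^sup>2) = K z * (LINT x|lborel. (g x z)\<^sup>2)" by simp
      also have "\<dots> \<le> K z * M"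
        using M[of z] supp[of z] K0[of z] by (cases "norm z < r") (auto simp: g_def intro!: mult_left_mono)
      finally show "(\<integral>\<^sup>+x. ennreal (K z * (g x z)\<^sup>2) \<partial>lborel) \<le> ennreal (K z * M)" by (simp add: ennreal_leI)
    qed
    also have "\<dots> = ennreal (LINT z|lborel. K z * M)"
      by (rule nn_integral_eq_integral) (use iK K0 M0 in auto)
    also have "(LINT z|lborel. K z * M) = M" using K1 by simp
    finally show ?thesis .
  qed
  then have "(\<integral>\<^sup>+x. ennreal ((conv K f x - f x)\<^sup>2) \<partial>lborel) < \<infinity>"
    using order_le_less_trans[OF bound ennreal_less_top] by simp
  then show int: "integrable lborel (\<lambda>x. (conv K f x - f x)\<^sup>2)"
    by (intro integrableI_nonneg) auto
  have "ennreal (LINT x|lborel. (conv K f x - f x)\<^sup>2) \<le> ennreal M"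
    using bound nn_integral_eq_integral[OF int] by simp
  then show "(LINT x|lborel. (conv K f x - f x)\<^sup>2) \<le> M" using M0 by simp
qed

lemma conv_L2:
  fixes K f :: "'a::euclidean_space \<Rightarrow> real"
  assumes cont: "continuous_on UNIV K" and supp: "\<And>z. norm z \<ge> r \<Longrightarrow> K z = 0"
    and K0: "\<And>z. K z \<ge> 0" and K1: "(LINT z|lborel. K z) = 1"
    and f[measurable]: "f \<in> borel_measurable borel" and f2: "integrable lborel (\<lambda>x. (f x)\<^sup>2)"
  shows "integrable lborel (\<lambda>x. (conv K f x)\<^sup>2)"
proof -
  have i: "integrable lborel (\<lambda>x. (f (x + t))\<^sup>2)" for t by (rule integrable_lborel_translate[OF f2])
  have "(LINT x|lborel. (f (x + (- z)) - f x)\<^sup>2) \<le> 4 * (LINT x|lborel. (f x)\<^sup>2)" for z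
  proof -
    have "(LINT x|lborel. (f (x + (- z)) - f x)\<^sup>2) \<le> (LINT x|lborel. 2 * (f (x + (- z)))\<^sup>2 + 2 * (f x)\<^sup>2)"
      by (rule integral_mono') (use i[of "- z"] f2 diff_square_le in auto)
    also have "\<dots> = 2 * (LINT x|lborel. (f (x + (- z)))\<^sup>2) + 2 * (LINT x|lborel. (f x)\<^sup>2)"
      using i[of "- z"] f2 by simp
    also have "(LINT x|lborel. (f (x + (- z)))\<^sup>2) = (LINT x|lborel. (f x)\<^sup>2)"
      by (rule integral_lborel_translate[of "\<lambda>x. (f x)\<^sup>2"]) simp
    finally show ?thesis by simp
  qed
  then have d: "integrable lborel (\<lambda>x. (conv K f x - f x)\<^sup>2)"
    by (intro mollify_L2_bound(1)[OF cont supp K0 K1 f f2])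
  have [measurable]: "conv K f \<in> borel_measurable borel"
    by (rule borel_measurable_continuous_onI[OF conv_continuous[OF cont supp f f2]])
  show ?thesis
  proof (rule Bochner_Integration.integrable_bound[where f="\<lambda>x. 2 * (conv K f x - f x)\<^sup>2 + 2 * (f x)\<^sup>2"])
    show "AE x in lborel. norm ((conv K f x)\<^sup>2) \<le> norm (2 * (conv K f x - f x)\<^sup>2 + 2 * (f x)\<^sup>2)"
    proof (rule AE_I2)
      fix x
      show "norm ((conv K f x)\<^sup>2) \<le> norm (2 * (conv K f x - f x)\<^sup>2 + 2 * (f x)\<^sup>2)"
        using diff_square_le[of "conv K f x - f x" "- f x"] by simp
    qed
  qed (use d f2 in auto)
qed

lemma mollify_tendsto:
  fixes K :: "nat \<Rightarrow> 'a::euclidean_space \<Rightarrow> real" and f :: "'a \<Rightarrow> real"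
  assumes cont: "\<And>n. continuous_on UNIV (K n)" and supp: "\<And>n z. norm z \<ge> r n \<Longrightarrow> K n z = 0"
    and K0: "\<And>n z. K n z \<ge> 0" and K1: "\<And>n. (LINT z|lborel. K n z) = 1" and r: "r \<longlonglongrightarrow> 0"
    and f: "f \<in> borel_measurable borel" and f2: "integrable lborel (\<lambda>x. (f x)\<^sup>2)"
  shows "(\<lambda>n. LINT x|lborel. (conv (K n) f x - f x)\<^sup>2) \<longlonglongrightarrow> 0"
proof (rule LIMSEQ_I)
  fix e :: real assume e: "e > 0"
  have "\<exists>d>0. \<forall>z. norm z < d \<longrightarrow> (LINT x|lborel. (f (x + (- z)) - f x)\<^sup>2) \<le> e / 2"
  proof (rule ccontr)
    assume "\<not> ?thesis"
    then have *: "\<exists>z. norm z < d \<and> (LINT x|lborel. (f (x + (- z)) - f x)\<^sup>2) > e / 2" if "d > 0" for d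
      using that by (auto simp: not_le)
    have "\<forall>n. \<exists>z. norm z < inverse (real (Suc n)) \<and> (LINT x|lborel. (f (x + (- z)) - f x)\<^sup>2) > e / 2"
      by (intro allI *) simp
    from choice[OF this] obtain X where X_all:
       "\<forall>n. norm (X n) < inverse (real (Suc n)) \<and> (LINT x|lborel. (f (x + (- X n)) - f x)\<^sup>2) > e / 2" ..
    then have X: "norm (X n) < inverse (real (Suc n))"
       "(LINT x|lborel. (f (x + (- X n)) - f x)\<^sup>2) > e / 2" for n by simp_all
    have "X \<longlonglongrightarrow> 0"
      by (rule Lim_null_comparison[OF _ LIMSEQ_inverse_real_of_nat]) (use X(1) in \<open>auto intro!: always_eventually less_imp_le\<close>)
    then have "(\<lambda>n. - X n) \<longlonglongrightarrow> 0" using tendsto_minus[of X 0] by simp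
    from L2_translation_continuous[OF f f2 this]
    have "\<forall>\<^sub>F n in sequentially. (LINT x|lborel. (f (x + (- X n)) - f x)\<^sup>2) < e / 2"
      using e by (intro order_tendstoD) auto
    then obtain n where "(LINT x|lborel. (f (x + (- X n)) - f x)\<^sup>2) < e / 2"
      by (auto simp: eventually_sequentially)
    then show False using X(2)[of n] by simp
  qed
  then obtain d where d: "d > 0" "\<And>z. norm z < d \<Longrightarrow> (LINT x|lborel. (f (x + (- z)) - f x)\<^sup>2) \<le> e / 2" by blast
  obtain N where N: "\<And>n. n \<ge> N \<Longrightarrow> r n < d"
    using order_tendstoD(2)[OF r d(1)] by (auto simp: eventually_sequentially)
  have "norm ((LINT x|lborel. (conv (K n) f x - f x)\<^sup>2) - 0) < e" if "n \<ge> N" for n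
  proof -
    have "(LINT x|lborel. (conv (K n) f x - f x)\<^sup>2) \<le> e / 2"
      by (rule mollify_L2_bound(2)[OF cont supp K0 K1 f f2]) (use d(2) N[OF that] in auto)
    moreover have "0 \<le> (LINT x|lborel. (conv (K n) f x - f x)\<^sup>2)" by simp
    ultimately show ?thesis using e by simp
  qed
  then show "\<exists>no. \<forall>n\<ge>no. norm ((LINT x|lborel. (conv (K n) f x - f x)\<^sup>2) - 0) < e" by blast
qed

lemma weighted_L2_limit:
  fixes w :: "nat \<Rightarrow> 'a::euclidean_space \<Rightarrow> real" and u \<Theta> :: "'a \<Rightarrow> real"
  assumes [measurable]: "\<And>n. w n \<in> borel_measurable borel" "u \<in> borel_measurable borel" "\<Theta> \<in> borel_measurable borel"
    and w2: "\<And>n. integrable lborel (\<lambda>x. (w n x)\<^sup>2)" and u2: "integrable lborel (\<lambda>x. (u x)\<^sup>2)"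
    and lim: "(\<lambda>n. LINT x|lborel. (w n x - u x)\<^sup>2) \<longlonglongrightarrow> 0" and B: "\<And>x. \<bar>\<Theta> x\<bar> \<le> B"
  shows "(\<lambda>n. LINT x|lborel. \<Theta> x * (w n x)\<^sup>2) \<longlonglongrightarrow> (LINT x|lborel. \<Theta> x * (u x)\<^sup>2)"
proof (rule LIMSEQ_I)
  fix e :: real assume e: "e > 0"
  have B0: "B \<ge> 0" using B abs_ge_zero order_trans by blast
  define U where "U = (LINT x|lborel. (u x)\<^sup>2)"
  have U0: "U \<ge> 0" by (simp add: U_def)
  define T where "T = (B + 1) * (U + 1)"
  have T: "T > 0" using B0 U0 by (simp add: T_def)
  define d where "d = e / (2 * T)"
  have d: "d > 0" using e T by (simp add: d_def)
  have dU: "B * (d * U) \<le> e / 2"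
  proof -
     have "B * U \<le> T" using B0 U0 by (simp add: T_def algebra_simps)
    then have "d * (B * U) \<le> d * T" using d by (intro mult_left_mono) auto
    also have "\<dots> = e / 2" using T by (simp add: d_def)
    finally show ?thesis by (simp add: mult_ac)
  qed
  have id: "integrable lborel (\<lambda>x. (w n x - u x)\<^sup>2)" for n
    by (rule Bochner_Integration.integrable_bound[where f="\<lambda>x. 2 * (w n x)\<^sup>2 + 2 * (u x)\<^sup>2"])
      (use w2 u2 diff_square_le in auto)
  have iT: "integrable lborel (\<lambda>x. \<Theta> x * (v x)\<^sup>2)"
    if [measurable]: "v \<in> borel_measurable borel" and "integrable lborel (\<lambda>x. (v x)\<^sup>2)" for v
    by (rule Bochner_Integration.integrable_bound[where f="\<lambda>x. B * (v x)\<^sup>2"])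
      (use that B B0 in \<open>auto simp: abs_mult mult_right_mono\<close>)
  define C where "C = B * (1 + 1 / d)"
  have C0: "C \<ge> 0" using B0 d by (simp add: C_def)
  have "(\<lambda>n. C * (LINT x|lborel. (w n x - u x)\<^sup>2)) \<longlonglongrightarrow> C * 0" by (intro tendsto_mult_left lim)
  then have "\<forall>\<^sub>F n in sequentially. C * (LINT x|lborel. (w n x - u x)\<^sup>2) < e / 2"
    using e by (intro order_tendstoD) auto
  then obtain N where N: "\<And>n. n \<ge> N \<Longrightarrow> C * (LINT x|lborel. (w n x - u x)\<^sup>2) < e / 2"
    by (auto simp: eventually_sequentially)
  have "norm ((LINT x|lborel. \<Theta> x * (w n x)\<^sup>2) - (LINT x|lborel. \<Theta> x * (u x)\<^sup>2)) < e" if n: "n \<ge> N" for n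
  proof -
    have pt: "\<bar>\<Theta> x * (w n x)\<^sup>2 - \<Theta> x * (u x)\<^sup>2\<bar> \<le> C * (w n x - u x)\<^sup>2 + B * (d * (u x)\<^sup>2)" for x
    proof -
      define t where "t = w n x - u x"
      have "(w n x)\<^sup>2 - (u x)\<^sup>2 = t\<^sup>2 + 2 * t * u x" by (simp add: t_def power2_eq_square algebra_simps)
      then have "\<bar>(w n x)\<^sup>2 - (u x)\<^sup>2\<bar> \<le> t\<^sup>2 + 2 * (\<bar>t\<bar> * \<bar>u x\<bar>)"
        using abs_triangle_ineq[of "t\<^sup>2" "2 * t * u x"] by (simp add: abs_mult)
      also have "2 * (\<bar>t\<bar> * \<bar>u x\<bar>) \<le> t\<^sup>2 / d + d * (u x)\<^sup>2"
      proof -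
        \<comment> \<open>Young's inequality; the small parameter \<open>d\<close> goes with the fixed function \<open>u\<close>.\<close>
        have "2 * (\<bar>t\<bar> / sqrt d) * (sqrt d * \<bar>u x\<bar>) \<le> (\<bar>t\<bar> / sqrt d)\<^sup>2 + (sqrt d * \<bar>u x\<bar>)\<^sup>2"
          by (rule sum_squares_bound)
        then show ?thesis using d by (simp add: power_divide power_mult_distrib)
      qed
      finally have "\<bar>(w n x)\<^sup>2 - (u x)\<^sup>2\<bar> \<le> (1 + 1 / d) * t\<^sup>2 + d * (u x)\<^sup>2" by (simp add: algebra_simps)
      then have "\<bar>\<Theta> x\<bar> * \<bar>(w n x)\<^sup>2 - (u x)\<^sup>2\<bar> \<le> B * ((1 + 1 / d) * t\<^sup>2 + d * (u x)\<^sup>2)"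
        using B[of x] B0 d by (intro mult_mono) auto
      then show ?thesis by (simp add: C_def t_def abs_mult[symmetric] algebra_simps)
    qed
    have "norm ((LINT x|lborel. \<Theta> x * (w n x)\<^sup>2) - (LINT x|lborel. \<Theta> x * (u x)\<^sup>2))
       = norm (LINT x|lborel. \<Theta> x * (w n x)\<^sup>2 - \<Theta> x * (u x)\<^sup>2)"
      using iT[of "w n"] iT[of u] w2 u2 by simp
    also have "\<dots> \<le> (LINT x|lborel. norm (\<Theta> x * (w n x)\<^sup>2 - \<Theta> x * (u x)\<^sup>2))"
      by (rule integral_norm_bound)
    also have "\<dots> \<le> (LINT x|lborel. C * (w n x - u x)\<^sup>2 + B * (d * (u x)\<^sup>2))"
      by (rule integral_mono) (use iT[of "w n"] iT[of u] w2 u2 id pt in auto)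
    also have "\<dots> = C * (LINT x|lborel. (w n x - u x)\<^sup>2) + B * (d * U)"
      using id u2 by (simp add: U_def)
    also have "\<dots> < e" using N[OF n] dU by linarith
    finally show ?thesis .
  qed
  then show "\<exists>no. \<forall>n\<ge>no. norm ((LINT x|lborel. \<Theta> x * (w n x)\<^sup>2) - (LINT x|lborel. \<Theta> x * (u x)\<^sup>2)) < e" by blast
qed

section \<open>The weak equation tested with bumps\<close>

lemma kernel_scaleR_integrable:
  fixes f :: "'a::euclidean_space \<Rightarrow> 'b::euclidean_space" and k :: "'a \<Rightarrow> real"
  assumes f: "set_integrable lebesgue (cball x r) f"
    and cont: "continuous_on UNIV k" and supp: "\<And>z. norm z \<ge> r \<Longrightarrow> k z = 0"
  shows "integrable lebesgue (\<lambda>y. k (x - y) *\<^sub>R f y)"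
proof -
  obtain B where B: "B > 0" "\<And>z. norm (k z) \<le> B"
    using continuous_compact_support_bounded[OF cont supp] by blast
  have [measurable]: "k \<in> borel_measurable borel" by (rule borel_measurable_continuous_onI[OF cont])
  have "(\<lambda>y. k (x - y)) \<in> borel_measurable lborel" by simp
  then have [measurable]: "(\<lambda>y. k (x - y)) \<in> borel_measurable lebesgue" by (rule measurable_completion)
  have int: "integrable lebesgue (\<lambda>y. indicat_real (cball x r) y *\<^sub>R f y)"
    using f by (simp add: set_integrable_def)
  then have [measurable]: "(\<lambda>y. indicat_real (cball x r) y *\<^sub>R f y) \<in> borel_measurable lebesgue" by auto
  have "integrable lebesgue (\<lambda>y. k (x - y) *\<^sub>R (indicat_real (cball x r) y *\<^sub>R f y))"
  proof (rule Bochner_Integration.integrable_bound[where f="\<lambda>y. B *\<^sub>R (indicat_real (cball x r) y *\<^sub>R f y)"])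
    show "integrable lebesgue (\<lambda>y. B *\<^sub>R (indicat_real (cball x r) y *\<^sub>R f y))"
      by (intro integrable_scaleR_right) (rule int)
    show "AE y in lebesgue. norm (k (x - y) *\<^sub>R (indicat_real (cball x r) y *\<^sub>R f y)) \<le> norm (B *\<^sub>R (indicat_real (cball x r) y *\<^sub>R f y))"
      using B by (intro AE_I2) (auto simp: abs_mult intro!: mult_right_mono)
  qed measurable
  moreover have "k (x - y) *\<^sub>R (indicat_real (cball x r) y *\<^sub>R f y) = k (x - y) *\<^sub>R f y" for y
    using supp[of "x - y"] by (cases "norm (x - y) \<le> r") (auto simp: indicator_def dist_norm)
  ultimately show ?thesis by (simp only:)
qed

lemma kernel_integral_lborel:
  fixes u U :: "'a::euclidean_space \<Rightarrow> real"
  assumes [measurable]: "u \<in> borel_measurable lebesgue" and U[measurable]: "U \<in> borel_measurable borel"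
    and eq: "AE y in lebesgue. u y = U y" and cont: "continuous_on UNIV k"
  shows "(LINT y|lebesgue. k (x - y) * u y) = conv k U x"
proof -
  have [measurable]: "k \<in> borel_measurable borel" by (rule borel_measurable_continuous_onI[OF cont])
  have m: "(\<lambda>y. k (x - y)) \<in> borel_measurable lborel" "U \<in> borel_measurable lborel"
    "(\<lambda>y. k (x - y) * U y) \<in> borel_measurable lborel" by auto
  note [measurable] = measurable_completion[OF m(1)] measurable_completion[OF m(2)]
  have "(LINT y|lebesgue. k (x - y) * u y) = (LINT y|lebesgue. k (x - y) * U y)"
    by (rule integral_cong_AE) (use eq in auto)
  also have "\<dots> = conv k U x" unfolding conv_def by (rule integral_completion[OF m(3)])
  finally show ?thesis .
qed

lemma grad_eq:
  assumes "(\<phi> has_derivative D) (at x)"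
  shows "grad \<phi> x = (\<Sum>b\<in>Basis. D b *\<^sub>R b)"
  using frechet_derivative_at[OF assms] by (simp add: grad_def)

text \<open>The weak identities, tested with \<open>y \<mapsto> bump c (x - y)\<close> and with its partial derivatives, become identities
  between convolutions at \<open>x\<close>. Two weak gradients of \<open>u\<close> occur in the hypotheses: the one from \<open>H1\<close> is square
  integrable, the one from \<open>weak_solution\<close> satisfies the equation. The first is used for the gradient of the
  mollification, in the form of its components \<open>h\<close>. The second is eliminated by testing with a partial
  derivative, which moves the Laplacian entirely to the bump. Borel representatives are chosen
  so that Tonelli's theorem applies to the convolutions.\<close>

lemma very_weak_solution:
  fixes u :: "'a::euclidean_space \<Rightarrow> real"
  assumes H1: "H1 u" and sol: "weak_solution \<Omega> \<Lambda> u" and \<Omega>: "open \<Omega>"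
  obtains U where "U \<in> borel_measurable borel" "integrable lborel (\<lambda>x. (U x)\<^sup>2)" "AE x in lebesgue. u x = U x"
    and "\<forall>b\<in>Basis. \<exists>h. h \<in> borel_measurable borel \<and> integrable lborel (\<lambda>x. (h x)\<^sup>2) \<and>
        (\<forall>c d x. c * d\<^sup>2 \<ge> 1 \<longrightarrow> c \<ge> 0 \<longrightarrow> d \<ge> 0 \<longrightarrow> conv (bump1 c b) U x = conv (bump c) h x)"
    and "\<forall>c d x. c * d\<^sup>2 \<ge> 1 \<longrightarrow> c \<ge> 0 \<longrightarrow> d \<ge> 0 \<longrightarrow>
        (\<Sum>b\<in>Basis. conv (bump2 c b b) U x) = - \<Lambda> * conv (bump c) (\<lambda>y. Q \<Omega> y * U y) x"
proof -
  have um[measurable]: "u \<in> borel_measurable lebesgue" and u2: "integrable lebesgue (\<lambda>x. (u x)\<^sup>2)"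
    using H1 by (auto simp: H1_def L2_def)
  obtain g where g: "has_weak_gradient u g" and gm[measurable]: "g \<in> borel_measurable lebesgue"
    and g2: "integrable lebesgue (\<lambda>x. (norm (g x))\<^sup>2)"
    using H1 by (auto simp: H1_def L2_def)
  obtain g' where g': "has_weak_gradient u g'"
    and weak: "\<And>\<phi>. test_function \<phi> \<Longrightarrow> (LINT x|lebesgue. g' x \<bullet> grad \<phi> x) = \<Lambda> * (LINT x|lebesgue. Q \<Omega> x * u x * \<phi> x)"
    using sol by (auto simp: weak_solution_def)
  obtain U where U[measurable]: "U \<in> borel_measurable borel" and uU: "AE x in lebesgue. u x = U x"
    using completion_ex_borel_measurable_real[OF um] by (auto simp: AE_completion_iff)
  have sq: "integrable lborel (\<lambda>x. (F x)\<^sup>2)"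
    if [measurable]: "f \<in> borel_measurable lebesgue" "F \<in> borel_measurable borel" and "AE x in lebesgue. f x = F x"
      and "integrable lebesgue (\<lambda>x. (f x)\<^sup>2)" for f F :: "'a \<Rightarrow> real"
  proof -
    have m: "(\<lambda>x. (F x)\<^sup>2) \<in> borel_measurable lborel" by simp
    have "integrable lebesgue (\<lambda>x. (F x)\<^sup>2)"
      by (rule integrable_cong_AE_imp[OF that(4) measurable_completion[OF m]]) (use that(3) in auto)
    then show ?thesis using integrable_completion[OF m] by simp
  qed
  have U2: "integrable lborel (\<lambda>x. (U x)\<^sup>2)" by (rule sq[OF um U uU u2])
  have lu: "set_integrable lebesgue (cball x r) u" for x r
    using g by (auto simp: has_weak_gradient_def locally_integrable_def)
  \<comment> \<open>The \<open>b\<close> component of the weak gradient identity for the test function \<open>k (x - y)\<close> of \<open>y\<close>; reflection changes the sign of its derivative.\<close>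
  have key: "(LINT y|lebesgue. dk b (x - y) * u y) = (LINT y|lebesgue. k (x - y) * (G y \<bullet> b))"
    if G: "has_weak_gradient u G" and t: "test_function (\<lambda>y. k (x - y))"
      and d: "\<And>y. ((\<lambda>y. k (x - y)) has_derivative (\<lambda>h. - dk h (x - y))) (at y)"
      and c: "continuous_on UNIV k" "\<And>h. continuous_on UNIV (dk h)"
      and s: "\<And>z. norm z \<ge> r \<Longrightarrow> k z = 0" "\<And>z h. norm z \<ge> r \<Longrightarrow> dk h z = 0" and b: "b \<in> Basis"
    for G :: "'a \<Rightarrow> 'a" and k :: "'a \<Rightarrow> real" and dk x r b
  proof -
    have lG: "set_integrable lebesgue (cball x r) G" for x r
      using G by (auto simp: has_weak_gradient_def locally_integrable_def)
    have iG: "integrable lebesgue (\<lambda>y. k (x - y) *\<^sub>R G y)" by (rule kernel_scaleR_integrable[OF lG c(1) s(1)])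
    have iu: "integrable lebesgue (\<lambda>y. dk h (x - y) *\<^sub>R u y)" for h
      by (rule kernel_scaleR_integrable[OF lu c(2) s(2)])
    have "(LINT y|lebesgue. u y *\<^sub>R grad (\<lambda>y. k (x - y)) y) = - (LINT y|lebesgue. k (x - y) *\<^sub>R G y)"
      using G t by (auto simp: has_weak_gradient_def)
    also have "(\<lambda>y. u y *\<^sub>R grad (\<lambda>y. k (x - y)) y) = (\<lambda>y. \<Sum>b\<in>Basis. (- (dk b (x - y) *\<^sub>R u y)) *\<^sub>R b)"
      by (auto simp: fun_eq_iff grad_eq[OF d] scaleR_sum_right sum_negf mult.commute intro!: sum.cong)
    also have "(LINT y|lebesgue. (\<Sum>b\<in>Basis. (- (dk b (x - y) *\<^sub>R u y)) *\<^sub>R b))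
       = (\<Sum>b\<in>Basis. (LINT y|lebesgue. - (dk b (x - y) *\<^sub>R u y)) *\<^sub>R b)"
      using iu by (subst Bochner_Integration.integral_sum) auto
    finally have "(\<Sum>b\<in>Basis. (LINT y|lebesgue. - (dk b (x - y) *\<^sub>R u y)) *\<^sub>R b) \<bullet> b = - ((LINT y|lebesgue. k (x - y) *\<^sub>R G y) \<bullet> b)"
      by simp
    then have "(LINT y|lebesgue. - (dk b (x - y) *\<^sub>R u y)) = - (LINT y|lebesgue. (k (x - y) *\<^sub>R G y) \<bullet> b)"
      unfolding inner_sum_left_Basis[OF b] using iG by (simp only: integral_inner_left)
    then show ?thesis by simp
  qed
  have conv_u: "(LINT y|lebesgue. k (x - y) * u y) = conv k U x" if "continuous_on UNIV k" for k x
    by (rule kernel_integral_lborel[OF um U uU that])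
  show thesis
  proof (rule that[OF U U2 uU]; intro ballI allI impI)
    fix b :: 'a assume b: "b \<in> Basis"
    have gb[measurable]: "(\<lambda>y. g y \<bullet> b) \<in> borel_measurable lebesgue" by measurable
    have gb2: "integrable lebesgue (\<lambda>y. (g y \<bullet> b)\<^sup>2)"
    proof (rule Bochner_Integration.integrable_bound[OF g2])
      show "AE y in lebesgue. norm ((g y \<bullet> b)\<^sup>2) \<le> norm ((norm (g y))\<^sup>2)"
        using Basis_le_norm[OF b] by (intro AE_I2) (simp add: abs_le_square_iff[symmetric])
    qed measurable
    obtain h where h[measurable]: "h \<in> borel_measurable borel" and gh: "AE x in lebesgue. g x \<bullet> b = h x"
      using completion_ex_borel_measurable_real[OF gb] by (auto simp: AE_completion_iff)
    have "conv (bump1 c b) U x = conv (bump c) h x" if "c * d\<^sup>2 \<ge> 1" "c \<ge> 0" "d \<ge> 0" for c d x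
    proof -
      have "(LINT y|lebesgue. bump1 c b (x - y) * u y) = (LINT y|lebesgue. bump c (x - y) * (g y \<bullet> b))"
        by (rule key[OF g test_function_bump(1)[OF that] bump_reflect_deriv(1) bump_continuous(1,2) bump_zero(1,2)[OF that] b])
      also have "(LINT y|lebesgue. bump c (x - y) * (g y \<bullet> b)) = conv (bump c) h x"
        by (rule kernel_integral_lborel[OF gb h gh bump_continuous(1)])
      finally show ?thesis by (simp add: conv_u[OF bump_continuous(2)])
    qed
    then show "\<exists>h. h \<in> borel_measurable borel \<and> integrable lborel (\<lambda>x. (h x)\<^sup>2) \<and>
        (\<forall>c d x. c * d\<^sup>2 \<ge> 1 \<longrightarrow> c \<ge> 0 \<longrightarrow> d \<ge> 0 \<longrightarrow> conv (bump1 c b) U x = conv (bump c) h x)"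
      using h sq[OF gb h gh gb2] by blast
  next
    fix c d :: real and x :: 'a
    assume cd: "c * d\<^sup>2 \<ge> 1" "c \<ge> 0" "d \<ge> 0"
    have lG: "set_integrable lebesgue (cball x r) g'" for r
      using g' by (auto simp: has_weak_gradient_def locally_integrable_def)
    have i1: "integrable lebesgue (\<lambda>y. bump1 c b (x - y) *\<^sub>R g' y)" for b
      by (rule kernel_scaleR_integrable[OF lG bump_continuous(2) bump_zero(2)[OF cd]])
    have "(LINT y|lebesgue. bump2 c b b (x - y) * u y) = (LINT y|lebesgue. bump1 c b (x - y) * (g' y \<bullet> b))"
      if b: "b \<in> Basis" for b
      by (rule key[OF g' test_function_bump(2)[OF cd] bump_reflect_deriv(2) bump_continuous(2,3) bump_zero(2,3)[OF cd] b])
    then have "(\<Sum>b\<in>Basis. conv (bump2 c b b) U x) = (\<Sum>b\<in>Basis. LINT y|lebesgue. bump1 c b (x - y) * (g' y \<bullet> b))"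
      by (intro sum.cong) (auto simp: conv_u[OF bump_continuous(3)])
    also have "\<dots> = (LINT y|lebesgue. (\<Sum>b\<in>Basis. bump1 c b (x - y) * (g' y \<bullet> b)))"
    proof (rule Bochner_Integration.integral_sum[symmetric])
      fix b :: 'a
      show "integrable lebesgue (\<lambda>y. bump1 c b (x - y) * (g' y \<bullet> b))"
        using integrable_inner_left[OF i1[of b], of b] by simp
    qed
    also have "(\<lambda>y. \<Sum>b\<in>Basis. bump1 c b (x - y) * (g' y \<bullet> b)) = (\<lambda>y. - (g' y \<bullet> grad (\<lambda>y. bump c (x - y)) y))"
      by (auto simp: fun_eq_iff grad_eq[OF bump_reflect_deriv(1)] inner_sum_right sum_negf)
    also have "(LINT y|lebesgue. - (g' y \<bullet> grad (\<lambda>y. bump c (x - y)) y)) = - \<Lambda> * (LINT y|lebesgue. Q \<Omega> y * u y * bump c (x - y))"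
      using weak[OF test_function_bump(1)[OF cd]] by simp
    also have "(LINT y|lebesgue. Q \<Omega> y * u y * bump c (x - y)) = (LINT y|lebesgue. bump c (x - y) * (Q \<Omega> y * u y))"
      by (simp add: mult_ac)
    also have "\<dots> = conv (bump c) (\<lambda>y. Q \<Omega> y * U y) x"
    proof (rule kernel_integral_lborel)
      have Qm: "Q \<Omega> \<in> borel_measurable borel"
      proof -
        have [measurable]: "\<Omega> \<in> sets borel" using \<Omega> by simp
        show ?thesis unfolding Q_def[abs_def] by measurable
      qed
      then have "Q \<Omega> \<in> borel_measurable lborel" by simp
      from measurable_completion[OF this] show "(\<lambda>y. Q \<Omega> y * u y) \<in> borel_measurable lebesgue" by measurable
      show "(\<lambda>y. Q \<Omega> y * U y) \<in> borel_measurable borel" using Qm by measurable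
      show "AE y in lebesgue. Q \<Omega> y * u y = Q \<Omega> y * U y" using uU by eventually_elim simp
    qed (rule bump_continuous)
    finally show "(\<Sum>b\<in>Basis. conv (bump2 c b b) U x) = - \<Lambda> * conv (bump c) (\<lambda>y. Q \<Omega> y * U y) x" .
  qed
qed

section \<open>Nonpositive parameters\<close>

lemma linear_eq_inner:
  fixes L :: "'a::euclidean_space \<Rightarrow> real"
  assumes "linear L"
  shows "L h = (\<Sum>b\<in>Basis. L b *\<^sub>R b) \<bullet> h"
proof -
  have "L h = L (\<Sum>b\<in>Basis. (h \<bullet> b) *\<^sub>R b)" by (simp add: euclidean_representation)
  also have "\<dots> = (\<Sum>b\<in>Basis. (h \<bullet> b) * L b)"
    by (simp add: linear_sum[OF assms] linear_scale[OF assms])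
  also have "\<dots> = (\<Sum>b\<in>Basis. L b *\<^sub>R b) \<bullet> h"
    unfolding inner_sum_left by (rule sum.cong) (simp_all add: inner_commute)
  finally show ?thesis .
qed

lemma linear_symmetric_on_Basis:
  fixes L :: "'a::euclidean_space \<Rightarrow> 'a"
  assumes L: "linear L" and sym: "\<And>b b'. b \<in> Basis \<Longrightarrow> b' \<in> Basis \<Longrightarrow> L b \<bullet> b' = b \<bullet> L b'"
  shows "L h \<bullet> k = h \<bullet> L k"
proof -
  have L_eq: "L h = (\<Sum>b\<in>Basis. (h \<bullet> b) *\<^sub>R L b)" for h
  proof -
    have "L h = L (\<Sum>b\<in>Basis. (h \<bullet> b) *\<^sub>R b)" by (simp add: euclidean_representation)
    then show ?thesis by (simp add: linear_sum[OF L] linear_scale[OF L])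
  qed
  have "L h \<bullet> b' = h \<bullet> L b'" if b': "b' \<in> Basis" for h b'
  proof -
    have "L h \<bullet> b' = (\<Sum>b\<in>Basis. (h \<bullet> b) * (L b \<bullet> b'))" by (subst L_eq) (simp add: inner_sum_left)
    also have "\<dots> = (\<Sum>b\<in>Basis. (h \<bullet> b) * (L b' \<bullet> b))"
      using sym b' by (intro sum.cong) (auto simp: inner_commute)
    also have "\<dots> = h \<bullet> L b'" by (simp add: euclidean_inner[of h "L b'"])
    finally show ?thesis .
  qed
  then have "L h \<bullet> k = (\<Sum>b\<in>Basis. (k \<bullet> b) * (h \<bullet> L b))"
    by (simp add: euclidean_inner[of "L h" k] mult.commute)
  also have "\<dots> = h \<bullet> L k" by (subst (2) L_eq) (simp add: inner_sum_right)
  finally show ?thesis .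
qed

text \<open>The derivatives of the mollification fall on the kernel, so the second derivative inherits its
  symmetry. Square integrability of the gradient holds because each of its components is also the
  mollification of the corresponding component of the weak gradient.\<close>

lemma mollified_solution:
  fixes U :: "'a::euclidean_space \<Rightarrow> real"
  assumes U[measurable]: "U \<in> borel_measurable borel" and U2: "integrable lborel (\<lambda>x. (U x)\<^sup>2)"
    and grad: "\<And>b. b \<in> Basis \<Longrightarrow> \<exists>h. h \<in> borel_measurable borel \<and> integrable lborel (\<lambda>x. (h x)\<^sup>2) \<and>
        (\<forall>c d x. c * d\<^sup>2 \<ge> 1 \<longrightarrow> c \<ge> 0 \<longrightarrow> d \<ge> 0 \<longrightarrow> conv (bump1 c b) U x = conv (bump c) h x)"
    and lap: "\<And>c d x. c * d\<^sup>2 \<ge> 1 \<Longrightarrow> c \<ge> 0 \<Longrightarrow> d \<ge> 0 \<Longrightarrow>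
        (\<Sum>b\<in>Basis. conv (bump2 c b b) U x) = l * conv (bump c) F x"
    and d: "d > 0"
  shows "\<exists>K p H. continuous_on UNIV K \<and> (\<forall>z. norm z \<ge> d \<longrightarrow> K z = 0) \<and> (\<forall>z. K z \<ge> 0) \<and> (LINT z|lborel. K z) = 1
    \<and> (\<forall>x. (conv K U has_derivative (\<lambda>h. p x \<bullet> h)) (at x)) \<and> (\<forall>x. (p has_derivative H x) (at x))
    \<and> (\<forall>x h k. H x h \<bullet> k = h \<bullet> H x k) \<and> (\<forall>h. continuous_on UNIV (\<lambda>x. H x h))
    \<and> integrable lborel (\<lambda>x. (norm (p x))\<^sup>2) \<and> (\<forall>x. tr (H x) = l * conv K F x)"
proof -
  define c where "c = 1 / d\<^sup>2"
  have cd: "c * d\<^sup>2 \<ge> 1" "c \<ge> 0" "d \<ge> 0" and c: "c > 0" using d by (auto simp: c_def)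
  define t where "t = 1 / (LINT z|lborel. bump c (z::'a))"
  note bi = bump_integral_pos[OF c cd(1,3), where 'a='a]
  have t: "t > 0" using bi(2) by (simp add: t_def)
  define K where "K z = t * bump c z" for z :: 'a
  define p where "p x = (\<Sum>b\<in>Basis. conv (\<lambda>z. t * bump1 c b z) U x *\<^sub>R b)" for x
  define H where "H x h = (\<Sum>b\<in>Basis. conv (\<lambda>z. t * bump2 c b h z) U x *\<^sub>R b)" for x h
  have conv_K: "conv K f x = t * conv (bump c) f x" for f x
    unfolding K_def[abs_def] by (rule conv_cmult)
  have contK: "continuous_on UNIV K" unfolding K_def[abs_def] by (intro continuous_intros bump_continuous)
  have supp: "K z = 0" "t * bump1 c h z = 0" "t * bump2 c h k z = 0" if "norm z \<ge> d" for z h k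
    using bump_zero[OF cd that] by (auto simp: K_def)
  have cont1: "continuous_on UNIV (\<lambda>z. t * bump1 c h z)" for h :: 'a by (intro continuous_intros bump_continuous)
  have cont2: "continuous_on UNIV (\<lambda>z. t * bump2 c h k z)" for h k :: 'a by (intro continuous_intros bump_continuous)
  have dw: "(conv K U has_derivative (\<lambda>h. p x \<bullet> h)) (at x)" for x
  proof -
    have D: "(conv K U has_derivative (\<lambda>h. conv (\<lambda>z. t * bump1 c h z) U x)) (at x)"
    proof (rule conv_has_derivative[OF _ cont1 supp(1) U U2])
      show "(K has_derivative (\<lambda>h. t * bump1 c h z)) (at z)" for z
        unfolding K_def[abs_def] by (intro has_derivative_mult_right bump_deriv)
    qed
    show ?thesis
      by (rule has_derivative_eq_rhs[OF D], rule ext, unfold p_def)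
        (rule linear_eq_inner[OF has_derivative_linear[OF D]])
  qed
  have d1: "(conv (\<lambda>z. t * bump1 c b z) U has_derivative (\<lambda>h. conv (\<lambda>z. t * bump2 c b h z) U x)) (at x)" for b x
    by (rule conv_has_derivative[OF _ cont2 supp(2) U U2]) (intro has_derivative_mult_right bump1_deriv)
  have dp: "(p has_derivative H x) (at x)" for x
    unfolding p_def[abs_def] H_def by (intro has_derivative_sum has_derivative_scaleR_left d1)
  have sym: "H x h \<bullet> k = h \<bullet> H x k" for x h k
  proof (rule linear_symmetric_on_Basis[OF has_derivative_linear[OF dp]])
    fix b b' :: 'a assume b: "b \<in> Basis" "b' \<in> Basis"
    show "H x b \<bullet> b' = b \<bullet> H x b'"
      unfolding H_def inner_sum_left_Basis[OF b(2)] inner_commute[of b] inner_sum_left_Basis[OF b(1)]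
      by (simp only: bump2_sym)
  qed
  have contH: "continuous_on UNIV (\<lambda>x. H x h)" for h
    unfolding H_def by (intro continuous_intros conv_continuous[OF cont2 supp(3) U U2])
  have K0: "K z \<ge> 0" for z using t bump_nonneg[of c z] by (simp add: K_def)
  have K1: "(LINT z|lborel. K z) = 1" using bi by (simp add: K_def t_def)
  have p2: "integrable lborel (\<lambda>x. (norm (p x))\<^sup>2)"
  proof -
    have "(norm (p x))\<^sup>2 = (\<Sum>b\<in>Basis. (conv (\<lambda>z. t * bump1 c b z) U x)\<^sup>2)" for x
    proof -
      have "(norm (p x))\<^sup>2 = (\<Sum>b\<in>Basis. (p x \<bullet> b) * (p x \<bullet> b))"
        by (simp add: power2_norm_eq_inner euclidean_inner[of "p x" "p x"])
      then show ?thesis by (simp add: p_def inner_sum_left_Basis power2_eq_square)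
    qed
    moreover have "integrable lborel (\<lambda>x. (conv (\<lambda>z. t * bump1 c b z) U x)\<^sup>2)" if b: "b \<in> Basis" for b
    proof -
      obtain h where h: "h \<in> borel_measurable borel" "integrable lborel (\<lambda>x. (h x)\<^sup>2)"
        "\<forall>c d x. c * d\<^sup>2 \<ge> 1 \<longrightarrow> c \<ge> 0 \<longrightarrow> d \<ge> 0 \<longrightarrow> conv (bump1 c b) U x = conv (bump c) h x"
        using grad[OF b] by (elim exE conjE)
      have "conv (\<lambda>z. t * bump1 c b z) U x = conv K h x" for x
        unfolding conv_K conv_cmult using h(3)[rule_format, OF cd] by simp
      then show ?thesis using conv_L2[OF contK supp(1) K0 K1 h(1,2)] by simp
    qed
    ultimately show ?thesis by (simp add: Bochner_Integration.integrable_sum)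
  qed
  have trH: "tr (H x) = l * conv K F x" for x
  proof -
    have "tr (H x) = t * (\<Sum>b\<in>Basis. conv (bump2 c b b) U x)"
      by (simp add: tr_def H_def inner_sum_left_Basis conv_cmult sum_distrib_left)
    then show ?thesis unfolding lap[OF cd] conv_K by simp
  qed
  show ?thesis
    by (intro exI[of _ K] exI[of _ p] exI[of _ H] conjI allI impI contK supp(1) K0 K1 dw dp sym contH p2 trH)
qed

text \<open>The field \<open>- w p\<close> has divergence \<open>- |p|\<^sup>2\<close>, so \<open>p\<close> vanishes and \<open>w\<close> is constant; a nonzero
  constant is not square integrable on a space of infinite measure.\<close>

lemma harmonic_C2_finite_energy:
  fixes w :: "'a::euclidean_space \<Rightarrow> real"
  assumes w: "\<And>x. (w has_derivative (\<lambda>h. p x \<bullet> h)) (at x)"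
    and p: "\<And>x. (p has_derivative H x) (at x)"
    and contH: "\<And>h. continuous_on UNIV (\<lambda>x. H x h)"
    and w2: "integrable lborel (\<lambda>x. (w x)\<^sup>2)" and p2: "integrable lborel (\<lambda>x. (norm (p x))\<^sup>2)"
    and harm: "\<And>x. tr (H x) = 0"
  shows "w x = 0"
proof -
  have cw: "continuous_on UNIV w" and cp: "continuous_on UNIV p"
    by (rule has_derivative_continuous_UNIV[OF w] has_derivative_continuous_UNIV[OF p])+
  define Z where "Z x = - (w x *\<^sub>R p x)" for x
  define Z' where "Z' x h = - (w x *\<^sub>R H x h + (p x \<bullet> h) *\<^sub>R p x)" for x h
  have "0 \<le> (LINT x|lborel. - (norm (p x))\<^sup>2)"
  proof (rule integral_nonneg_of_divergence_le[where Z=Z and Z'=Z' and l="\<lambda>x. (w x)\<^sup>2 + (norm (p x))\<^sup>2"])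
    show "(Z has_derivative Z' x) (at x)" for x
      unfolding Z_def[abs_def] Z'_def by (intro has_derivative_minus has_derivative_scaleR w p)
    show "continuous_on UNIV (\<lambda>x. Z' x b)" for b
      unfolding Z'_def by (intro continuous_intros cw cp contH)
    show "norm (Z x) \<le> (1 + norm x) * ((w x)\<^sup>2 + (norm (p x))\<^sup>2)" for x
    proof -
      have "2 * (\<bar>w x\<bar> * norm (p x)) \<le> (w x)\<^sup>2 + (norm (p x))\<^sup>2"
        using sum_squares_bound[of "\<bar>w x\<bar>" "norm (p x)"] by (simp add: mult.assoc)
      moreover have "0 \<le> \<bar>w x\<bar> * norm (p x)" by simp
      moreover have "norm (Z x) = \<bar>w x\<bar> * norm (p x)" by (simp add: Z_def)
      moreover have "a \<le> 1 * b" if "2 * a \<le> b" "0 \<le> a" for a b :: real using that by linarith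
      ultimately have "norm (Z x) \<le> 1 * ((w x)\<^sup>2 + (norm (p x))\<^sup>2)" by (simp only:)
      also have "\<dots> \<le> (1 + norm x) * ((w x)\<^sup>2 + (norm (p x))\<^sup>2)" by (intro mult_right_mono) auto
      finally show ?thesis .
    qed
    show "tr (Z' x) \<le> - (norm (p x))\<^sup>2" for x
      unfolding Z'_def tr_simps harm by (simp add: dot_square_norm)
  qed (use w2 p2 in auto)
  then have "(LINT x|lborel. (norm (p x))\<^sup>2) \<le> 0" by simp
  moreover have "0 \<le> (LINT x|lborel. (norm (p x))\<^sup>2)" by (rule integral_nonneg_AE) auto
  ultimately have "(LINT x|lborel. (norm (p x))\<^sup>2) = 0" by (rule antisym)
  then have "AE x in lborel. (norm (p x))\<^sup>2 = 0"
    using integral_nonneg_eq_0_iff_AE[OF p2] by simp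
  then have AE0: "AE x in lborel. p x = 0" by simp
  have p0: "p x = 0" for x
  proof (rule ccontr)
    assume "p x \<noteq> 0"
    have "open (p -` (- {0}))" by (rule open_vimage[OF _ cp]) auto
    then obtain e where e: "e > 0" "ball x e \<subseteq> p -` (- {0})"
      by (rule openE[of _ x]) (use \<open>p x \<noteq> 0\<close> in simp)
    have "AE y in lborel. y \<notin> ball x e" using AE0 by eventually_elim (use e(2) in auto)
    moreover have "(AE y in lborel. y \<notin> ball x e) \<longleftrightarrow> emeasure lborel (ball x e) = 0"
      by (rule AE_iff_measurable) auto
    ultimately have "emeasure lborel (ball x e) = 0" by (simp only:)
    then have "measure lborel (ball x e) = 0" by (simp add: measure_def)
    then show False using content_ball_pos[OF e(1), of x] by simp
  qed
  have "\<exists>c. \<forall>x\<in>UNIV. w x = c"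
    by (rule has_derivative_zero_constant) (use w in \<open>auto simp: p0\<close>)
  then obtain c where c: "\<And>x. w x = c" by auto
  have "integrable lborel (\<lambda>x::'a. c\<^sup>2)" using w2 by (simp add: c)
  then have "(\<integral>\<^sup>+x. ennreal (c\<^sup>2) \<partial>(lborel :: 'a measure)) < \<infinity>" by (simp add: integrable_iff_bounded)
  then have "c\<^sup>2 = 0" by (auto simp: ennreal_mult_top split: if_splits)
  then show ?thesis by (simp add: c)
qed

lemma AE_zero_of_L2_norm_zero:
  fixes U :: "'a::euclidean_space \<Rightarrow> real"
  assumes "integrable lborel (\<lambda>x. (U x)\<^sup>2)" and "(LINT x|lborel. (U x)\<^sup>2) \<le> 0"
  shows "AE x in lborel. U x = 0"
proof -
  have "0 \<le> (LINT x|lborel. (U x)\<^sup>2)" by (rule integral_nonneg_AE) auto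
  with assms(2) have "(LINT x|lborel. (U x)\<^sup>2) = 0" by simp
  then have "AE x in lborel. (U x)\<^sup>2 = 0" using integral_nonneg_eq_0_iff_AE[OF assms(1)] by simp
  then show ?thesis by simp
qed

text \<open>The centre is placed far enough from \<open>\<Omega>\<close> that all points within distance \<open>1\<close> of \<open>\<Omega>\<close> stay in the annulus. These
  are the points where the mollified right-hand side can be nonzero.\<close>

lemma annulus_centre:
  fixes \<Omega> :: "'a::euclidean_space set"
  assumes "bounded \<Omega>"
  shows "\<exists>c S::real. S \<ge> 1 \<and> (\<forall>x. \<forall>y\<in>\<Omega>. norm (x - y) < 1 \<longrightarrow> 1 \<le> (x - c) \<bullet> (x - c) \<and> (x - c) \<bullet> (x - c) \<le> S)"
proof -
  obtain \<rho> where \<rho>: "\<rho> > 0" "\<And>x. x \<in> \<Omega> \<Longrightarrow> norm x \<le> \<rho>"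
    using assms bounded_pos by metis
  obtain e :: 'a where e: "norm e = 1" using norm_Basis nonempty_Basis by blast
  define c where "c = (\<rho> + 2) *\<^sub>R e"
  have nc: "norm c = \<rho> + 2" using \<rho>(1) e by (simp add: c_def)
  show ?thesis
  proof (intro exI[of _ c] exI[of _ "(2 * \<rho> + 3)\<^sup>2"] conjI allI ballI impI)
    show "1 \<le> (2 * \<rho> + 3)\<^sup>2" using \<rho>(1) by simp
    fix x y assume y: "y \<in> \<Omega>" and xy: "norm (x - y) < 1"
    have "norm c - norm y - norm (x - y) \<le> norm (x - c)"
      using norm_triangle_ineq[of "c - x" "x - y"] norm_triangle_ineq[of "c - y" y] by (simp add: norm_minus_commute)
    then have lo: "1 \<le> norm (x - c)" using \<rho>(2)[OF y] xy nc by linarith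
    have "norm (x - c) \<le> norm (x - y) + norm (y - c)" using norm_triangle_ineq[of "x - y" "y - c"] by simp
    also have "norm (y - c) \<le> norm y + norm c" by (rule norm_triangle_ineq4)
    finally have hi: "norm (x - c) \<le> 2 * \<rho> + 3" using \<rho>(2)[OF y] xy nc by linarith
    show "1 \<le> (x - c) \<bullet> (x - c)" "(x - c) \<bullet> (x - c) \<le> (2 * \<rho> + 3)\<^sup>2"
      unfolding dot_square_norm using one_le_power[OF lo, of 2] power_mono[OF hi, of 2] by simp_all
  qed
qed

text \<open>For \<open>\<Lambda> < 0\<close>, the inequality for the mollifications \<open>conv (K n) U\<close> and their right-hand sides \<open>f n\<close> contains only
  integrals of squares against the bounded functions \<open>\<Theta>1\<close> and \<open>\<Theta>2\<close>, so it passes to the limit. In the limit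
  \<open>\<Theta>1 F\<^sup>2 + \<Theta>2 U\<^sup>2\<close> is bounded above by a negative multiple of \<open>U\<^sup>2\<close>.\<close>

lemma weak_solution_nonpos_vanishes:
  fixes \<Omega> :: "'a::euclidean_space set"
  assumes \<Omega>: "open \<Omega>" "bounded \<Omega>" and H1: "H1 u" and sol: "weak_solution \<Omega> \<Lambda> u" and \<Lambda>: "\<Lambda> \<le> 0"
  shows "AE x in lebesgue. u x = 0"
proof -
  obtain U where U[measurable]: "U \<in> borel_measurable borel" and U2: "integrable lborel (\<lambda>x. (U x)\<^sup>2)"
    and uU: "AE x in lebesgue. u x = U x"
    and grad: "\<forall>b\<in>Basis. \<exists>h. h \<in> borel_measurable borel \<and> integrable lborel (\<lambda>x. (h x)\<^sup>2) \<and>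
        (\<forall>c d x. c * d\<^sup>2 \<ge> 1 \<longrightarrow> c \<ge> 0 \<longrightarrow> d \<ge> 0 \<longrightarrow> conv (bump1 c b) U x = conv (bump c) h x)"
    and lap: "\<forall>c d x. c * d\<^sup>2 \<ge> 1 \<longrightarrow> c \<ge> 0 \<longrightarrow> d \<ge> 0 \<longrightarrow>
        (\<Sum>b\<in>Basis. conv (bump2 c b b) U x) = - \<Lambda> * conv (bump c) (\<lambda>y. Q \<Omega> y * U y) x"
    by (rule very_weak_solution[OF H1 sol \<Omega>(1)])
  define QU where "QU y = Q \<Omega> y * U y" for y
  have [measurable]: "\<Omega> \<in> sets borel" using \<Omega>(1) by simp
  have QU[measurable]: "QU \<in> borel_measurable borel"
    unfolding QU_def[abs_def] Q_def[abs_def] by measurable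
  have QU2: "integrable lborel (\<lambda>x. (QU x)\<^sup>2)"
  proof -
    have "(QU x)\<^sup>2 = (U x)\<^sup>2" for x by (simp add: QU_def Q_def)
    then show ?thesis using U2 by simp
  qed
  \<comment> \<open>The kernel radii stay at most \<open>1\<close>, the margin that \<open>annulus_centre\<close> provides.\<close>
  define r where "r n = inverse (real (Suc n))" for n
  have r0: "r n > 0" "r n \<le> 1" for n by (simp_all add: r_def inverse_le_1_iff)
  have "\<forall>n. \<exists>K p H. continuous_on UNIV K \<and> (\<forall>z. norm z \<ge> r n \<longrightarrow> K z = 0) \<and> (\<forall>z. K z \<ge> 0) \<and> (LINT z|lborel. K z) = 1
    \<and> (\<forall>x. (conv K U has_derivative (\<lambda>h. p x \<bullet> h)) (at x)) \<and> (\<forall>x. (p has_derivative H x) (at x))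
    \<and> (\<forall>x h k. H x h \<bullet> k = h \<bullet> H x k) \<and> (\<forall>h. continuous_on UNIV (\<lambda>x. H x h))
    \<and> integrable lborel (\<lambda>x. (norm (p x))\<^sup>2) \<and> (\<forall>x. tr (H x) = - \<Lambda> * conv K QU x)"
    (is "\<forall>n. \<exists>K p H. ?P n K p H")
    by (intro allI mollified_solution[OF U U2 grad[rule_format] lap[folded QU_def, rule_format] r0(1)])
  from choice[OF this] obtain K where "\<forall>n. \<exists>p H. ?P n (K n) p H" by (elim exE)
  from choice[OF this] obtain p where "\<forall>n. \<exists>H. ?P n (K n) (p n) H" by (elim exE)
  from choice[OF this] obtain H where P: "\<forall>n. ?P n (K n) (p n) (H n)" by (elim exE)
  have P': "?P n (K n) (p n) (H n)" for n using P by (rule spec)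
  note contK = P'[THEN conjunct1]
    and supp = P'[THEN conjunct2, THEN conjunct1, rule_format]
    and K0 = P'[THEN conjunct2, THEN conjunct2, THEN conjunct1, rule_format]
    and K1 = P'[THEN conjunct2, THEN conjunct2, THEN conjunct2, THEN conjunct1]
    and dw = P'[THEN conjunct2, THEN conjunct2, THEN conjunct2, THEN conjunct2, THEN conjunct1, rule_format]
    and dp = P'[THEN conjunct2, THEN conjunct2, THEN conjunct2, THEN conjunct2, THEN conjunct2, THEN conjunct1, rule_format]
    and sym = P'[THEN conjunct2, THEN conjunct2, THEN conjunct2, THEN conjunct2, THEN conjunct2, THEN conjunct2, THEN conjunct1, rule_format]
    and contH = P'[THEN conjunct2, THEN conjunct2, THEN conjunct2, THEN conjunct2, THEN conjunct2, THEN conjunct2, THEN conjunct2, THEN conjunct1, rule_format]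
    and p2 = P'[THEN conjunct2, THEN conjunct2, THEN conjunct2, THEN conjunct2, THEN conjunct2, THEN conjunct2, THEN conjunct2, THEN conjunct2, THEN conjunct1]
    and trH = P'[THEN conjunct2, THEN conjunct2, THEN conjunct2, THEN conjunct2, THEN conjunct2, THEN conjunct2, THEN conjunct2, THEN conjunct2, THEN conjunct2, rule_format]
  have w2: "integrable lborel (\<lambda>x. (conv (K n) U x)\<^sup>2)" for n
    by (rule conv_L2[OF contK supp K0 K1 U U2])
  have r_lim: "r \<longlonglongrightarrow> 0" unfolding r_def by (rule LIMSEQ_inverse_real_of_nat)
  have U_lim: "(\<lambda>n. LINT x|lborel. (conv (K n) U x - U x)\<^sup>2) \<longlonglongrightarrow> 0"
    by (rule mollify_tendsto[OF contK supp K0 K1 r_lim U U2])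
  have wm[measurable]: "conv (K n) U \<in> borel_measurable borel" for n
    by (rule borel_measurable_continuous_onI[OF conv_continuous[OF contK supp U U2]])
  have U_norm: "(LINT x|lborel. (U x)\<^sup>2) \<le> 0"
  proof (cases "\<Lambda> = 0")
    case True
    have "conv (K n) U x = 0" for n x
      by (rule harmonic_C2_finite_energy[OF dw dp contH w2 p2]) (simp add: trH True)
    then show ?thesis using U_lim by (simp add: LIMSEQ_const_iff)
  next
    case False
    define k where "k = sqrt (- \<Lambda>)"
    have k: "k > 0" "k\<^sup>2 = - \<Lambda>" using \<Lambda> False by (auto simp: k_def)
    obtain c S where S: "S \<ge> 1" and ann:
      "\<forall>x. \<forall>y\<in>\<Omega>. norm (x - y) < 1 \<longrightarrow> 1 \<le> (x - c) \<bullet> (x - c) \<and> (x - c) \<bullet> (x - c) \<le> S"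
      using annulus_centre[OF \<Omega>(2)] by (elim exE conjE)
    define \<nu> where "\<nu> = (real DIM('a) - 1) / 2"
    \<comment> \<open>On \<open>\<Omega>\<close> the limit of \<open>f n\<close> has square \<open>4 k\<^sup>4 U\<^sup>2\<close>, and this \<open>C\<close> makes \<open>(S + \<nu>) 4 k\<^sup>4 + \<nu> - C = - 1\<close>.\<close>
    define C where "C = \<nu> + (S + \<nu>) * (4 * k ^ 4) + 1"
    obtain \<Phi> a a' \<beta> \<beta>' A \<eta> where \<eta>: "\<eta> > 0" and W: "carleman_weight k S C \<Phi> a a' \<beta> \<beta>' A \<eta>"
      using carleman_weight_exists[OF k(1) S, of C] by (elim exE conjE)
    have W1: "(\<Phi> has_real_derivative a t / 2) (at t)" "\<bar>\<Phi> t\<bar> \<le> A" if "t \<ge> 0" for t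
      using W that unfolding carleman_weight_def by blast+
    define s where "s x = (x - c) \<bullet> (x - c)" for x
    have s0: "s x \<ge> 0" for x by (simp add: s_def)
    define F where "F y = k\<^sup>2 * (QU y + U y)" for y
    have F[measurable]: "F \<in> borel_measurable borel" unfolding F_def[abs_def] by measurable
    have F_eq: "F y = (if y \<in> \<Omega> then 2 * k\<^sup>2 * U y else 0)" for y
      by (simp add: F_def QU_def Q_def)
    have F2: "integrable lborel (\<lambda>x. (F x)\<^sup>2)"
      by (rule Bochner_Integration.integrable_bound[where f="\<lambda>x. (4 * k ^ 4) * (U x)\<^sup>2"])
        (use U2 in \<open>auto simp: F_eq power_mult_distrib\<close>)
    define f where "f n x = conv (K n) F x" for n x
    have f_eq: "f n x = tr (H n x) + k\<^sup>2 * conv (K n) U x" for n x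
    proof -
      have "f n x = k\<^sup>2 * (conv (K n) QU x + conv (K n) U x)"
        unfolding f_def F_def conv_def
        using conv_integrable[OF contK supp QU QU2, where x=x] conv_integrable[OF contK supp U U2, where x=x]
        by (simp add: distrib_left mult.left_commute flip: Bochner_Integration.integral_add Bochner_Integration.integral_mult_right_zero)
      then show ?thesis by (simp add: trH k(2) distrib_left)
    qed
    have fm[measurable]: "f n \<in> borel_measurable borel" for n
      unfolding f_def[abs_def] by (rule borel_measurable_continuous_onI[OF conv_continuous[OF contK supp F F2]])
    have f2: "integrable lborel (\<lambda>x. (f n x)\<^sup>2)" for n
      unfolding f_def by (rule conv_L2[OF contK supp K0 K1 F F2])
    have f_supp: "1 \<le> (x - c) \<bullet> (x - c) \<and> (x - c) \<bullet> (x - c) \<le> S" if "f n x \<noteq> 0" for n x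
    proof -
      have "\<exists>y. K n (x - y) * F y \<noteq> 0"
      proof (rule ccontr)
        assume "\<not> ?thesis"
        then have z: "K n (x - y) * F y = 0" for y by blast
        have "f n x = 0" unfolding f_def conv_def z by simp
        then show False using that by simp
      qed
      then obtain y where y: "K n (x - y) \<noteq> 0" "F y \<noteq> 0" by auto
      have "norm (x - y) < r n" using supp[of n "x - y"] y(1) by force
      then have "norm (x - y) < 1" using r0(2)[of n] by simp
      moreover have "y \<in> \<Omega>" using y(2) by (simp add: F_eq split: if_splits)
      ultimately show ?thesis using ann by blast
    qed
    define \<Theta>1 where "\<Theta>1 x = exp (2 * \<Phi> (s x)) * (S + \<nu>)" for x
    define \<Theta>2 where "\<Theta>2 x = exp (2 * \<Phi> (s x)) * (if 1 \<le> s x \<and> s x \<le> S then \<nu> - C else - \<eta>)" for x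
    have sm[measurable]: "s \<in> borel_measurable borel" unfolding s_def[abs_def] by measurable
    have cont\<Phi>: "continuous_on UNIV (\<lambda>x. \<Phi> (s x))"
    proof (rule continuous_on_compose2[of "{0..}" \<Phi>])
      show "continuous_on {0..} \<Phi>"
        using W1(1) by (intro continuous_at_imp_continuous_on ballI DERIV_isCont) auto
      show "continuous_on UNIV s" unfolding s_def[abs_def] by (intro continuous_intros)
    qed (use s0 in auto)
    have [measurable]: "(\<lambda>x. \<Phi> (s x)) \<in> borel_measurable borel" by (rule borel_measurable_continuous_onI[OF cont\<Phi>])
    have [measurable]: "\<Theta>1 \<in> borel_measurable borel" "\<Theta>2 \<in> borel_measurable borel"
      unfolding \<Theta>1_def[abs_def] \<Theta>2_def[abs_def] by measurable
    have eb: "exp (2 * \<Phi> (s x)) \<le> exp (2 * A)" "exp (- (2 * A)) \<le> exp (2 * \<Phi> (s x))" for x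
      using W1(2)[OF s0[of x]] by (auto simp: abs_le_iff)
    have b1: "\<bar>\<Theta>1 x\<bar> \<le> exp (2 * A) * \<bar>S + \<nu>\<bar>" for x
      using eb(1)[of x] by (simp add: \<Theta>1_def abs_mult mult_right_mono)
    have b2: "\<bar>\<Theta>2 x\<bar> \<le> exp (2 * A) * (\<bar>\<nu> - C\<bar> + \<bar>\<eta>\<bar>)" for x
    proof -
      have "\<bar>if 1 \<le> s x \<and> s x \<le> S then \<nu> - C else - \<eta>\<bar> \<le> \<bar>\<nu> - C\<bar> + \<bar>\<eta>\<bar>" by auto
      then have "exp (2 * \<Phi> (s x)) * \<bar>if 1 \<le> s x \<and> s x \<le> S then \<nu> - C else - \<eta>\<bar> \<le> exp (2 * A) * (\<bar>\<nu> - C\<bar> + \<bar>\<eta>\<bar>)"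
        by (rule mult_mono[OF eb(1)]) auto
      then show ?thesis by (simp only: \<Theta>2_def abs_mult abs_exp_cancel)
    qed
    have iT: "integrable lborel (\<lambda>x. T x * (v x)\<^sup>2)"
      if [measurable]: "T \<in> borel_measurable borel" "v \<in> borel_measurable borel"
        and "\<And>x. \<bar>T x\<bar> \<le> B" and "integrable lborel (\<lambda>x. (v x)\<^sup>2)" for T v :: "'a \<Rightarrow> real" and B
      by (rule Bochner_Integration.integrable_bound[where f="\<lambda>x. B * (v x)\<^sup>2"])
        (use that(3,4) in \<open>auto simp: abs_mult intro!: mult_mono order_trans[OF that(3) abs_ge_self]\<close>)
    have carleman: "0 \<le> (LINT x|lborel. \<Theta>1 x * (f n x)\<^sup>2) + (LINT x|lborel. \<Theta>2 x * (conv (K n) U x)\<^sup>2)" for n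
    proof -
      have "0 \<le> (LINT x|lborel. exp (2 * \<Phi> (s x)) * ((S + \<nu>) * (f n x)\<^sup>2)
         + exp (2 * \<Phi> (s x)) * (if 1 \<le> s x \<and> s x \<le> S then \<nu> - C else - \<eta>) * (conv (K n) U x)\<^sup>2)"
        unfolding s_def \<nu>_def
        by (rule carleman_inequality[OF dw dp sym contH w2 p2 f2 f_eq f_supp W])
      also have "\<dots> = (LINT x|lborel. \<Theta>1 x * (f n x)\<^sup>2 + \<Theta>2 x * (conv (K n) U x)\<^sup>2)"
        by (simp add: \<Theta>1_def \<Theta>2_def mult.assoc)
      also have "\<dots> = (LINT x|lborel. \<Theta>1 x * (f n x)\<^sup>2) + (LINT x|lborel. \<Theta>2 x * (conv (K n) U x)\<^sup>2)"
        by (intro Bochner_Integration.integral_add iT[OF _ _ b1 f2] iT[OF _ _ b2 w2]) measurable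
      finally show ?thesis .
    qed
    have F_lim: "(\<lambda>n. LINT x|lborel. (f n x - F x)\<^sup>2) \<longlonglongrightarrow> 0"
      unfolding f_def by (rule mollify_tendsto[OF contK supp K0 K1 r_lim F F2])
    have l1: "(\<lambda>n. LINT x|lborel. \<Theta>1 x * (f n x)\<^sup>2) \<longlonglongrightarrow> (LINT x|lborel. \<Theta>1 x * (F x)\<^sup>2)"
      by (rule weighted_L2_limit[OF fm F _ f2 F2 F_lim b1]) measurable
    have l2: "(\<lambda>n. LINT x|lborel. \<Theta>2 x * (conv (K n) U x)\<^sup>2) \<longlonglongrightarrow> (LINT x|lborel. \<Theta>2 x * (U x)\<^sup>2)"
      by (rule weighted_L2_limit[OF wm U _ w2 U2 U_lim b2]) measurable
    have "0 \<le> (LINT x|lborel. \<Theta>1 x * (F x)\<^sup>2) + (LINT x|lborel. \<Theta>2 x * (U x)\<^sup>2)"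
      by (rule LIMSEQ_le_const[OF tendsto_add[OF l1 l2]]) (use carleman in auto)
    also have "\<dots> = (LINT x|lborel. \<Theta>1 x * (F x)\<^sup>2 + \<Theta>2 x * (U x)\<^sup>2)"
      by (intro Bochner_Integration.integral_add[symmetric] iT[OF _ _ b1 F2] iT[OF _ _ b2 U2]) measurable
    also have "\<dots> \<le> (LINT x|lborel. - (exp (- (2 * A)) * min 1 \<eta>) * (U x)\<^sup>2)"
    proof (rule integral_mono)
      show "integrable lborel (\<lambda>x. \<Theta>1 x * (F x)\<^sup>2 + \<Theta>2 x * (U x)\<^sup>2)"
        by (intro Bochner_Integration.integrable_add iT[OF _ _ b1 F2] iT[OF _ _ b2 U2]) measurable
      show "integrable lborel (\<lambda>x. - (exp (- (2 * A)) * min 1 \<eta>) * (U x)\<^sup>2)" using U2 by simp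
      fix x
      define E where "E = exp (2 * \<Phi> (s x))"
      have \<nu>0: "\<nu> \<ge> 0" using DIM_positive[where 'a='a] by (simp add: \<nu>_def)
      have "\<Theta>1 x * (F x)\<^sup>2 + \<Theta>2 x * (U x)\<^sup>2 \<le> E * (- min 1 \<eta> * (U x)\<^sup>2)"
      proof (cases "x \<in> \<Omega>")
        case True
        then have B: "1 \<le> s x" "s x \<le> S" using ann[rule_format, of x x] by (auto simp: s_def)
        have "\<Theta>1 x * (F x)\<^sup>2 + \<Theta>2 x * (U x)\<^sup>2 = E * (((S + \<nu>) * (4 * k ^ 4) + \<nu> - C) * (U x)\<^sup>2)"
          using True B by (simp add: \<Theta>1_def \<Theta>2_def F_eq E_def power_mult_distrib algebra_simps)
        also have "(S + \<nu>) * (4 * k ^ 4) + \<nu> - C = - 1" by (simp add: C_def)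
        also have "E * (- 1 * (U x)\<^sup>2) \<le> E * (- min 1 \<eta> * (U x)\<^sup>2)"
          by (intro mult_left_mono mult_right_mono) (auto simp: E_def)
        finally show ?thesis .
      next
        case False
        have "0 \<le> (S + \<nu>) * (4 * k ^ 4)" using S \<nu>0 by simp
        then have "(if 1 \<le> s x \<and> s x \<le> S then \<nu> - C else - \<eta>) \<le> - min 1 \<eta>" by (auto simp: C_def)
        then have "E * ((if 1 \<le> s x \<and> s x \<le> S then \<nu> - C else - \<eta>) * (U x)\<^sup>2) \<le> E * (- min 1 \<eta> * (U x)\<^sup>2)"
          by (intro mult_left_mono mult_right_mono) (auto simp: E_def)
        then show ?thesis using False by (simp add: \<Theta>1_def \<Theta>2_def F_eq E_def mult.assoc)
      qed
      also have "\<dots> \<le> exp (- (2 * A)) * (- min 1 \<eta> * (U x)\<^sup>2)"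
        using eb(2)[of x] \<eta> by (intro mult_right_mono_neg) (auto simp: E_def)
      finally show "\<Theta>1 x * (F x)\<^sup>2 + \<Theta>2 x * (U x)\<^sup>2 \<le> - (exp (- (2 * A)) * min 1 \<eta>) * (U x)\<^sup>2"
        by (simp add: mult.assoc)
    qed
    also have "\<dots> = - (exp (- (2 * A)) * min 1 \<eta>) * (LINT x|lborel. (U x)\<^sup>2)" by simp
    finally have "(exp (- (2 * A)) * min 1 \<eta>) * (LINT x|lborel. (U x)\<^sup>2) \<le> 0" by simp
    moreover have "0 < exp (- (2 * A)) * min 1 \<eta>" using \<eta> by simp
    ultimately show ?thesis by (meson mult_pos_pos not_le)
  qed
  have "AE x in lborel. U x = 0" by (rule AE_zero_of_L2_norm_zero[OF U2 U_norm])
  then have "AE x in lebesgue. U x = 0" by (rule AE_completion)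
  with uU show ?thesis by eventually_elim simp
qed

theorem theorem1p8:
  fixes \<Omega> :: "(real ^ 'n) set" and \<Lambda> :: real and u :: "real ^ 'n \<Rightarrow> real"
  assumes "CARD('n) \<ge> 3"
    and "\<Omega> \<noteq> {}" and "open \<Omega>" and "bounded \<Omega>" and "smooth_boundary \<Omega>"
    and "H1 u" and "\<not> (AE x in lebesgue. u x = 0)"
    and "weak_solution \<Omega> \<Lambda> u"
    and "starlike \<Omega> \<or> disjoint_union_of_starshaped \<Omega>"
  shows "\<Lambda> > 0"
  using weak_solution_nonpos_vanishes[of \<Omega> u \<Lambda>] assms by force

end
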